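(* Let $A$ be a Poisson algebra over $k$. If the module of Kähler differentials $\Omega_A$ is a projective $A$-module, then there is an $A$-algebra isomorphism $$S_A(\Omega_A)\cong \mathrm{gr}_F\, A^e,$$ where $S_A(\Omega_A)$ is the symmetric $A$-algebra on $\Omega_A$, and $\mathrm{gr}_F A^e$ is the associated graded algebra of $A^e$ with respect to the filtration $\{F_nA^e\}_{n\ge0}$.
   Context: $k$ is a field. A Poisson algebra is a commutative $k$-algebra $A$ with a Lie bracket $\{\cdot,\cdot\}$ such that $\{a,bc\}=\{a,b\}c+b\{a,c\}$. $\Omega_A$ is the module of Kähler differentials of $A$ over $k$. Universal enveloping algebra: $A^e$ is the associative unital $k$-algebra generated by two copies $m_A=\{m_a:a\in A\}$ and $h_A=\{h_a:a\in A\}$ of the vector space $A$ ($a\mapsto m_a$ and $a\mapsto h_a$ being $k$-linear) subject to the relations, for all $x,y\in A$, $$m_{xy}=m_xm_y,\quad h_{\{x,y\}}=h_xh_y-h_yh_x,\quad h_{xy}=m_yh_x+m_xh_y,\quad m_{\{x,y\}}=h_xm_y-m_yh_x,\quad m_1=1.$$ The algebra map $m:A\to A^e$, $a\mapsto m_a$, is injective, and $a\in A$ is identified with $m_a$. Filtration: $F_nA^e$ is the left $A$-submodule of $A^e$ spanned by all products $h_{y_1}\cdots h_{y_s}$ with $0\le s\le n$ and $y_i\in A$ (so $F_0A^e=A$). This is Rinehart's filtration on the enveloping algebra $V(A,\Omega_A)$ of the Lie-Rinehart algebra $(A,\Omega_A)$ (with $V_n$ the left $A$-submodule generated by products of at most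 $n$ elements of the image of $\Omega_A$), transported through the algebra isomorphism $V(A,\Omega_A)\cong A^e$ sending $a\in A$ to $m_a$ and $da$ to $h_a$. *)

theory Defs
  imports "HOL-Algebra.Module" "HOL-Algebra.QuotRing"
begin

text \<open>
  Everything is carrier based. The record \<^typ>\<open>('r, 'm) module\<close> serves for modules and for
  (possibly noncommutative) algebras; for a mere module the fields \<^term>\<open>mult\<close> and
  \<^term>\<open>one\<close> are irrelevant and left \<^term>\<open>undefined\<close>. The zero ring is allowed.
\<close>

section \<open>Poisson algebras\<close>

locale poisson_algebra = K?: field K + algebra K A
  for K (structure) and A (structure) +
  fixes bracket :: "'c \<Rightarrow> 'c \<Rightarrow> 'c"
  assumes bracket_closed:
      "\<lbrakk>x \<in> carrier A; y \<in> carrier A\<rbrakk> \<Longrightarrow> bracket x y \<in> carrier A"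
    and bracket_add_left:
      "\<lbrakk>x \<in> carrier A; y \<in> carrier A; z \<in> carrier A\<rbrakk>
        \<Longrightarrow> bracket (x \<oplus>\<^bsub>A\<^esub> y) z = bracket x z \<oplus>\<^bsub>A\<^esub> bracket y z"
    and bracket_add_right:
      "\<lbrakk>x \<in> carrier A; y \<in> carrier A; z \<in> carrier A\<rbrakk>
        \<Longrightarrow> bracket x (y \<oplus>\<^bsub>A\<^esub> z) = bracket x y \<oplus>\<^bsub>A\<^esub> bracket x z"
    and bracket_smult_left:
      "\<lbrakk>c \<in> carrier K; x \<in> carrier A; y \<in> carrier A\<rbrakk>
        \<Longrightarrow> bracket (c \<odot>\<^bsub>A\<^esub> x) y = c \<odot>\<^bsub>A\<^esub> bracket x y"
    and bracket_smult_right: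
      "\<lbrakk>c \<in> carrier K; x \<in> carrier A; y \<in> carrier A\<rbrakk>
        \<Longrightarrow> bracket x (c \<odot>\<^bsub>A\<^esub> y) = c \<odot>\<^bsub>A\<^esub> bracket x y"
    and bracket_alternating: "x \<in> carrier A \<Longrightarrow> bracket x x = \<zero>\<^bsub>A\<^esub>"
    and bracket_jacobi:
      "\<lbrakk>x \<in> carrier A; y \<in> carrier A; z \<in> carrier A\<rbrakk>
        \<Longrightarrow> bracket x (bracket y z) \<oplus>\<^bsub>A\<^esub> bracket y (bracket z x) \<oplus>\<^bsub>A\<^esub> bracket z (bracket x y)
          = \<zero>\<^bsub>A\<^esub>"
    and bracket_leibniz:
      "\<lbrakk>x \<in> carrier A; y \<in> carrier A; z \<in> carrier A\<rbrakk>
        \<Longrightarrow> bracket x (y \<otimes>\<^bsub>A\<^esub> z) = (bracket x y \<otimes>\<^bsub>A\<^esub> z) \<oplus>\<^bsub>A\<^esub> (y \<otimes>\<^bsub>A\<^esub> bracket x z)"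


section \<open>Modules\<close>

definition module_hom ::
    "('r, 'p) ring_scheme \<Rightarrow> ('r, 'm, 'q) module_scheme \<Rightarrow> ('r, 'n, 's) module_scheme \<Rightarrow> ('m \<Rightarrow> 'n) set"
  where "module_hom R M N = {f. f \<in> carrier M \<rightarrow> carrier N
    \<and> (\<forall>x\<in>carrier M. \<forall>y\<in>carrier M. f (x \<oplus>\<^bsub>M\<^esub> y) = f x \<oplus>\<^bsub>N\<^esub> f y)
    \<and> (\<forall>r\<in>carrier R. \<forall>x\<in>carrier M. f (r \<odot>\<^bsub>M\<^esub> x) = r \<odot>\<^bsub>N\<^esub> f x)}"

text \<open>
  Projectivity is the lifting property against surjections \<open>N \<rightarrow> L\<close>. HOL cannot quantify over
  the types of \<open>N\<close> and \<open>L\<close> inside a definition. The types chosen below accommodate the free module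
  on the set underlying \<open>M\<close> as \<open>N\<close>, and \<open>M\<close> itself as \<open>L\<close>; lifting the identity of \<open>M\<close> along the
  canonical surjection makes \<open>M\<close> a direct summand of a free module, and from this the lifting
  property for modules over arbitrary types follows.
\<close>
definition projective_module :: "('r, 'p) ring_scheme \<Rightarrow> ('r, 'm) module \<Rightarrow> bool"
  where "projective_module R M \<longleftrightarrow> module R M \<and>
    (\<forall>(N :: ('r, 'm \<Rightarrow> 'r) module) (L :: ('r, 'm) module) g f.
       module R N \<longrightarrow> module R L \<longrightarrow> g \<in> module_hom R N L \<longrightarrow> g ` carrier N = carrier L \<longrightarrow>
       f \<in> module_hom R M L \<longrightarrow>
       (\<exists>h \<in> module_hom R M N. \<forall>x\<in>carrier M. g (h x) = f x))"

definition generated_submodule ::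
    "('r, 'p) ring_scheme \<Rightarrow> ('r, 'm, 'q) module_scheme \<Rightarrow> 'm set \<Rightarrow> 'm set"
  where "generated_submodule R M S = \<Inter>{N. submodule N R M \<and> S \<subseteq> N}"

definition quotient_module ::
    "('r, 'm, 'q) module_scheme \<Rightarrow> 'm set \<Rightarrow> ('r, 'm set) module"
  where "quotient_module M N =
    \<lparr>carrier = a_rcosets\<^bsub>M\<^esub> N, mult = undefined, one = undefined,
     zero = N, add = set_add M,
     smult = (\<lambda>r P. \<Union>x\<in>P. N +>\<^bsub>M\<^esub> (r \<odot>\<^bsub>M\<^esub> x))\<rparr>"

definition free_module :: "('r, 'p) ring_scheme \<Rightarrow> 'x set \<Rightarrow> ('r, 'x \<Rightarrow> 'r) module"
  where "free_module R X =
    \<lparr>carrier = {f. (\<forall>x. f x \<in> carrier R) \<and> (\<forall>x. x \<notin> X \<longrightarrow> f x = \<zero>\<^bsub>R\<^esub>)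
                   \<and> finite {x. f x \<noteq> \<zero>\<^bsub>R\<^esub>}},
     mult = undefined, one = undefined,
     zero = (\<lambda>x. \<zero>\<^bsub>R\<^esub>), add = (\<lambda>f g x. f x \<oplus>\<^bsub>R\<^esub> g x),
     smult = (\<lambda>r f x. r \<otimes>\<^bsub>R\<^esub> f x)\<rparr>"

definition free_basis :: "('r, 'p) ring_scheme \<Rightarrow> 'x \<Rightarrow> 'x \<Rightarrow> 'r"
  where "free_basis R x = (\<lambda>y. if y = x then \<one>\<^bsub>R\<^esub> else \<zero>\<^bsub>R\<^esub>)"


section \<open>Kaehler differentials\<close>

text \<open>The \<open>A\<close>-module on symbols \<open>dx\<close>, \<open>x \<in> A\<close>, with \<open>d\<close> made a \<open>K\<close>-linear derivation.\<close>

definition kaehler_relations ::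
    "('k, 'p) ring_scheme \<Rightarrow> ('k, 'a, 'q) module_scheme \<Rightarrow> ('a \<Rightarrow> 'a) set"
  where "kaehler_relations K A =
    (let F = free_module A (carrier A); d = free_basis A in
      {d (x \<oplus>\<^bsub>A\<^esub> y) \<ominus>\<^bsub>F\<^esub> (d x \<oplus>\<^bsub>F\<^esub> d y) | x y. x \<in> carrier A \<and> y \<in> carrier A}
    \<union> {d (c \<odot>\<^bsub>A\<^esub> x) \<ominus>\<^bsub>F\<^esub> ((c \<odot>\<^bsub>A\<^esub> \<one>\<^bsub>A\<^esub>) \<odot>\<^bsub>F\<^esub> d x) | c x. c \<in> carrier K \<and> x \<in> carrier A}
    \<union> {d (x \<otimes>\<^bsub>A\<^esub> y) \<ominus>\<^bsub>F\<^esub> ((x \<odot>\<^bsub>F\<^esub> d y) \<oplus>\<^bsub>F\<^esub> (y \<odot>\<^bsub>F\<^esub> d x)) | x y. x \<in> carrier A \<and> y \<in> carrier A})"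

definition kaehler ::
    "('k, 'p) ring_scheme \<Rightarrow> ('k, 'a, 'q) module_scheme \<Rightarrow> ('a, ('a \<Rightarrow> 'a) set) module"
  where "kaehler K A =
    (let F = free_module A (carrier A)
     in quotient_module F (generated_submodule A F (kaehler_relations K A)))"


section \<open>Associative algebras by generators and relations\<close>

text \<open>
  Elements of the free associative unital algebra over the commutative ring \<open>R\<close> on the set \<open>X\<close>
  are finitely supported coefficient functions on words over \<open>X\<close>; multiplication extends
  concatenation of words, so the coefficient at \<open>w\<close> sums over all splittings of \<open>w\<close>.
\<close>
definition free_algebra :: "('r, 'p) ring_scheme \<Rightarrow> 'x set \<Rightarrow> ('r, 'x list \<Rightarrow> 'r) module"
  where "free_algebra R X = (free_module R (lists X))
    \<lparr>mult := (\<lambda>f g w. \<Oplus>\<^bsub>R\<^esub>i\<in>{..length w}. f (take i w) \<otimes>\<^bsub>R\<^esub> g (drop i w)),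
     one := free_basis R []\<rparr>"

definition free_var :: "('r, 'p) ring_scheme \<Rightarrow> 'x \<Rightarrow> 'x list \<Rightarrow> 'r"
  where "free_var R x = free_basis R [x]"

definition quotient_algebra ::
    "('r, 'b, 'q) module_scheme \<Rightarrow> 'b set \<Rightarrow> ('r, 'b set) module"
  where "quotient_algebra B I = (quotient_module B I)
    \<lparr>mult := mult (B Quot I), one := one (B Quot I)\<rparr>"

text \<open>
  The ideal generated by the relations is two-sided (\<^const>\<open>genideal\<close>).
\<close>
definition presented_algebra ::
    "('r, 'p) ring_scheme \<Rightarrow> 'x set \<Rightarrow> ('x list \<Rightarrow> 'r) set \<Rightarrow> ('r, ('x list \<Rightarrow> 'r) set) module"
  where "presented_algebra R X rels =
    quotient_algebra (free_algebra R X) (Idl\<^bsub>free_algebra R X\<^esub> rels)"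

definition presented_var ::
    "('r, 'p) ring_scheme \<Rightarrow> 'x set \<Rightarrow> ('x list \<Rightarrow> 'r) set \<Rightarrow> 'x \<Rightarrow> ('x list \<Rightarrow> 'r) set"
  where "presented_var R X rels x =
    (Idl\<^bsub>free_algebra R X\<^esub> rels) +>\<^bsub>free_algebra R X\<^esub> free_var R x"


section \<open>The symmetric algebra of a module\<close>

text \<open>
  The first two families of relations make the free algebra on the set \<open>M\<close> into the tensor algebra
  of the \<open>R\<close>-module \<open>M\<close>, the third one divides out the commutators \<open>u \<otimes> v - v \<otimes> u\<close>.
\<close>
definition symmetric_relations ::
    "('r, 'p) ring_scheme \<Rightarrow> ('r, 'm, 'q) module_scheme \<Rightarrow> ('m list \<Rightarrow> 'r) set"
  where "symmetric_relations R M =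
    (let F = free_algebra R (carrier M); v = free_var R in
      {v (x \<oplus>\<^bsub>M\<^esub> y) \<ominus>\<^bsub>F\<^esub> (v x \<oplus>\<^bsub>F\<^esub> v y) | x y. x \<in> carrier M \<and> y \<in> carrier M}
    \<union> {v (r \<odot>\<^bsub>M\<^esub> x) \<ominus>\<^bsub>F\<^esub> (r \<odot>\<^bsub>F\<^esub> v x) | r x. r \<in> carrier R \<and> x \<in> carrier M}
    \<union> {(v x \<otimes>\<^bsub>F\<^esub> v y) \<ominus>\<^bsub>F\<^esub> (v y \<otimes>\<^bsub>F\<^esub> v x) | x y. x \<in> carrier M \<and> y \<in> carrier M})"

definition symmetric_algebra ::
    "('r, 'p) ring_scheme \<Rightarrow> ('r, 'm, 'q) module_scheme \<Rightarrow> ('r, ('m list \<Rightarrow> 'r) set) module"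
  where "symmetric_algebra R M = presented_algebra R (carrier M) (symmetric_relations R M)"


section \<open>The universal enveloping algebra of a Poisson algebra\<close>

datatype 'a env_gen = GenM 'a | GenH 'a

definition env_gens :: "('k, 'a, 'q) module_scheme \<Rightarrow> 'a env_gen set"
  where "env_gens A = GenM ` carrier A \<union> GenH ` carrier A"

text \<open>The first four families say that \<open>m\<close> and \<open>h\<close> are \<open>K\<close>-linear.\<close>

definition env_relations ::
    "('k, 'p) ring_scheme \<Rightarrow> ('k, 'a, 'q) module_scheme \<Rightarrow> ('a \<Rightarrow> 'a \<Rightarrow> 'a)
      \<Rightarrow> ('a env_gen list \<Rightarrow> 'k) set"
  where "env_relations K A br =
    (let F = free_algebra K (env_gens A);
         m = (\<lambda>x. free_var K (GenM x)); h = (\<lambda>x. free_var K (GenH x)) in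
      {m (x \<oplus>\<^bsub>A\<^esub> y) \<ominus>\<^bsub>F\<^esub> (m x \<oplus>\<^bsub>F\<^esub> m y) | x y. x \<in> carrier A \<and> y \<in> carrier A}
    \<union> {m (c \<odot>\<^bsub>A\<^esub> x) \<ominus>\<^bsub>F\<^esub> (c \<odot>\<^bsub>F\<^esub> m x) | c x. c \<in> carrier K \<and> x \<in> carrier A}
    \<union> {h (x \<oplus>\<^bsub>A\<^esub> y) \<ominus>\<^bsub>F\<^esub> (h x \<oplus>\<^bsub>F\<^esub> h y) | x y. x \<in> carrier A \<and> y \<in> carrier A}
    \<union> {h (c \<odot>\<^bsub>A\<^esub> x) \<ominus>\<^bsub>F\<^esub> (c \<odot>\<^bsub>F\<^esub> h x) | c x. c \<in> carrier K \<and> x \<in> carrier A}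
    \<union> {m (x \<otimes>\<^bsub>A\<^esub> y) \<ominus>\<^bsub>F\<^esub> (m x \<otimes>\<^bsub>F\<^esub> m y) | x y. x \<in> carrier A \<and> y \<in> carrier A}
    \<union> {h (br x y) \<ominus>\<^bsub>F\<^esub> ((h x \<otimes>\<^bsub>F\<^esub> h y) \<ominus>\<^bsub>F\<^esub> (h y \<otimes>\<^bsub>F\<^esub> h x)) | x y. x \<in> carrier A \<and> y \<in> carrier A}
    \<union> {h (x \<otimes>\<^bsub>A\<^esub> y) \<ominus>\<^bsub>F\<^esub> ((m y \<otimes>\<^bsub>F\<^esub> h x) \<oplus>\<^bsub>F\<^esub> (m x \<otimes>\<^bsub>F\<^esub> h y)) | x y. x \<in> carrier A \<and> y \<in> carrier A}
    \<union> {m (br x y) \<ominus>\<^bsub>F\<^esub> ((h x \<otimes>\<^bsub>F\<^esub> m y) \<ominus>\<^bsub>F\<^esub> (m y \<otimes>\<^bsub>F\<^esub> h x)) | x y. x \<in> carrier A \<and> y \<in> carrier A}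
    \<union> {m \<one>\<^bsub>A\<^esub> \<ominus>\<^bsub>F\<^esub> \<one>\<^bsub>F\<^esub>})"

definition poisson_env ::
    "('k, 'p) ring_scheme \<Rightarrow> ('k, 'a, 'q) module_scheme \<Rightarrow> ('a \<Rightarrow> 'a \<Rightarrow> 'a)
      \<Rightarrow> ('k, ('a env_gen list \<Rightarrow> 'k) set) module"
  where "poisson_env K A br = presented_algebra K (env_gens A) (env_relations K A br)"

definition env_m ::
    "('k, 'p) ring_scheme \<Rightarrow> ('k, 'a, 'q) module_scheme \<Rightarrow> ('a \<Rightarrow> 'a \<Rightarrow> 'a)
      \<Rightarrow> 'a \<Rightarrow> ('a env_gen list \<Rightarrow> 'k) set"
  where "env_m K A br x = presented_var K (env_gens A) (env_relations K A br) (GenM x)"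

definition env_h ::
    "('k, 'p) ring_scheme \<Rightarrow> ('k, 'a, 'q) module_scheme \<Rightarrow> ('a \<Rightarrow> 'a \<Rightarrow> 'a)
      \<Rightarrow> 'a \<Rightarrow> ('a env_gen list \<Rightarrow> 'k) set"
  where "env_h K A br x = presented_var K (env_gens A) (env_relations K A br) (GenH x)"

text \<open>
  The ring underlying \<^const>\<open>poisson_env\<close>, now as a left \<open>A\<close>-module via \<open>m\<close>. It is not an
  \<open>A\<close>-algebra: \<open>m\<close> is not central in general.
\<close>
definition poisson_env_left ::
    "('k, 'p) ring_scheme \<Rightarrow> ('k, 'a, 'q) module_scheme \<Rightarrow> ('a \<Rightarrow> 'a \<Rightarrow> 'a)
      \<Rightarrow> ('a, ('a env_gen list \<Rightarrow> 'k) set) module"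
  where "poisson_env_left K A br =
    (let E = poisson_env K A br in
      \<lparr>carrier = carrier E, mult = mult E, one = one E, zero = zero E, add = add E,
       smult = (\<lambda>a u. env_m K A br a \<otimes>\<^bsub>E\<^esub> u)\<rparr>)"

definition env_filtration ::
    "('k, 'p) ring_scheme \<Rightarrow> ('k, 'a, 'q) module_scheme \<Rightarrow> ('a \<Rightarrow> 'a \<Rightarrow> 'a)
      \<Rightarrow> nat \<Rightarrow> ('a env_gen list \<Rightarrow> 'k) set set"
  where "env_filtration K A br n =
    (let E = poisson_env_left K A br in
      generated_submodule A E
        {foldr (\<lambda>y u. env_h K A br y \<otimes>\<^bsub>E\<^esub> u) ys \<one>\<^bsub>E\<^esub> | ys.
           ys \<in> lists (carrier A) \<and> length ys \<le> n})"


section \<open>Associated graded algebras\<close>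

text \<open>
  \<open>E\<close> is a ring with a left action of the scalars and \<open>F\<close> an increasing multiplicative filtration
  of \<open>E\<close> by submodules, with the convention that \<open>F (-1)\<close> is zero.
\<close>

definition filt_pred :: "('r, 'e, 'q) module_scheme \<Rightarrow> (nat \<Rightarrow> 'e set) \<Rightarrow> nat \<Rightarrow> 'e set"
  where "filt_pred E F n = (case n of 0 \<Rightarrow> {\<zero>\<^bsub>E\<^esub>} | Suc i \<Rightarrow> F i)"

definition gr_piece ::
    "('r, 'e, 'q) module_scheme \<Rightarrow> (nat \<Rightarrow> 'e set) \<Rightarrow> nat \<Rightarrow> ('r, 'e set) module"
  where "gr_piece E F n = quotient_module (E\<lparr>carrier := F n\<rparr>) (filt_pred E F n)"

text \<open>
  An element of the direct sum of the pieces is a finitely supported family of homogeneous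
  components. The product of \<open>x + F (i - 1)\<close> and \<open>y + F (j - 1)\<close> is \<open>xy + F (i + j - 1)\<close>, which is
  what \<^const>\<open>rcoset_mult\<close> with respect to \<open>F (i + j - 1)\<close> computes.
\<close>
definition gr_algebra ::
    "('r, 'e, 'q) module_scheme \<Rightarrow> (nat \<Rightarrow> 'e set) \<Rightarrow> ('r, nat \<Rightarrow> 'e set) module"
  where "gr_algebra E F =
    \<lparr>carrier = {u. (\<forall>n. u n \<in> carrier (gr_piece E F n))
                   \<and> finite {n. u n \<noteq> \<zero>\<^bsub>gr_piece E F n\<^esub>}},
     mult = (\<lambda>u v n. \<Oplus>\<^bsub>gr_piece E F n\<^esub>i\<in>{..n}. rcoset_mult E (filt_pred E F n) (u i) (v (n - i))),
     one = (\<lambda>n. if n = 0 then filt_pred E F 0 +>\<^bsub>E\<^esub> \<one>\<^bsub>E\<^esub> else \<zero>\<^bsub>gr_piece E F n\<^esub>),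
     zero = (\<lambda>n. \<zero>\<^bsub>gr_piece E F n\<^esub>),
     add = (\<lambda>u v n. u n \<oplus>\<^bsub>gr_piece E F n\<^esub> v n),
     smult = (\<lambda>r u n. r \<odot>\<^bsub>gr_piece E F n\<^esub> u n)\<rparr>"


section \<open>Isomorphisms of commutative algebras\<close>

text \<open>Both sides are required to be commutative \<open>R\<close>-algebras (locale \<^locale>\<open>algebra\<close>).\<close>

definition algebra_isomorphic ::
    "('r, 'p) ring_scheme \<Rightarrow> ('r, 'm, 'q) module_scheme \<Rightarrow> ('r, 'n, 's) module_scheme \<Rightarrow> bool"
  where "algebra_isomorphic R S T \<longleftrightarrow> algebra R S \<and> algebra R T \<and>
    (\<exists>f \<in> ring_iso S T. \<forall>r\<in>carrier R. \<forall>x\<in>carrier S. f (r \<odot>\<^bsub>S\<^esub> x) = r \<odot>\<^bsub>T\<^esub> f x)"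

end

theory Submission
  imports Defs "HOL-Library.Poly_Mapping" "HOL-Library.Multiset"
begin

text \<open>
  The factors of \<open>h y\<^sub>1 \<dots> h y\<^sub>n\<close> commute modulo lower filtration, which gives a surjection from
  the symmetric algebra to the graded algebra. Its injectivity is the Poincare-Birkhoff-Witt theorem of Rinehart:
  it suffices to let the enveloping algebra act on a polynomial ring such that \<open>h y\<close> is
  multiplication by \<open>dy\<close> up to terms of lower degree, because the leading term of \<open>u \<cdot> 1\<close> then
  recovers the symbol of \<open>u\<close>. For a Lie-Rinehart algebra that is free as a module, the action is
  defined recursively with the help of a total order of the basis, as for Lie algebras over a
  field. The differentials form a projective Lie-Rinehart algebra \<open>L\<close>; this is a retract of the
  semidirect product of \<open>L\<close> with a large free module \<open>F\<close> on which \<open>L\<close> acts by a flat connection,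
  and \<open>L \<oplus> F\<close> is free by an Eilenberg swindle.
\<close>

section \<open>Free Lie-Rinehart algebras acting on polynomials\<close>

text \<open>Injectivity needs only a left inverse of the symbol map, so no embedding or retraction
  of enveloping algebras is ever constructed. The left inverse has three steps: let \<open>u\<close>
  act on the constant polynomial \<open>v0\<close>, keep the part of top degree, and send every
  variable \<open>(n, x)\<close> to the class of \<open>dx\<close> in the symmetric algebra of the
  differentials (\<open>piS\<close>). The enveloping algebra acts through \<open>L\<close>, which
  sits in copy 0 of \<open>F\<close>.

  Projectivity enters once, as a section of the canonical map from the free module on the symbols
  \<open>dx\<close>. The bracket of differentials is not built on the quotient but in the
  coordinates of that free module, with values in the image of the idempotent given by the section.
  That it descends to differentials amounts to two kernel conditions, which are checked on the
  Kaehler relations.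

  The graded algebra is an algebra over \<open>A\<close> although the enveloping algebra is not:
  commutators with scalars have lower filtration.\<close>

definition scl :: "'r::comm_ring_1 \<Rightarrow> ('k \<Rightarrow>\<^sub>0 'r) \<Rightarrow> 'k \<Rightarrow>\<^sub>0 'r"
  where "scl r f = Poly_Mapping.map ((*) r) f"

lemma lookup_scl [simp]: "Poly_Mapping.lookup (scl r f) k = r * Poly_Mapping.lookup f k"
  unfolding scl_def by (transfer) (simp add: when_def)

lemma scl_simps [simp]:
  "scl 0 f = 0" "scl r 0 = 0" "scl 1 f = f" "scl r (Poly_Mapping.single k s) = Poly_Mapping.single k (r * s)"
  "scl r (scl s f) = scl (r * s) f" "scl r (- f) = - scl r f" "scl (- r) f = - scl r f"
  by (rule poly_mapping_eqI; simp add: lookup_single when_def mult.assoc)+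

lemma scl_distribs:
  "scl r (f + g) = scl r f + scl r g" "scl (r + s) f = scl r f + scl s f"
  "scl r (f - g) = scl r f - scl r g" "scl (r - s) f = scl r f - scl s f"
  by (rule poly_mapping_eqI; simp add: lookup_add lookup_minus algebra_simps)+

lemma scl_sum: "scl r (\<Sum>i\<in>I. f i) = (\<Sum>i\<in>I. scl r (f i))"
  by (induction I rule: infinite_finite_induct) (simp_all add: scl_distribs)

text \<open>The function \<open>t\<close> receives the coefficient as a second argument because
  several extensions below are additive without being linear: operators that act as derivations also
  differentiate the coefficient.\<close>

definition lext :: "('k \<Rightarrow> 'r::zero \<Rightarrow> 'w) \<Rightarrow> ('k \<Rightarrow>\<^sub>0 'r) \<Rightarrow> 'w::comm_monoid_add"
  where "lext t f = (\<Sum>k\<in>Poly_Mapping.keys f. t k (Poly_Mapping.lookup f k))"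

lemma lext_zero [simp]: "lext t 0 = 0"
  by (simp add: lext_def)

lemma lext_superset:
  assumes "\<And>k. t k 0 = 0" "finite S" "Poly_Mapping.keys f \<subseteq> S"
  shows "lext t f = (\<Sum>k\<in>S. t k (Poly_Mapping.lookup f k))"
  unfolding lext_def using assms
  by (intro sum.mono_neutral_left) (auto simp: in_keys_iff)

lemma lext_single [simp]: "t k 0 = 0 \<Longrightarrow> lext t (Poly_Mapping.single k r) = t k r"
  by (simp add: lext_def)

lemma lext_add:
  assumes "\<And>k. t k 0 = 0" "\<And>k a b. t k (a + b) = t k a + t k b"
  shows "lext t (f + g) = lext t f + lext t g"
proof -
  let ?S = "Poly_Mapping.keys f \<union> Poly_Mapping.keys g"
  have "Poly_Mapping.keys (f + g) \<subseteq> ?S" by (rule keys_add)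
  then show ?thesis
    using assms by (simp add: lext_superset[of t ?S] lookup_add sum.distrib)
qed

lemma lext_cong: "(\<And>k. k \<in> Poly_Mapping.keys f \<Longrightarrow> t k (Poly_Mapping.lookup f k) = t' k (Poly_Mapping.lookup f k)) \<Longrightarrow> lext t f = lext t' f"
  by (simp add: lext_def)

lemma lext_add_fun: "lext (\<lambda>k r. t k r + t' k r) f = lext t f + lext t' f"
  by (simp add: lext_def sum.distrib)

lemma lext_scl:
  assumes "\<And>k. t k 0 = 0" "\<And>k a. t k (r * a) = scl r (t k a)"
  shows "lext t (scl r f) = scl r (lext t f)"
proof -
  have "Poly_Mapping.keys (scl r f) \<subseteq> Poly_Mapping.keys f" by (auto simp: in_keys_iff)
  then show ?thesis
    using assms by (simp add: lext_superset[of t "Poly_Mapping.keys f"] scl_sum)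
qed

lemma poly_mapping_sum_single: "f = lext Poly_Mapping.single f"
proof (rule poly_mapping_eqI)
  fix k
  have "Poly_Mapping.lookup (lext Poly_Mapping.single f) k = (\<Sum>j\<in>Poly_Mapping.keys f. if j = k then Poly_Mapping.lookup f j else 0)"
    unfolding lext_def lookup_sum by (intro sum.cong) (auto simp: lookup_single when_def)
  then show "Poly_Mapping.lookup f k = Poly_Mapping.lookup (lext Poly_Mapping.single f) k"
    by (auto simp: in_keys_iff)
qed

lemma poly_mapping_add_induct [case_names zero single add]:
  fixes f :: "'k \<Rightarrow>\<^sub>0 'r::comm_monoid_add"
  assumes "P 0" "\<And>k r. P (Poly_Mapping.single k r)" "\<And>f g. P f \<Longrightarrow> P g \<Longrightarrow> P (f + g)"
  shows "P f"
proof -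
  have "P (\<Sum>k\<in>S. Poly_Mapping.single k (Poly_Mapping.lookup f k))" for S
    using assms by (induction S rule: infinite_finite_induct) auto
  then show ?thesis
    using poly_mapping_sum_single[of f] unfolding lext_def by metis
qed

lemma poly_mapping_keys_induct [consumes 1, case_names zero single add]:
  fixes f :: "'k \<Rightarrow>\<^sub>0 'r::comm_monoid_add"
  assumes "Poly_Mapping.keys f \<subseteq> S" "P 0" "\<And>k r. k \<in> S \<Longrightarrow> P (Poly_Mapping.single k r)" "\<And>f g. P f \<Longrightarrow> P g \<Longrightarrow> P (f + g)"
  shows "P f"
proof -
  have "T \<subseteq> S \<Longrightarrow> P (\<Sum>k\<in>T. Poly_Mapping.single k (Poly_Mapping.lookup f k))" for T
    using assms(2-) by (induction T rule: infinite_finite_induct) auto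
  then show ?thesis
    using poly_mapping_sum_single[of f] assms(1) unfolding lext_def by metis
qed

definition single1 :: "'k \<Rightarrow> 'k \<Rightarrow>\<^sub>0 'r::comm_ring_1"
  where "single1 k = Poly_Mapping.single k 1"

lemma single_eq_scl: "Poly_Mapping.single k r = scl r (single1 k)"
  by (simp add: single1_def)

text \<open>A Lie-Rinehart algebra whose module is free on the type \<open>'i\<close> over
  \<open>'r\<close>, with anchor \<open>anc\<close>. The order \<open>le\<close> selects the ordered
  products that serve as normal forms.\<close>

locale free_lie_rinehart =
  fixes le :: "'i \<Rightarrow> 'i \<Rightarrow> bool"
    and br :: "('i \<Rightarrow>\<^sub>0 'r::comm_ring_1) \<Rightarrow> ('i \<Rightarrow>\<^sub>0 'r) \<Rightarrow> 'i \<Rightarrow>\<^sub>0 'r"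
    and anc :: "('i \<Rightarrow>\<^sub>0 'r) \<Rightarrow> 'r \<Rightarrow> 'r"
  assumes le_refl: "le i i" and le_antisym: "le i j \<Longrightarrow> le j i \<Longrightarrow> i = j"
    and le_trans: "le i j \<Longrightarrow> le j k \<Longrightarrow> le i k" and le_total: "le i j \<or> le j i"
    and anc_add: "anc (x + y) r = anc x r + anc y r" and anc_scl: "anc (scl s x) r = s * anc x r"
    and anc_add_right: "anc x (r + s) = anc x r + anc x s"
    and anc_mult: "anc x (r * s) = anc x r * s + r * anc x s"
    and br_add_right: "br x (y + z) = br x y + br x z"
    and br_scl_right: "br x (scl r y) = scl r (br x y) + scl (anc x r) y"
    and br_alt: "br x x = 0"
    and br_add_left: "br (x + y) z = br x z + br y z"
    and br_jacobi: "br x (br y z) + br y (br z x) + br z (br x y) = 0"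
    and anc_br: "anc (br x y) r = anc x (anc y r) - anc y (anc x r)"
begin

lemma br_anti: "br y x = - br x y"
proof -
  have "br (x + y) (x + y) = br x y + br y x"
    unfolding br_add_left br_add_right by (simp add: br_alt)
  then show ?thesis by (simp add: br_alt eq_neg_iff_add_eq_0 add.commute)
qed

lemma br_scl_left: "br (scl r x) y = scl r (br x y) - scl (anc y r) x"
  by (simp add: br_anti[of "scl r x" y] br_scl_right br_anti[of y x])

lemma anc_zero [simp]: "anc x 0 = 0" "anc 0 r = 0" "anc x 1 = 0"
  using anc_add_right[of x 0 0] anc_add[of 0 0 r] anc_mult[of x 1 1] by auto

section \<open>Recursive construction of the operators, with degree bounds\<close>

abbreviation gen :: "'i \<Rightarrow> 'i \<Rightarrow>\<^sub>0 'r" where "gen \<equiv> single1"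
abbreviation mon :: "'i multiset \<Rightarrow> 'i multiset \<Rightarrow>\<^sub>0 'r" where "mon \<equiv> single1"

text \<open>The second summand differentiates the coefficient, as the Leibniz rule
  \<open>op1_scl\<close> demands. The values \<open>A\<close> on monomials are a parameter because
  the recursion for \<open>corr\<close> applies an operator that is known only up to some
  degree.\<close>

definition op1 :: "('i multiset \<Rightarrow> 'i multiset \<Rightarrow>\<^sub>0 'r) \<Rightarrow> 'i
    \<Rightarrow> ('i multiset \<Rightarrow>\<^sub>0 'r) \<Rightarrow> 'i multiset \<Rightarrow>\<^sub>0 'r"
  where "op1 A i v = lext (\<lambda>m r. scl r (A m) + Poly_Mapping.single m (anc (gen i) r)) v"

lemma op1_zero [simp]: "op1 A i 0 = 0"
  by (simp add: op1_def)

lemma op1_add: "op1 A i (v + w) = op1 A i v + op1 A i w"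
  unfolding op1_def by (intro lext_add) (simp_all add: scl_distribs anc_add_right single_add)

lemma op1_minus: "op1 A i (v - w) = op1 A i v - op1 A i w"
  using op1_add[of A i "v - w" w] by simp

lemma op1_mon [simp]: "op1 A i (mon m) = A m"
  unfolding op1_def single1_def by simp

lemma op1_single: "op1 A i (Poly_Mapping.single m r) = scl r (A m) + Poly_Mapping.single m (anc (gen i) r)"
  unfolding op1_def by simp

lemma op1_scl: "op1 A i (scl r v) = scl r (op1 A i v) + scl (anc (gen i) r) v"
  by (induction v rule: poly_mapping_add_induct)
    (simp_all add: op1_single scl_distribs anc_mult op1_add single_add ac_simps)

text \<open>Consulted only for nonempty multisets: \<open>corr\<close> settles the empty one in its
  case where \<open>i\<close> is below all of \<open>m\<close>.\<close>

definition least :: "'i multiset \<Rightarrow> 'i"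
  where "least m = (THE i. i \<in># m \<and> (\<forall>k\<in>#m. le i k))"

lemma least_add: "\<forall>k\<in>#m. le j k \<Longrightarrow> least (add_mset j m) = j"
  unfolding least_def by (rule the_equality) (auto intro: le_refl le_antisym)

lemma ex_least: "m \<noteq> {#} \<Longrightarrow> \<exists>j m'. m = add_mset j m' \<and> (\<forall>k\<in>#m'. le j k)"
proof (induction m)
  case (add x m)
  show ?case
  proof (cases "m = {#}")
    case False
    then obtain j m' where m: "m = add_mset j m'" "\<forall>k\<in>#m'. le j k"
      using add.IH by auto
    show ?thesis
    proof (cases "le x j")
      case True
      then have "\<forall>k\<in>#m. le x k" using m by (auto intro: le_trans)
      then show ?thesis by auto
    next
      case F: False
      then have "le j x" using le_total by blast
      then have "add_mset x m = add_mset j (add_mset x m') \<and> (\<forall>k\<in>#add_mset x m'. le j k)"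
        using m by (auto simp: add_mset_commute)
      then show ?thesis by blast
    qed
  qed auto
qed auto

text \<open>
  \<open>gen i\<close> acts on a monomial \<open>m\<close> as multiplication by \<open>i\<close> plus a correction of degree at most
  that of \<open>m\<close>. The correction recurses through corrections of lower-degree monomials, so
  the recursion is run on a degree bound (the first argument).
\<close>
primrec corr :: "nat \<Rightarrow> 'i \<Rightarrow> 'i multiset \<Rightarrow> 'i multiset \<Rightarrow>\<^sub>0 'r" where
  "corr 0 i m = 0"
| "corr (Suc n) i m =
    (if size m \<le> n then corr n i m
     else if \<forall>k\<in>#m. le i k then 0
     else let j = least m; m' = m - {#j#};
              A = (\<lambda>i m. mon (add_mset i m) + corr n i m)
          in op1 (A j) j (corr n i m') + lext (\<lambda>k r. scl r (A k m')) (br (gen i) (gen j)))"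

definition act :: "'i \<Rightarrow> 'i multiset \<Rightarrow> 'i multiset \<Rightarrow>\<^sub>0 'r"
  where "act i m = mon (add_mset i m) + corr (size m) i m"

text \<open>A value is final once the bound reaches the degree of the monomial, so
  \<open>size m\<close> in \<open>act\<close> selects the final one. Values at smaller bounds are
  placeholders that \<open>act\<close> never consults.\<close>

lemma corr_stable: "size m \<le> n \<Longrightarrow> corr n i m = corr (size m) i m"
proof (induction n)
  case (Suc n)
  then show ?case by (cases "size m = Suc n") auto
qed simp

definition deg_le :: "nat \<Rightarrow> ('i multiset \<Rightarrow>\<^sub>0 'r) \<Rightarrow> bool"
  where "deg_le n v \<longleftrightarrow> (\<forall>m\<in>Poly_Mapping.keys v. size m \<le> n)"

lemma deg_le_zero [simp]: "deg_le n 0"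
  by (simp add: deg_le_def)

lemma deg_le_add: "deg_le n v \<Longrightarrow> deg_le n w \<Longrightarrow> deg_le n (v + w)"
  using keys_add[of v w] by (auto simp: deg_le_def)

lemma deg_le_scl: "deg_le n v \<Longrightarrow> deg_le n (scl r v)"
  by (auto simp: deg_le_def in_keys_iff)

lemma deg_le_single: "size m \<le> n \<Longrightarrow> deg_le n (Poly_Mapping.single m r)"
  by (simp add: deg_le_def)

lemma deg_le_mono: "deg_le n v \<Longrightarrow> n \<le> n' \<Longrightarrow> deg_le n' v"
  by (auto simp: deg_le_def)

lemma deg_le_lext: "(\<And>k. k \<in> Poly_Mapping.keys f \<Longrightarrow> deg_le n (t k (Poly_Mapping.lookup f k))) \<Longrightarrow> deg_le n (lext t f)"
  unfolding lext_def
proof -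
  assume *: "\<And>k. k \<in> Poly_Mapping.keys f \<Longrightarrow> deg_le n (t k (Poly_Mapping.lookup f k))"
  have "S \<subseteq> Poly_Mapping.keys f \<Longrightarrow> deg_le n (\<Sum>k\<in>S. t k (Poly_Mapping.lookup f k))" for S
    by (induction S rule: infinite_finite_induct) (auto intro: deg_le_add *)
  then show "deg_le n (\<Sum>k\<in>Poly_Mapping.keys f. t k (Poly_Mapping.lookup f k))" by blast
qed

lemma deg_le_op1:
  assumes "deg_le n v" "\<And>m. m \<in> Poly_Mapping.keys v \<Longrightarrow> deg_le n' (A m)" "n \<le> n'"
  shows "deg_le n' (op1 A i v)"
  unfolding op1_def using assms
  by (intro deg_le_lext deg_le_add deg_le_scl deg_le_single) (auto simp: deg_le_def)

text \<open>This makes the recursion on the degree legitimate: for \<open>m\<close> of size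
  \<open>Suc n\<close>, the operator of \<open>j\<close> is applied to a correction of degree at
  most \<open>n\<close>, where stage \<open>n\<close> is already final. It is also the reason why
  the operators have the expected leading term.\<close>

lemma deg_le_corr: "deg_le (size m) (corr n i m)"
proof (induction n arbitrary: i m)
  case (Suc n)
  have A: "deg_le (Suc (size m')) (mon (add_mset j m') + corr n j m')" for j m'
    using Suc[of m' j] by (auto intro!: deg_le_add deg_le_single simp: single1_def elim: deg_le_mono)
  show ?case
  proof (cases "size m \<le> n \<or> (\<forall>k\<in>#m. le i k)")
    case True
    then show ?thesis using Suc by auto
  next
    case False
    then have "m \<noteq> {#}" by auto
    then obtain j m' where m: "m = add_mset j m'" and j: "\<forall>k\<in>#m'. le j k"
      using ex_least by blast
    have "deg_le (size m) (op1 (\<lambda>m. mon (add_mset j m) + corr n j m) j (corr n i m'))"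
    proof (rule deg_le_op1[where n = "size m'"])
      fix p assume "p \<in> Poly_Mapping.keys (corr n i m')"
      then have "size p \<le> size m'" using Suc[of m' i] by (auto simp: deg_le_def)
      then show "deg_le (size m) (mon (add_mset j p) + corr n j p)"
        using A[of p j] m by (auto elim: deg_le_mono)
    qed (use Suc m in auto)
    moreover have "deg_le (size m)
        (lext (\<lambda>k r. scl r (mon (add_mset k m') + corr n k m')) (br (gen i) (gen j)))"
      using A[of m'] m by (intro deg_le_lext deg_le_scl) simp
    ultimately show ?thesis
      using False m least_add[OF j] by (simp add: Let_def deg_le_add)
  qed
qed simp

definition X1 :: "'i \<Rightarrow> ('i multiset \<Rightarrow>\<^sub>0 'r) \<Rightarrow> 'i multiset \<Rightarrow>\<^sub>0 'r"
  where "X1 i v = op1 (act i) i v"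

definition X :: "('i \<Rightarrow>\<^sub>0 'r) \<Rightarrow> ('i multiset \<Rightarrow>\<^sub>0 'r) \<Rightarrow> 'i multiset \<Rightarrow>\<^sub>0 'r"
  where "X y v = lext (\<lambda>i r. scl r (X1 i v)) y"

lemma X_add: "X (y + z) v = X y v + X z v"
  unfolding X_def by (intro lext_add) (auto simp: scl_distribs)

lemma X_scl: "X (scl r y) v = scl r (X y v)"
  unfolding X_def by (intro lext_scl) auto

lemma X_zero [simp]: "X 0 v = 0" "X y 0 = 0"
  by (simp_all add: X_def X1_def lext_def)

lemma X_uminus: "X (- y) v = - X y v"
  using X_add[of y "- y" v] by (simp add: eq_neg_iff_add_eq_0 add.commute)

lemma X_minus: "X (y - z) v = X y v - X z v"
  using X_add[of "y - z" z v] by simp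

lemma X_gen: "X (gen i) v = X1 i v"
  by (simp add: X_def single1_def)

lemma X_add_right: "X y (v + w) = X y v + X y w"
  unfolding X_def X1_def op1_add scl_distribs lext_add_fun ..

lemma X_scl_right: "X y (scl r v) = scl r (X y v) + scl (anc y r) v"
proof (induction y rule: poly_mapping_add_induct)
  case (single k s)
  then show ?case
    unfolding single_eq_scl X_scl X_gen anc_scl X1_def op1_scl by (simp add: scl_distribs ac_simps)
qed (simp_all add: X_add anc_add scl_distribs ac_simps)

lemma X1_mon [simp]: "X1 i (mon m) = act i m"
  by (simp add: X1_def)

lemma act_low: "\<forall>k\<in>#m. le i k \<Longrightarrow> act i m = mon (add_mset i m)"
  unfolding act_def by (cases "size m") auto

text \<open>The recursion is designed to make this true. When \<open>i j m\<close> is rewritten as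
  \<open>j i m\<close> plus a bracket, the image of \<open>m\<close> under \<open>i\<close> splits
  into the monomial \<open>i m\<close>, on which \<open>j\<close> just multiplies because it is
  least, and a correction, which is what \<open>corr\<close> feeds to the operator of
  \<open>j\<close>.\<close>

lemma act_high:
  assumes "\<forall>k\<in>#m. le j k" "\<not> le i j"
  shows "X1 i (X1 j (mon m)) = X1 j (X1 i (mon m)) + X (br (gen i) (gen j)) (mon m)"
proof -
  define n where "n = size m"
  have ji: "le j i" using assms le_total by blast
  have eq: "mon (add_mset k p) + corr n k p = act k p" if "size p \<le> n" for k p
    using corr_stable[OF that] by (simp add: act_def)
  have "corr (Suc n) i (add_mset j m) =
      op1 (\<lambda>m. mon (add_mset j m) + corr n j m) j (corr n i m)
      + lext (\<lambda>k r. scl r (mon (add_mset k m) + corr n k m)) (br (gen i) (gen j))"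
    using assms least_add[OF assms(1)] by (simp add: Let_def n_def)
  \<comment> \<open>Stage \<open>n\<close> may be replaced by \<open>act\<close> here, because the
    correction has degree at most \<open>n\<close>.\<close>
  also have "op1 (\<lambda>m. mon (add_mset j m) + corr n j m) j (corr n i m) = X1 j (corr n i m)"
    unfolding X1_def op1_def
    using deg_le_corr[of m n i] unfolding n_def[symmetric]
    by (intro lext_cong) (auto simp: eq deg_le_def)
  also have "lext (\<lambda>k r. scl r (mon (add_mset k m) + corr n k m)) (br (gen i) (gen j))
      = X (br (gen i) (gen j)) (mon m)"
    unfolding X_def using eq[of m] by (intro lext_cong) (simp add: n_def)
  also have "corr n i m = X1 i (mon m) - mon (add_mset i m)"
    by (simp add: act_def n_def)
  also have "X1 j (X1 i (mon m) - mon (add_mset i m))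
      = X1 j (X1 i (mon m)) - mon (add_mset j (add_mset i m))"
    using act_low[of "add_mset i m" j] assms ji by (simp add: X1_def op1_minus)
  finally have "corr (Suc n) i (add_mset j m) = X1 j (X1 i (mon m))
      - mon (add_mset i (add_mset j m)) + X (br (gen i) (gen j)) (mon m)"
    by (simp add: add_mset_commute)
  then show ?thesis
    using act_low[OF assms(1)] by (simp add: act_def n_def)
qed

section \<open>The commutator relation\<close>

definition compat :: "('i \<Rightarrow>\<^sub>0 'r) \<Rightarrow> ('i \<Rightarrow>\<^sub>0 'r) \<Rightarrow> ('i multiset \<Rightarrow>\<^sub>0 'r) \<Rightarrow> bool"
  where "compat y z v \<longleftrightarrow> X y (X z v) = X z (X y v) + X (br y z) v"

lemma compat_sym: "compat y z v \<Longrightarrow> compat z y v"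
  unfolding compat_def using br_anti[of y z] by (simp add: X_uminus)

lemma compat_refl: "compat y y v"
  by (simp add: compat_def br_alt)

lemma br_zero [simp]: "br 0 y = 0" "br y 0 = 0"
  using br_add_left[of 0 0 y] br_add_right[of y 0 0] by auto

lemma br_uminus_right: "br y (- z) = - br y z"
  using br_add_right[of y z "- z"] by (simp add: eq_neg_iff_add_eq_0 add.commute)

lemma compat_zero [simp]: "compat y z 0" "compat 0 z v" "compat y 0 v"
  by (simp_all add: compat_def)

lemma compat_add: "compat y z v \<Longrightarrow> compat y z w \<Longrightarrow> compat y z (v + w)"
  unfolding compat_def by (simp add: X_add_right ac_simps)

lemma compat_add_left: "compat y z v \<Longrightarrow> compat y' z v \<Longrightarrow> compat (y + y') z v"
  unfolding compat_def by (simp add: X_add X_add_right br_add_left ac_simps)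

text \<open>The terms with one derivative of \<open>r\<close> are symmetric in \<open>y\<close> and
  \<open>z\<close>; those with two derivatives differ by the anchor of the bracket, which is
  \<open>anc_br\<close>.\<close>

lemma compat_scl: "compat y z v \<Longrightarrow> compat y z (scl r v)"
  unfolding compat_def
  by (simp add: X_add_right X_scl_right anc_br scl_distribs algebra_simps)

text \<open>When \<open>X z\<close> passes the coefficient \<open>r\<close>, the derivative of
  \<open>r\<close> along \<open>z\<close> appears; the second term of \<open>br_scl_left\<close>
  cancels it.\<close>

lemma compat_scl_left: "compat y z v \<Longrightarrow> compat (scl r y) z v"
  unfolding compat_def
  by (simp add: X_scl X_scl_right X_minus br_scl_left scl_distribs)

lemma compat_basis_left: "(\<And>i. compat (gen i) z v) \<Longrightarrow> compat y z v"
  by (induction y rule: poly_mapping_add_induct)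
    (auto simp: single_eq_scl[of _ "_ :: 'r"] intro: compat_add_left compat_scl_left)

text \<open>Combines the additivity and scaling rules in all three arguments. The degree bound
  allows it to supply the induction hypothesis of \<open>compat_gen\<close>.\<close>

lemma compat_basis:
  assumes "deg_le n v" "\<And>i j m. size m \<le> n \<Longrightarrow> compat (gen i) (gen j) (mon m)"
  shows "compat y z v"
proof -
  have "compat y z (mon m)" if "size m \<le> n" for m
  proof (rule compat_basis_left)
    show "compat (gen i) z (mon m)" for i
      by (rule compat_sym, rule compat_basis_left, rule compat_sym, rule assms(2)[OF that])
  qed
  then have *: "compat y z (Poly_Mapping.single m r)" if "size m \<le> n" for m r
    unfolding single_eq_scl by (rule compat_scl) (use that in simp)
  have "Poly_Mapping.keys v \<subseteq> {m. size m \<le> n}" using assms(1) by (auto simp: deg_le_def)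
  then show ?thesis
    by (induction v rule: poly_mapping_keys_induct) (auto intro: * compat_add)
qed

text \<open>If \<open>i\<close> is not below \<open>j\<close>, this is the design property
  \<open>act_high\<close>. Otherwise \<open>i\<close> is below \<open>j\<close> and all of
  \<open>m\<close>, and the roles of the two are exchanged.\<close>

lemma compat_low: "\<forall>k\<in>#m. le j k \<Longrightarrow> compat (gen i) (gen j) (mon m)"
proof (cases "i = j")
  case False
  assume m: "\<forall>k\<in>#m. le j k"
  show ?thesis
  proof (cases "le i j")
    case True
    then have "\<not> le j i" using le_antisym False by blast
    moreover have "\<forall>k\<in>#m. le i k" using m True le_trans by blast
    ultimately show ?thesis
      by (intro compat_sym[of "gen j"]) (simp add: compat_def X_gen act_high del: X1_mon)
  next
    case False
    then show ?thesis using m by (simp add: compat_def X_gen act_high del: X1_mon)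
  qed
qed (simp add: compat_refl)

text \<open>The heart of Poincare-Birkhoff-Witt, by induction on the degree. When neither index is
  below \<open>m\<close>, the least factor \<open>k\<close> is split off; moving \<open>k\<close> to
  the front of both products reduces the claim to the rest \<open>p\<close>, and what remains is the
  Jacobi identity for \<open>i\<close>, \<open>j\<close> and \<open>k\<close>.\<close>

lemma compat_gen: "compat (gen i) (gen j) (mon m)"
proof (induction "size m" arbitrary: i j m rule: less_induct)
  case less
  have IH: "compat y z v" if "deg_le n v" "n < size m" for y z v n
    using that less by - (rule compat_basis[of n], auto)
  show ?case
  proof (cases "(\<forall>k\<in>#m. le j k) \<or> (\<forall>k\<in>#m. le i k)")
    case True
    then show ?thesis using compat_low compat_sym by blast
  next
    case False
    then have "m \<noteq> {#}" by auto
    then obtain k p where m: "m = add_mset k p" and k: "\<forall>q\<in>#p. le k q"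
      using ex_least by blast
    have "\<forall>q\<in>#m. le a q" if "le a k" for a
      using that k le_trans[OF that] m by auto
    then have kj: "\<not> le j k" "\<not> le i k" using False by blast+
    have sz: "size p < size m" using m by simp
    have IHp: "compat y z (mon p)" for y z
      using IH[of "size p"] sz by (simp add: single1_def deg_le_single)
    have Xp: "X (gen a) (mon p) = mon (add_mset a p) + corr (size p) a p" for a
      by (simp add: X_gen act_def)
    \<comment> \<open>The image of \<open>p\<close> under \<open>b\<close> is the monomial
      \<open>b p\<close>, all of whose factors are still above \<open>k\<close>, plus a correction
      of degree below that of \<open>m\<close>. The first part falls under
      \<open>compat_low\<close>, the second under the induction hypothesis.\<close>
    have swap: "compat (gen a) (gen k) (X (gen b) (mon p))" if "\<not> le b k" for a b
      unfolding Xp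
    proof (rule compat_add)
      have "le k b" using that le_total by blast
      then show "compat (gen a) (gen k) (mon (add_mset b p))" using k by (intro compat_low) auto
      show "compat (gen a) (gen k) (corr (size p) b p)"
        by (rule IH[OF deg_le_corr sz])
    qed
    have mon_m: "mon m = X (gen k) (mon p)"
      using act_low[OF k] m by (simp add: X_gen)
    let ?i = "gen i" and ?j = "gen j" and ?k = "gen k" and ?v = "mon p"
    \<comment> \<open>Moves \<open>X ?k\<close> to the left past \<open>X b\<close> and then past
      \<open>X a\<close>. The sum of the two middle terms is symmetric in \<open>a\<close> and
      \<open>b\<close> and so cancels in the commutator.\<close>
    have expand: "X a (X b (X ?k ?v)) = X ?k (X a (X b ?v)) + X (br a ?k) (X b ?v)
        + X (br b ?k) (X a ?v) + X (br a (br b ?k)) ?v"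
      if "compat a ?k (X b ?v)" for a b
    proof -
      have "X b (X ?k ?v) = X ?k (X b ?v) + X (br b ?k) ?v"
        using IHp[of b ?k] by (simp add: compat_def)
      moreover have "X a (X ?k (X b ?v)) = X ?k (X a (X b ?v)) + X (br a ?k) (X b ?v)"
        using that by (simp add: compat_def)
      moreover have "X a (X (br b ?k) ?v) = X (br b ?k) (X a ?v) + X (br a (br b ?k)) ?v"
        using IHp[of a "br b ?k"] by (simp add: compat_def)
      ultimately show ?thesis by (simp add: X_add_right ac_simps)
    qed
    have ij: "X ?i (X ?j ?v) = X ?j (X ?i ?v) + X (br ?i ?j) ?v"
      using IHp[of ?i ?j] by (simp add: compat_def)
    have "X (br ?i ?j) (X ?k ?v) = X ?k (X (br ?i ?j) ?v) + X (br (br ?i ?j) ?k) ?v"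
      using IHp[of "br ?i ?j" ?k] by (simp add: compat_def)
    \<comment> \<open>The Jacobi identity as a derivation rule matches the double brackets left over
      from the two expansions.\<close>
    moreover have "br ?i (br ?j ?k) = br ?j (br ?i ?k) + br (br ?i ?j) ?k"
      using br_jacobi[of ?i ?j ?k] unfolding br_anti[of ?k ?i] br_anti[of "br ?i ?j" ?k] br_uminus_right
      by (simp add: algebra_simps)
    ultimately show ?thesis
      unfolding compat_def mon_m expand[OF swap[OF kj(1)]] expand[OF swap[OF kj(2)]] ij
      by (simp add: X_add_right X_add ac_simps)
  qed
qed

theorem X_commutator: "X y (X z v) - X z (X y v) = X (br y z) v"
proof -
  \<comment> \<open>For the zero polynomial the maximum is unspecified, but the degree bound then
    holds vacuously.\<close>
  define n where "n = Max (size ` Poly_Mapping.keys v)"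
  have "deg_le n v" unfolding deg_le_def n_def by auto
  then have "compat y z v" using compat_gen by (rule compat_basis)
  then show ?thesis by (simp add: compat_def)
qed

section \<open>Multiplication by linear forms as the leading term of the operators\<close>

definition mulv :: "('i \<Rightarrow>\<^sub>0 'r) \<Rightarrow> ('i multiset \<Rightarrow>\<^sub>0 'r) \<Rightarrow> 'i multiset \<Rightarrow>\<^sub>0 'r"
  where "mulv y v = lext (\<lambda>i r. lext (\<lambda>m s. Poly_Mapping.single (add_mset i m) (r * s)) v) y"

lemma mulv_add: "mulv (y + z) v = mulv y v + mulv z v"
  unfolding mulv_def
  by (intro lext_add) (auto simp: lext_def single_add distrib_right sum.distrib)

lemma mulv_add_right: "mulv y (v + w) = mulv y v + mulv y w"
proof -
  have "lext (\<lambda>m s. Poly_Mapping.single (add_mset i m) (r * s)) (v + w)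
    = lext (\<lambda>m s. Poly_Mapping.single (add_mset i m) (r * s)) v + lext (\<lambda>m s. Poly_Mapping.single (add_mset i m) (r * s)) w"
    for i and r :: 'r
    by (intro lext_add) (simp_all add: single_add distrib_left)
  then show ?thesis unfolding mulv_def by (simp add: lext_add_fun)
qed

lemma mulv_zero [simp]: "mulv 0 v = 0" "mulv y 0 = 0"
  by (simp_all add: mulv_def lext_def)

lemma mulv_single: "mulv (Poly_Mapping.single i r) (Poly_Mapping.single m s) = Poly_Mapping.single (add_mset i m) (r * s)"
  by (simp add: mulv_def)

text \<open>Beyond the product with \<open>y\<close> there are two contributions, the correction and
  the derivative of the coefficient, and neither raises the degree.\<close>

lemma X_top:
  assumes "deg_le n v"
  shows "deg_le n (X y v - mulv y v)"
proof -
  have "deg_le n (X y (Poly_Mapping.single m s) - mulv y (Poly_Mapping.single m s))" if "size m \<le> n" for m s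
  proof (induction y rule: poly_mapping_add_induct)
    case (single i r)
    have "anc (Poly_Mapping.single i r) s = r * anc (gen i) s"
      using anc_scl[of r "gen i" s] by (simp add: single1_def)
    then have "X (Poly_Mapping.single i r) (Poly_Mapping.single m s) - mulv (Poly_Mapping.single i r) (Poly_Mapping.single m s)
      = scl (r * s) (corr (size m) i m) + Poly_Mapping.single m (r * anc (gen i) s)"
      unfolding mulv_single unfolding single_eq_scl X_scl X_scl_right X_gen X1_mon act_def
      by (simp add: scl_distribs single1_def mult.commute)
    then show ?case
      using that deg_le_corr[of m "size m" i]
      by (auto intro!: deg_le_add deg_le_scl deg_le_single elim: deg_le_mono)
  next
    case (add f g)
    then show ?case using deg_le_add[OF add(1,2)] by (simp add: X_add mulv_add algebra_simps)
  qed simp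
  note top_single = this
  have "Poly_Mapping.keys v \<subseteq> {m. size m \<le> n}" using assms by (auto simp: deg_le_def)
  then show ?thesis
  proof (induction v rule: poly_mapping_keys_induct)
    case (single m s)
    then show ?case using top_single by simp
  next
    case (add f g)
    then show ?case using deg_le_add[OF add(1,2)] by (simp add: X_add_right mulv_add_right algebra_simps)
  qed auto
qed

end

section \<open>From free to projective Lie-Rinehart algebras\<close>

definition lin :: "('k \<Rightarrow> 'j \<Rightarrow>\<^sub>0 'r::comm_ring_1) \<Rightarrow> ('k \<Rightarrow>\<^sub>0 'r) \<Rightarrow> 'j \<Rightarrow>\<^sub>0 'r"
  where "lin t f = lext (\<lambda>k r. scl r (t k)) f"

lemma lin_simps [simp]: "lin t 0 = 0" "lin t (single1 k) = t k" "lin t (Poly_Mapping.single k r) = scl r (t k)"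
  by (simp_all add: lin_def single1_def)

lemma lin_add: "lin t (f + g) = lin t f + lin t g"
  unfolding lin_def by (intro lext_add) (simp_all add: scl_distribs)

lemma lin_scl: "lin t (scl r f) = scl r (lin t f)"
  unfolding lin_def by (intro lext_scl) simp_all

lemma lin_minus: "lin t (f - g) = lin t f - lin t g"
  using lin_add[of t "f - g" g] by simp

lemma lin_eqI:
  assumes "\<And>f g. F (f + g) = F f + F g" "\<And>r f. F (scl r f) = scl r (F f)"
    "\<And>f g. G (f + g) = G f + G g" "\<And>r f. G (scl r f) = scl r (G f)"
    "\<And>k. F (single1 k) = G (single1 k)"
  shows "F f = (G f :: 'j \<Rightarrow>\<^sub>0 'r::comm_ring_1)"
proof (induction f rule: poly_mapping_add_induct)
  case zero
  then show ?case using assms(2,4)[of 0 0] by simp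
next
  case (single k r)
  then show ?case unfolding single_eq_scl assms(2,4,5) ..
next
  case (add f g)
  then show ?case by (simp add: assms)
qed

text \<open>The free case asks for a total order of the basis; the well-ordering theorem provides
  one on every type.\<close>

definition some_le :: "'i \<Rightarrow> 'i \<Rightarrow> bool"
  where "some_le a b \<longleftrightarrow> (a, b) \<in> (SOME r. well_order_on UNIV r)"

lemma some_le: "some_le a a" "some_le a b \<Longrightarrow> some_le b a \<Longrightarrow> a = b"
  "some_le a b \<Longrightarrow> some_le b c \<Longrightarrow> some_le a c" "some_le a b \<or> some_le b a"
proof -
  have "well_order_on UNIV (SOME r :: 'a rel. well_order_on UNIV r)"
    using well_order_on[of UNIV] by (rule someI_ex)
  then have "linear_order_on UNIV (SOME r :: 'a rel. well_order_on UNIV r)"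
    by (simp add: well_order_on_def)
  then have "refl (SOME r :: 'a rel. well_order_on UNIV r)" "trans (SOME r :: 'a rel. well_order_on UNIV r)"
    "antisym (SOME r :: 'a rel. well_order_on UNIV r)" "total (SOME r :: 'a rel. well_order_on UNIV r)"
    by (auto simp: order_on_defs)
  note * = this
  show "some_le a a" using *(1) by (auto simp: some_le_def refl_on_def)
  show "some_le a b \<Longrightarrow> some_le b a \<Longrightarrow> a = b" using *(3) by (auto simp: some_le_def dest: antisymD)
  show "some_le a b \<Longrightarrow> some_le b c \<Longrightarrow> some_le a c" using *(2) by (auto simp: some_le_def dest: transD)
  show "some_le a b \<or> some_le b a" using *(1,4) by (cases "a = b") (auto simp: some_le_def total_on_def refl_on_def)
qed

text \<open>
  \<open>D x\<close> is the image of the \<open>x\<close>-th basis vector under an idempotent endomorphism \<open>proj\<close> of a free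
  module. The bracket of the basis vectors \<open>x\<close> and \<open>y\<close> is the basis vector \<open>br0 x y\<close>; it
  satisfies the axioms of a Lie-Rinehart algebra only modulo the kernel of \<open>proj\<close>.
\<close>
locale projective_lie_rinehart =
  fixes anc0 :: "'x \<Rightarrow> 'r::comm_ring_1 \<Rightarrow> 'r" and br0 :: "'x \<Rightarrow> 'x \<Rightarrow> 'x" and D :: "'x \<Rightarrow> 'x \<Rightarrow>\<^sub>0 'r"
  assumes anc0_add: "anc0 x (r + s) = anc0 x r + anc0 x s"
    and anc0_mult: "anc0 x (r * s) = anc0 x r * s + r * anc0 x s"
    and lin_D_D: "lin D (D x) = D x"
    and ker_anc: "lin D k = 0 \<Longrightarrow> lext (\<lambda>x r. r * anc0 x s) k = 0"
    and ker_lie: "lin D k = 0 \<Longrightarrow> lext (\<lambda>x r. scl r (D (br0 x c)) - scl (anc0 c r) (D x)) k = 0"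
    and D_br_alt: "D (br0 x x) = 0"
    and D_br_anti: "D (br0 x y) = - D (br0 y x)"
    and D_br_jacobi: "D (br0 x (br0 y z)) + D (br0 y (br0 z x)) + D (br0 z (br0 x y)) = 0"
    and anc0_br: "anc0 (br0 x y) r = anc0 x (anc0 y r) - anc0 y (anc0 x r)"
begin

abbreviation proj :: "('x \<Rightarrow>\<^sub>0 'r) \<Rightarrow> 'x \<Rightarrow>\<^sub>0 'r" where "proj \<equiv> lin D"

lemma anc0_zero [simp]: "anc0 x 0 = 0" "anc0 x 1 = 0"
  using anc0_add[of x 0 0] anc0_mult[of x 1 1] by auto

section \<open>Anchor and bracket extended from basis vectors\<close>

definition anc :: "('x \<Rightarrow>\<^sub>0 'r) \<Rightarrow> 'r \<Rightarrow> 'r"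
  where "anc f s = lext (\<lambda>x r. r * anc0 x s) f"

lemma anc_zero [simp]: "anc 0 s = 0" "anc f 0 = 0" "anc f 1 = 0"
  by (simp_all add: anc_def lext_def)

lemma anc_add: "anc (f + g) s = anc f s + anc g s"
  unfolding anc_def by (intro lext_add) (auto simp: algebra_simps)

lemma anc_single [simp]: "anc (Poly_Mapping.single x r) s = r * anc0 x s"
  by (simp add: anc_def)

lemma anc_gen [simp]: "anc (single1 x) s = anc0 x s"
  by (simp add: single1_def)

lemma anc_scl: "anc (scl r f) s = r * anc f s"
  by (induction f rule: poly_mapping_add_induct) (simp_all add: anc_add scl_distribs algebra_simps)

lemma anc_minus: "anc (f - g) s = anc f s - anc g s"
  using anc_add[of "f - g" g s] by simp

lemma anc_add_right: "anc f (r + s) = anc f r + anc f s"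
  unfolding anc_def by (simp add: anc0_add distrib_left lext_add_fun)

lemma anc_mult: "anc f (r * s) = anc f r * s + r * anc f s"
  by (induction f rule: poly_mapping_add_induct) (simp_all add: anc_add anc0_mult algebra_simps)

lemma anc_minus_right: "anc f (r - s) = anc f r - anc f s"
  using anc_add_right[of f "r - s" s] by simp

lemma proj_proj [simp]: "proj (proj f) = proj f"
  by (rule lin_eqI[where F = "\<lambda>f. proj (proj f)"]) (simp_all add: lin_add lin_scl lin_D_D)

lemma proj_diff [simp]: "proj (proj f - f) = 0"
  by (simp add: lin_minus)

lemma anc_proj [simp]: "anc (proj f) s = anc f s"
  using ker_anc[OF proj_diff[of f], of s] unfolding anc_def[symmetric] by (simp add: anc_minus)

text \<open>The bracket with a basis vector, extended by the Leibniz rule. Basis vectors enter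
  through \<open>D\<close> because the bracket is to take its values in the image of
  \<open>proj\<close>.\<close>

definition lie :: "'x \<Rightarrow> ('x \<Rightarrow>\<^sub>0 'r) \<Rightarrow> 'x \<Rightarrow>\<^sub>0 'r"
  where "lie x g = lext (\<lambda>y s. scl s (D (br0 x y)) + scl (anc0 x s) (D y)) g"

lemma lie_add: "lie x (f + g) = lie x f + lie x g"
  unfolding lie_def by (intro lext_add) (simp_all add: scl_distribs anc0_add)

lemma lie_single: "lie x (Poly_Mapping.single y s) = scl s (D (br0 x y)) + scl (anc0 x s) (D y)"
  by (simp add: lie_def)

lemma lie_zero [simp]: "lie x 0 = 0"
  by (simp add: lie_def)

lemma lie_scl: "lie x (scl r g) = scl r (lie x g) + scl (anc0 x r) (proj g)"
  by (induction g rule: poly_mapping_add_induct)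
    (simp_all add: lie_add lie_single lin_add scl_distribs anc0_mult algebra_simps)

text \<open>Forced by the Leibniz rule in the first argument. On the image of \<open>proj\<close>
  the projections in \<open>lb_scl_right\<close> and \<open>lb_scl_left\<close> disappear, and this
  is the Lie-Rinehart bracket of \<open>L\<close>; in general it is the bracket of the two
  projections.\<close>

definition lb :: "('x \<Rightarrow>\<^sub>0 'r) \<Rightarrow> ('x \<Rightarrow>\<^sub>0 'r) \<Rightarrow> 'x \<Rightarrow>\<^sub>0 'r"
  where "lb f g = lext (\<lambda>x r. scl r (lie x g) - scl (anc g r) (D x)) f"

lemma lb_add_left: "lb (f + f') g = lb f g + lb f' g"
  unfolding lb_def by (intro lext_add) (simp_all add: scl_distribs anc_add_right)

lemma lb_zero [simp]: "lb 0 g = 0" "lb f 0 = 0"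
  by (simp_all add: lb_def lext_def)

lemma lb_single: "lb (Poly_Mapping.single x r) g = scl r (lie x g) - scl (anc g r) (D x)"
  by (simp add: lb_def)

lemma lb_gen: "lb (single1 x) (single1 y) = D (br0 x y)"
  by (simp add: single1_def lb_single lie_single)

lemma lb_add_right: "lb f (g + g') = lb f g + lb f g'"
  by (induction f rule: poly_mapping_add_induct)
    (simp_all add: lb_add_left lb_single lie_add anc_add scl_distribs)

lemma lb_scl_right: "lb f (scl r g) = scl r (lb f g) + scl (anc f r) (proj g)"
  by (induction f rule: poly_mapping_add_induct)
    (simp_all add: lb_add_left lb_single lie_scl anc_add anc_scl scl_distribs algebra_simps)

lemma lb_scl_left: "lb (scl r f) g = scl r (lb f g) - scl (anc g r) (proj f)"
  by (induction f rule: poly_mapping_add_induct)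
    (simp_all add: lb_add_left lb_single anc_mult lin_add scl_distribs algebra_simps)

lemma lb_minus_right: "lb f (g - g') = lb f g - lb f g'"
  using lb_add_right[of f "g - g'" g'] by simp

lemma lb_uminus_right: "lb f (- g) = - lb f g"
  using lb_minus_right[of f 0 g] by simp

lemma lb_anti: "lb f g = - lb g f"
proof -
  have *: "lb (single1 x) g = - lb g (single1 x)" for x g
  proof (induction g rule: poly_mapping_add_induct)
    case (single y r)
    then show ?case
      using D_br_anti[of x y]
      unfolding single_eq_scl lb_scl_right lb_scl_left by (simp add: lb_gen)
  qed (simp_all add: lb_add_left lb_add_right)
  show ?thesis
  proof (induction f rule: poly_mapping_add_induct)
    case (single y r)
    then show ?case
      using *[of y g] unfolding single_eq_scl lb_scl_right lb_scl_left by simp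
  qed (simp_all add: lb_add_left lb_add_right)
qed

lemma lb_alt: "lb f f = 0"
proof (induction f rule: poly_mapping_add_induct)
  case (single x r)
  show ?case
    unfolding single_eq_scl lb_scl_right lb_scl_left anc_scl
    by (simp add: lb_gen D_br_alt scl_distribs anc_scl)
next
  case (add f g)
  then show ?case using lb_anti[of f g] by (simp add: lb_add_left lb_add_right)
qed simp

text \<open>The case of a basis vector \<open>c\<close> is \<open>ker_lie\<close>; a coefficient
  \<open>r\<close> adds a multiple of the anchor of \<open>k\<close> at \<open>r\<close>, which
  vanishes by \<open>ker_anc\<close>. Together with \<open>lb_anti\<close> it follows that the
  bracket depends only on the projections of its arguments.\<close>

lemma lb_ker:
  assumes "proj k = 0"
  shows "lb k g = 0"
proof (induction g rule: poly_mapping_add_induct)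
  case (single c r)
  have "lb k (single1 c) = lext (\<lambda>x r. scl r (D (br0 x c)) - scl (anc0 c r) (D x)) k"
    unfolding lb_def single1_def by (simp add: lie_single)
  then have "lb k (single1 c) = 0" using ker_lie[OF assms] by simp
  then show ?case
    unfolding single_eq_scl lb_scl_right using ker_anc[OF assms] by (simp add: anc_def)
qed (simp_all add: lb_add_right)

lemma lb_proj_left: "lb (proj f) g = lb f g"
proof -
  have "lb (proj f - f) g = 0" by (rule lb_ker) simp
  then show ?thesis using lb_add_left[of "proj f - f" f g] by simp
qed

lemma lb_proj_right: "lb f (proj g) = lb f g"
  using lb_anti[of f g] lb_anti[of f "proj g"] by (simp add: lb_proj_left)

lemma proj_lie: "proj (lie x g) = lie x g"
  by (induction g rule: poly_mapping_add_induct)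
    (simp_all add: lie_add lie_single lin_add lin_scl lin_D_D)

lemma proj_lb [simp]: "proj (lb f g) = lb f g"
  by (induction f rule: poly_mapping_add_induct)
    (simp_all add: lb_add_left lb_single lin_add lin_minus lin_scl lin_D_D proj_lie)

lemma anc_D: "anc (D x) r = anc0 x r"
  using anc_proj[of "single1 x" r] by simp

lemma anc_lb: "anc (lb f g) r = anc f (anc g r) - anc g (anc f r)"
proof (induction f rule: poly_mapping_add_induct)
  case (single x s)
  have *: "anc (lb (single1 x) g) r = anc0 x (anc g r) - anc g (anc0 x r)"
  proof (induction g rule: poly_mapping_add_induct)
    case (single y t)
    show ?case
      unfolding single_eq_scl lb_scl_right
      by (simp add: anc_add anc_scl lb_gen anc_D anc0_br anc0_mult algebra_simps)
  qed (simp_all add: lb_add_right anc_add anc0_add algebra_simps)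
  show ?case
    unfolding single_eq_scl lb_scl_left
    by (simp add: anc_minus anc_scl * anc_D anc_mult algebra_simps)
qed (simp_all add: lb_add_left anc_add anc_add_right)

lemma lb_gen_D: "lb (single1 x) (D y) = D (br0 x y)"
  using lb_proj_right[of "single1 x" "single1 y"] by (simp add: lb_gen)

section \<open>The Jacobi identity\<close>

definition jac :: "('x \<Rightarrow>\<^sub>0 'r) \<Rightarrow> ('x \<Rightarrow>\<^sub>0 'r) \<Rightarrow> ('x \<Rightarrow>\<^sub>0 'r) \<Rightarrow> 'x \<Rightarrow>\<^sub>0 'r"
  where "jac f g h = lb f (lb g h) + lb g (lb h f) + lb h (lb f g)"

lemma jac_cycle: "jac f g h = jac g h f"
  by (simp add: jac_def ac_simps)

text \<open>Terms with one derivative of \<open>r\<close> cancel by antisymmetry, terms with two by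
  \<open>anc_lb\<close>. The Jacobian is thus linear in its last argument and, being cyclic, in
  every argument, which reduces the identity to basis vectors.\<close>

lemma jac_scl: "jac f g (scl r h) = scl r (jac f g h)"
  unfolding jac_def lb_scl_right lb_scl_left lb_add_right
  using lb_anti[of h f] lb_anti[of h g]
  by (simp add: lb_proj_right lb_add_right lb_minus_right lb_uminus_right lb_scl_right lb_scl_left
      anc_lb scl_distribs algebra_simps)

lemma jac_add: "jac f g (h + h') = jac f g h + jac f g h'"
  by (simp add: jac_def lb_add_left lb_add_right)

lemma jac_basis: "(\<And>x. jac f g (single1 x) = 0) \<Longrightarrow> jac f g h = 0"
  by (induction h rule: poly_mapping_add_induct)
    (simp_all add: jac_add single_eq_scl jac_scl, simp add: jac_def)

lemma lb_jacobi: "lb f (lb g h) + lb g (lb h f) + lb h (lb f g) = 0"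
proof -
  have "jac (single1 x) (single1 y) (single1 z) = 0" for x y z
    by (simp add: jac_def lb_gen lb_gen_D D_br_jacobi)
  then have "jac f g h = 0"
    by (metis jac_basis jac_cycle)
  then show ?thesis by (simp add: jac_def)
qed

end

section \<open>Shifts on a countable direct sum of free modules\<close>

definition nth_in :: "nat \<Rightarrow> ('x \<Rightarrow>\<^sub>0 'r::comm_ring_1) \<Rightarrow> (nat \<times> 'x) \<Rightarrow>\<^sub>0 'r"
  where "nth_in n = lin (\<lambda>x. single1 (n, x))"

definition fst_out :: "((nat \<times> 'x) \<Rightarrow>\<^sub>0 'r::comm_ring_1) \<Rightarrow> 'x \<Rightarrow>\<^sub>0 'r"
  where "fst_out = lin (\<lambda>(n, x). if n = 0 then single1 x else 0)"

definition up :: "((nat \<times> 'x) \<Rightarrow>\<^sub>0 'r::comm_ring_1) \<Rightarrow> (nat \<times> 'x) \<Rightarrow>\<^sub>0 'r"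
  where "up = lin (\<lambda>(n, x). single1 (Suc n, x))"

definition down :: "((nat \<times> 'x) \<Rightarrow>\<^sub>0 'r::comm_ring_1) \<Rightarrow> (nat \<times> 'x) \<Rightarrow>\<^sub>0 'r"
  where "down = lin (\<lambda>(n, x). case n of 0 \<Rightarrow> 0 | Suc k \<Rightarrow> single1 (k, x))"

lemma nth_in_eqI:
  assumes "\<And>f g. F (f + g) = F f + F g" "\<And>r f. F (scl r f) = scl r (F f)"
    "\<And>f g. G (f + g) = G f + G g" "\<And>r f. G (scl r f) = scl r (G f)"
    "\<And>n f. F (nth_in n f) = G (nth_in n f)"
  shows "F f = (G f :: 'j \<Rightarrow>\<^sub>0 'r::comm_ring_1)"
proof (rule lin_eqI[of F G, OF assms(1-4)])
  show "F (single1 k) = G (single1 k)" for k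
    using assms(5)[of "fst k" "single1 (snd k)"] by (simp add: nth_in_def)
qed

lemma shift_nth_in:
  "up (nth_in n f) = nth_in (Suc n) f" "down (nth_in (Suc n) f) = nth_in n f"
  "down (nth_in 0 f) = 0" "fst_out (nth_in 0 f) = f" "fst_out (nth_in (Suc n) f) = 0"
proof -
  have "up (nth_in n f) = nth_in (Suc n) f"
    by (rule lin_eqI[where F = "\<lambda>f. up (nth_in n f)"]) (simp_all add: up_def nth_in_def lin_add lin_scl)
  moreover have "down (nth_in (Suc n) f) = nth_in n f"
    by (rule lin_eqI[where F = "\<lambda>f. down (nth_in (Suc n) f)"])
      (simp_all add: down_def nth_in_def lin_add lin_scl)
  moreover have "down (nth_in 0 f) = 0"
    by (rule lin_eqI[where F = "\<lambda>f. down (nth_in 0 f)" and G = "\<lambda>_. 0"])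
      (simp_all add: down_def nth_in_def lin_add lin_scl)
  moreover have "fst_out (nth_in 0 f) = f"
    by (rule lin_eqI[where F = "\<lambda>f. fst_out (nth_in 0 f)" and G = "\<lambda>f. f"])
      (simp_all add: fst_out_def nth_in_def lin_add lin_scl)
  moreover have "fst_out (nth_in (Suc n) f) = 0"
    by (rule lin_eqI[where F = "\<lambda>f. fst_out (nth_in (Suc n) f)" and G = "\<lambda>_. 0"])
      (simp_all add: fst_out_def nth_in_def lin_add lin_scl)
  ultimately show "up (nth_in n f) = nth_in (Suc n) f" "down (nth_in (Suc n) f) = nth_in n f"
    "down (nth_in 0 f) = 0" "fst_out (nth_in 0 f) = f" "fst_out (nth_in (Suc n) f) = 0"
    by blast+
qed

lemma shift_linear:
  "nth_in n (f + g) = nth_in n f + nth_in n g" "nth_in n (scl r f) = scl r (nth_in n f)"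
  "nth_in n (0 :: 'x \<Rightarrow>\<^sub>0 'r) = 0"
  "up (u + v) = up u + up v" "up (scl r u) = scl r (up u)" "up (u - v) = up u - up v"
  "down (u + v) = down u + down v" "down (scl r u) = scl r (down u)" "down (u - v) = down u - down v"
  "fst_out (u + v) = fst_out u + fst_out v" "fst_out (scl r u) = scl r (fst_out u)"
  "fst_out (u - v) = fst_out u - fst_out v"
  for f g :: "'x \<Rightarrow>\<^sub>0 'r::comm_ring_1" and u v :: "(nat \<times> 'x) \<Rightarrow>\<^sub>0 'r"
  by (simp_all add: nth_in_def up_def down_def fst_out_def lin_add lin_scl lin_minus)

context projective_lie_rinehart
begin

text \<open>
  Rinehart's reduction of the projective to the free case. With \<open>F\<close> the direct sum of countably
  many copies of the free module containing \<open>L = range proj\<close>, an Eilenberg swindle (the maps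
  \<open>pack\<close>, \<open>head\<close> and \<open>tail\<close>) identifies \<open>L \<oplus> F\<close> with the free module \<open>F\<close>; and \<open>L\<close> acts on the
  abelian Lie algebra \<open>F\<close> by the flat connection \<open>nab\<close> that kills the basis.
\<close>

definition pbar :: "((nat \<times> 'x) \<Rightarrow>\<^sub>0 'r) \<Rightarrow> (nat \<times> 'x) \<Rightarrow>\<^sub>0 'r"
  where "pbar = lin (\<lambda>(n, x). nth_in n (D x))"

lemma pbar_linear:
  "pbar (u + v) = pbar u + pbar v" "pbar (scl r u) = scl r (pbar u)" "pbar (u - v) = pbar u - pbar v"
  "pbar 0 = 0"
  by (simp_all add: pbar_def lin_add lin_scl lin_minus)

lemma pbar_nth_in: "pbar (nth_in n f) = nth_in n (proj f)"
  by (rule lin_eqI[where F = "\<lambda>f. pbar (nth_in n f)"])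
    (simp_all add: pbar_def shift_linear lin_add lin_scl, simp add: nth_in_def)

lemma pbar_pbar: "pbar (pbar u) = pbar u"
  by (rule nth_in_eqI[where F = "\<lambda>u. pbar (pbar u)"]) (simp_all add: pbar_linear pbar_nth_in)

lemma pbar_up: "pbar (up u) = up (pbar u)"
  by (rule nth_in_eqI[where F = "\<lambda>u. pbar (up u)"])
    (simp_all add: pbar_linear pbar_nth_in shift_linear shift_nth_in)

lemma pbar_down: "pbar (down u) = down (pbar u)"
proof (rule nth_in_eqI[where F = "\<lambda>u. pbar (down u)"])
  show "pbar (down (nth_in n f)) = down (pbar (nth_in n f))" for n f
    by (cases n) (simp_all add: pbar_linear pbar_nth_in shift_nth_in)
qed (simp_all add: pbar_linear shift_linear)

lemma fst_out_pbar: "fst_out (pbar u) = proj (fst_out u)"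
proof (rule nth_in_eqI[where F = "\<lambda>u. fst_out (pbar u)"])
  show "fst_out (pbar (nth_in n f)) = proj (fst_out (nth_in n f))" for n f
    by (cases n) (simp_all add: pbar_nth_in shift_nth_in)
qed (simp_all add: pbar_linear shift_linear lin_add lin_scl)

lemma fst_out_up: "fst_out (up u) = 0"
  by (rule nth_in_eqI[where F = "\<lambda>u. fst_out (up u)" and G = "\<lambda>_. 0"])
    (simp_all add: shift_linear shift_nth_in)

lemma down_up: "down (up u) = u"
  by (rule nth_in_eqI[where F = "\<lambda>u. down (up u)" and G = "\<lambda>u. u"])
    (simp_all add: shift_linear shift_nth_in)

lemma up_down: "up (down u) = u - nth_in 0 (fst_out u)"
proof (rule nth_in_eqI[where F = "\<lambda>u. up (down u)"])
  show "up (down (nth_in n f)) = nth_in n f - nth_in 0 (fst_out (nth_in n f))" for n f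
    by (cases n) (simp_all add: shift_linear shift_nth_in, simp_all add: up_def)
qed (simp_all add: shift_linear scl_distribs)

definition head :: "((nat \<times> 'x) \<Rightarrow>\<^sub>0 'r) \<Rightarrow> 'x \<Rightarrow>\<^sub>0 'r"
  where "head u = proj (fst_out u)"

definition tail :: "((nat \<times> 'x) \<Rightarrow>\<^sub>0 'r) \<Rightarrow> (nat \<times> 'x) \<Rightarrow>\<^sub>0 'r"
  where "tail u = u - pbar u + down (pbar u)"

text \<open>\<open>F\<close> splits into the image and the kernel of \<open>pbar\<close>, the image
  being countably many copies of \<open>L\<close>. Packing shifts these copies up by one and puts
  \<open>l\<close> into the vacated copy 0, while the kernel part \<open>w - pbar w\<close> stays in
  place. The maps \<open>head\<close> and \<open>tail\<close> undo this.\<close>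

definition pack :: "('x \<Rightarrow>\<^sub>0 'r) \<Rightarrow> ((nat \<times> 'x) \<Rightarrow>\<^sub>0 'r) \<Rightarrow> (nat \<times> 'x) \<Rightarrow>\<^sub>0 'r"
  where "pack l w = nth_in 0 l + (w - pbar w) + up (pbar w)"

lemma head_linear: "head (u + v) = head u + head v" "head (scl r u) = scl r (head u)"
  by (simp_all add: head_def shift_linear lin_add lin_scl)

lemma tail_linear: "tail (u + v) = tail u + tail v" "tail (scl r u) = scl r (tail u)"
  by (simp_all add: tail_def pbar_linear shift_linear scl_distribs)

lemma head_pack: "proj l = l \<Longrightarrow> head (pack l w) = l"
  by (simp add: head_def pack_def shift_linear shift_nth_in fst_out_pbar fst_out_up lin_add lin_minus)

lemma tail_pack: "proj l = l \<Longrightarrow> tail (pack l w) = w"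
  by (simp add: tail_def pack_def pbar_linear shift_linear shift_nth_in pbar_nth_in pbar_pbar pbar_up
      pbar_down down_up)

lemma pack_head_tail: "pack (head u) (tail u) = u"
  by (simp add: pack_def tail_def head_def pbar_linear shift_linear pbar_pbar pbar_down up_down
      fst_out_pbar)

lemma proj_head [simp]: "proj (head u) = head u"
  by (simp add: head_def)

lemma head_tail_eqI: "head u = head v \<Longrightarrow> tail u = tail v \<Longrightarrow> u = v"
  by (metis pack_head_tail)

section \<open>The flat connection and the semidirect product\<close>

definition nab :: "('x \<Rightarrow>\<^sub>0 'r) \<Rightarrow> ((nat \<times> 'x) \<Rightarrow>\<^sub>0 'r) \<Rightarrow> (nat \<times> 'x) \<Rightarrow>\<^sub>0 'r"
  where "nab f = Poly_Mapping.map (anc f)"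

lemma lookup_nab: "Poly_Mapping.lookup (nab f w) k = anc f (Poly_Mapping.lookup w k)"
  unfolding nab_def by (simp add: Poly_Mapping.map.rep_eq when_def)

lemma nab_linear:
  "nab f (u + v) = nab f u + nab f v" "nab f (u - v) = nab f u - nab f v"
  "nab f (scl r u) = scl r (nab f u) + scl (anc f r) u"
  "nab (f + g) u = nab f u + nab g u" "nab (scl r f) u = scl r (nab f u)" "nab f 0 = 0"
  by (rule poly_mapping_eqI; simp add: lookup_nab lookup_add lookup_minus anc_add_right anc_minus_right
      anc_mult anc_add anc_scl)+

text \<open>Flatness: the connection acts on every coordinate by the anchor, so its curvature
  vanishes by \<open>anc_lb\<close>.\<close>

lemma nab_lb: "nab (lb f g) u = nab f (nab g u) - nab g (nab f u)"
  by (rule poly_mapping_eqI) (simp add: lookup_nab lookup_minus anc_lb)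

text \<open>The bracket of the semidirect product of \<open>L\<close> with the abelian Lie algebra
  \<open>F\<close>, transported along \<open>pack\<close>.\<close>

definition fbr :: "((nat \<times> 'x) \<Rightarrow>\<^sub>0 'r) \<Rightarrow> ((nat \<times> 'x) \<Rightarrow>\<^sub>0 'r) \<Rightarrow> (nat \<times> 'x) \<Rightarrow>\<^sub>0 'r"
  where "fbr u v = pack (lb (head u) (head v)) (nab (head u) (tail v) - nab (head v) (tail u))"

definition fanc :: "((nat \<times> 'x) \<Rightarrow>\<^sub>0 'r) \<Rightarrow> 'r \<Rightarrow> 'r"
  where "fanc u r = anc (head u) r"

lemma head_fbr: "head (fbr u v) = lb (head u) (head v)"
  by (simp add: fbr_def head_pack)

lemma tail_fbr: "tail (fbr u v) = nab (head u) (tail v) - nab (head v) (tail u)"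
  by (simp add: fbr_def tail_pack)

lemma head_tail_zero: "head 0 = 0" "tail 0 = 0"
  using head_linear(2)[of 0 0] tail_linear(2)[of 0 0] by auto

sublocale free_lie_rinehart some_le fbr fanc
proof
  show "some_le i i" for i :: "nat \<times> 'x" by (rule some_le)
  show "some_le i j \<Longrightarrow> some_le j i \<Longrightarrow> i = j" for i j :: "nat \<times> 'x" by (rule some_le)
  show "some_le i j \<Longrightarrow> some_le j k \<Longrightarrow> some_le i k" for i j k :: "nat \<times> 'x" by (rule some_le)
  show "some_le i j \<or> some_le j i" for i j :: "nat \<times> 'x" by (rule some_le)
  show "fanc (x + y) r = fanc x r + fanc y r" for x y r
    by (simp add: fanc_def head_linear anc_add)
  show "fanc (scl s x) r = s * fanc x r" for s x r
    by (simp add: fanc_def head_linear anc_scl)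
  show "fanc x (r + s) = fanc x r + fanc x s" for x r s
    by (simp add: fanc_def anc_add_right)
  show "fanc x (r * s) = fanc x r * s + r * fanc x s" for x r s
    by (simp add: fanc_def anc_mult)
  show "fbr x (y + z) = fbr x y + fbr x z" for x y z
    by (rule head_tail_eqI)
      (simp_all add: head_fbr tail_fbr head_linear tail_linear nab_linear lb_add_right)
  \<comment> \<open>The projection in \<open>lb_scl_right\<close> is harmless, because heads lie in
    the image of \<open>proj\<close>.\<close>
  show "fbr x (scl r y) = scl r (fbr x y) + scl (fanc x r) y" for x r y
    by (rule head_tail_eqI)
      (simp_all add: head_fbr tail_fbr head_linear tail_linear nab_linear lb_scl_right fanc_def
        scl_distribs)
  show "fbr x x = 0" for x
    by (rule head_tail_eqI) (simp_all add: head_fbr tail_fbr head_tail_zero lb_alt)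
  show "fbr (x + y) z = fbr x z + fbr y z" for x y z
    by (rule head_tail_eqI)
      (simp_all add: head_fbr tail_fbr head_linear tail_linear nab_linear lb_add_left)
  \<comment> \<open>In the head this is the Jacobi identity of \<open>L\<close>; in the tail
    everything cancels by flatness.\<close>
  show "fbr x (fbr y z) + fbr y (fbr z x) + fbr z (fbr x y) = 0" for x y z
    by (rule head_tail_eqI)
      (simp_all add: head_fbr tail_fbr head_linear tail_linear nab_linear nab_lb head_tail_zero
        lb_jacobi)
  show "fanc (fbr x y) r = fanc x (fanc y r) - fanc y (fanc x r)" for x y r
    by (simp add: fanc_def head_fbr anc_lb)
qed

text \<open>For \<open>l\<close> in \<open>L\<close>, \<open>nth_in 0 l\<close> equals
  \<open>pack l 0\<close>. Hence \<open>L\<close> acts on polynomials as a subalgebra of the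
  semidirect product.\<close>

lemma head_tail_nth_in: "proj l = l \<Longrightarrow> head (nth_in 0 l) = l" "proj l = l \<Longrightarrow> tail (nth_in 0 l) = 0"
  by (simp_all add: head_def tail_def shift_nth_in pbar_nth_in)

definition hact :: "'x \<Rightarrow> ((nat \<times> 'x) multiset \<Rightarrow>\<^sub>0 'r) \<Rightarrow> (nat \<times> 'x) multiset \<Rightarrow>\<^sub>0 'r"
  where "hact x = X (nth_in 0 (D x))"

lemma hact_commutator: "hact x (hact y v) - hact y (hact x v) = hact (br0 x y) v"
proof -
  have "lb (D x) (D y) = D (br0 x y)"
    using lb_proj_left[of "single1 x" "D y"] by (simp add: lb_gen_D)
  then have "fbr (nth_in 0 (D x)) (nth_in 0 (D y)) = nth_in 0 (D (br0 x y))"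
    by - (rule head_tail_eqI, simp_all add: head_fbr tail_fbr head_tail_nth_in lin_D_D nab_linear)
  then show ?thesis unfolding hact_def X_commutator by simp
qed

lemma hact_add_right: "hact x (v + w) = hact x v + hact x w"
  by (simp add: hact_def X_add_right)

lemma hact_scl_right: "hact x (scl r v) = scl r (hact x v) + scl (anc0 x r) v"
  unfolding hact_def X_scl_right by (simp add: fanc_def head_tail_nth_in lin_D_D anc_D)

lemma hact_D: "D x = D y + D z \<Longrightarrow> hact x v = hact y v + hact z v"
  "D x = scl r (D y) \<Longrightarrow> hact x v = scl r (hact y v)"
  by (simp_all add: hact_def shift_linear X_add X_scl)

end

section \<open>Commutative rings with carrier as factors of a ring type\<close>

text \<open>
  The operators above live over a type of class \<open>comm_ring_1\<close>. A commutative ring on a subset of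
  \<open>'a\<close> is a direct factor of the following ring, the product of all commutative rings
  on subsets of \<open>'a\<close> and of the integers (the integers only ensure \<open>0 \<noteq> 1\<close>).
\<close>
typedef 'a uring = "{p :: ('a ring \<Rightarrow> 'a) \<times> int.
    \<forall>s. if cring s then fst p s \<in> carrier s else fst p s = undefined}"
proof
  show "(\<lambda>s. if cring s then \<zero>\<^bsub>s\<^esub> else undefined, 0)
    \<in> {p :: ('a ring \<Rightarrow> 'a) \<times> int. \<forall>s. if cring s then fst p s \<in> carrier s else fst p s = undefined}"
    by (auto simp: cring.cring_simprules(2))
qed

setup_lifting type_definition_uring

instantiation uring :: (type) comm_ring_1
begin

lift_definition zero_uring :: "'a uring"
  is "(\<lambda>s. if cring s then \<zero>\<^bsub>s\<^esub> else undefined, 0)"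
  by (auto simp: cring.cring_simprules)

lift_definition one_uring :: "'a uring"
  is "(\<lambda>s. if cring s then \<one>\<^bsub>s\<^esub> else undefined, 1)"
  by (auto simp: cring.cring_simprules)

lift_definition plus_uring :: "'a uring \<Rightarrow> 'a uring \<Rightarrow> 'a uring"
  is "\<lambda>p q. (\<lambda>s. if cring s then fst p s \<oplus>\<^bsub>s\<^esub> fst q s else undefined, snd p + snd q)"
  by (auto simp: cring.cring_simprules split: if_splits)

lift_definition times_uring :: "'a uring \<Rightarrow> 'a uring \<Rightarrow> 'a uring"
  is "\<lambda>p q. (\<lambda>s. if cring s then fst p s \<otimes>\<^bsub>s\<^esub> fst q s else undefined, snd p * snd q)"
  by (auto simp: cring.cring_simprules split: if_splits)

lift_definition uminus_uring :: "'a uring \<Rightarrow> 'a uring"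
  is "\<lambda>p. (\<lambda>s. if cring s then \<ominus>\<^bsub>s\<^esub> fst p s else undefined, - snd p)"
  by (auto simp: cring.cring_simprules split: if_splits)

definition minus_uring :: "'a uring \<Rightarrow> 'a uring \<Rightarrow> 'a uring"
  where "minus_uring p q = p + - q"

instance
proof
  fix a b c :: "'a uring"
  show "a * b * c = a * (b * c)" by transfer (auto simp: fun_eq_iff cring.cring_simprules)
  show "a * b = b * a" by transfer (auto simp: fun_eq_iff cring.cring_simprules)
  show "1 * a = a" by transfer (auto simp: fun_eq_iff prod_eq_iff cring.cring_simprules)
  show "a + b + c = a + (b + c)" by transfer (auto simp: fun_eq_iff cring.cring_simprules)
  show "a + b = b + a" by transfer (auto simp: fun_eq_iff cring.cring_simprules)
  show "0 + a = a" by transfer (auto simp: fun_eq_iff prod_eq_iff cring.cring_simprules)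
  show "- a + a = 0" by transfer (auto simp: fun_eq_iff prod_eq_iff cring.cring_simprules)
  show "a - b = a + - b" by (simp add: minus_uring_def)
  show "(a + b) * c = a * c + b * c"
    by transfer (auto simp: fun_eq_iff cring.cring_simprules algebra_simps)
  show "(0 :: 'a uring) \<noteq> 1" by transfer auto
qed

end

text \<open>The factors of \<open>uring\<close> are indexed by plain ring records; this truncation
  makes such an index of a record with further fields, like the algebra \<open>A\<close>.\<close>

definition base_ring :: "('a, 'm) ring_scheme \<Rightarrow> 'a ring"
  where "base_ring A = \<lparr>carrier = carrier A, monoid.mult = monoid.mult A, one = one A, zero = zero A, add = add A\<rparr>"

lemma base_ring_simps [simp]:
  "carrier (base_ring A) = carrier A" "monoid.mult (base_ring A) = monoid.mult A" "one (base_ring A) = one A"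
  "zero (base_ring A) = zero A" "add (base_ring A) = add A"
  by (simp_all add: base_ring_def)

lemma (in cring) cring_base_ring: "cring (base_ring R)"
  by (rule cringI; (rule abelian_groupI comm_monoidI)?)
    (auto simp: m_assoc l_distr a_assoc intro: m_comm a_comm a_inv_closed l_neg)

text \<open>The inclusion of one factor, zero in all the others and in the integers. For a
  commutative ring it respects sums and products on the carrier and sends the unit to an idempotent;
  elements outside the carrier go to zero.\<close>

lift_definition emb :: "('a, 'm) ring_scheme \<Rightarrow> 'a \<Rightarrow> 'a uring"
  is "\<lambda>A a. (\<lambda>s. if cring s then (if s = base_ring A \<and> a \<in> carrier A then a else \<zero>\<^bsub>s\<^esub>) else undefined, 0)"
  by (auto simp: cring.cring_simprules)

lift_definition component :: "('a, 'm) ring_scheme \<Rightarrow> 'a uring \<Rightarrow> 'a"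
  is "\<lambda>A p. fst p (base_ring A)" .

definition uring_at :: "'a ring \<Rightarrow> 'a uring \<Rightarrow> 'a"
  where "uring_at s p = fst (Rep_uring p) s"

lemma uring_at_closed: "cring s \<Longrightarrow> uring_at s p \<in> carrier s"
  unfolding uring_at_def by transfer (metis (full_types))

lemma uring_eqI:
  assumes "\<And>s. cring s \<Longrightarrow> uring_at s p = uring_at s q" "snd (Rep_uring p) = snd (Rep_uring q)"
  shows "p = q"
proof -
  have "fst (Rep_uring p) s = fst (Rep_uring q) s" for s
    using assms(1)[of s] Rep_uring[of p] Rep_uring[of q]
    unfolding uring_at_def by (cases "cring s") (force)+
  then show ?thesis
    using assms(2) by (simp add: Rep_uring_inject[symmetric] prod_eq_iff fun_eq_iff)
qed

lemma uring_at_simps: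
  assumes "cring s"
  shows "uring_at s (p + q) = uring_at s p \<oplus>\<^bsub>s\<^esub> uring_at s q"
    "uring_at s (p * q) = uring_at s p \<otimes>\<^bsub>s\<^esub> uring_at s q" "uring_at s 0 = \<zero>\<^bsub>s\<^esub>"
    "uring_at s (emb A a) = (if s = base_ring A \<and> a \<in> carrier A then a else \<zero>\<^bsub>s\<^esub>)"
  using assms unfolding uring_at_def by (transfer, simp)+

lemma cring_zero_simps:
  assumes "cring s"
  shows "\<zero>\<^bsub>s\<^esub> \<oplus>\<^bsub>s\<^esub> \<zero>\<^bsub>s\<^esub> = \<zero>\<^bsub>s\<^esub>" "\<zero>\<^bsub>s\<^esub> \<otimes>\<^bsub>s\<^esub> \<zero>\<^bsub>s\<^esub> = \<zero>\<^bsub>s\<^esub>"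
    "x \<in> carrier s \<Longrightarrow> \<zero>\<^bsub>s\<^esub> \<otimes>\<^bsub>s\<^esub> x = \<zero>\<^bsub>s\<^esub>"
    "x \<in> carrier s \<Longrightarrow> y \<in> carrier s \<Longrightarrow> x \<oplus>\<^bsub>s\<^esub> y \<in> carrier s"
    "x \<in> carrier s \<Longrightarrow> y \<in> carrier s \<Longrightarrow> x \<otimes>\<^bsub>s\<^esub> y \<in> carrier s"
proof -
  interpret cring s by fact
  show "\<zero>\<^bsub>s\<^esub> \<oplus>\<^bsub>s\<^esub> \<zero>\<^bsub>s\<^esub> = \<zero>\<^bsub>s\<^esub>" "\<zero>\<^bsub>s\<^esub> \<otimes>\<^bsub>s\<^esub> \<zero>\<^bsub>s\<^esub> = \<zero>\<^bsub>s\<^esub>"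
    "x \<in> carrier s \<Longrightarrow> \<zero>\<^bsub>s\<^esub> \<otimes>\<^bsub>s\<^esub> x = \<zero>\<^bsub>s\<^esub>"
    "x \<in> carrier s \<Longrightarrow> y \<in> carrier s \<Longrightarrow> x \<oplus>\<^bsub>s\<^esub> y \<in> carrier s"
    "x \<in> carrier s \<Longrightarrow> y \<in> carrier s \<Longrightarrow> x \<otimes>\<^bsub>s\<^esub> y \<in> carrier s" by auto
qed

context cring
begin

lemma component_closed [simp, intro]: "component R p \<in> carrier R"
  using cring_base_ring by transfer (metis base_ring_simps(1))

lemma component_add [simp]: "component R (p + q) = component R p \<oplus> component R q"
  using cring_base_ring by transfer simp

lemma component_mult [simp]: "component R (p * q) = component R p \<otimes> component R q"
  using cring_base_ring by transfer simp

lemma component_zero [simp]: "component R 0 = \<zero>"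
  using cring_base_ring by transfer simp

lemma component_emb [simp]: "a \<in> carrier R \<Longrightarrow> component R (emb R a) = a"
  using cring_base_ring by transfer simp

lemma emb_add: "a \<in> carrier R \<Longrightarrow> b \<in> carrier R \<Longrightarrow> emb R (a \<oplus> b) = emb R a + emb R b"
proof (rule uring_eqI)
  fix s :: "'a ring"
  assume *: "a \<in> carrier R" "b \<in> carrier R" "cring s"
  then show "uring_at s (emb R (a \<oplus> b)) = uring_at s (emb R a + emb R b)"
    by (cases "s = base_ring R") (simp_all add: uring_at_simps cring_zero_simps)
qed (transfer, simp)

lemma emb_zero [simp]: "emb R \<zero> = 0"
proof (rule uring_eqI)
  fix s :: "'a ring"
  assume *: "cring s"
  then show "uring_at s (emb R \<zero>) = uring_at s 0"
    by (cases "s = base_ring R") (simp_all add: uring_at_simps)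
qed (transfer, simp)

text \<open>A direct factor is an ideal, so a multiplication into it sees only the component there.
  This is how arbitrary coefficients from \<open>uring\<close> are traded for elements of the
  carrier.\<close>

lemma emb_times: "a \<in> carrier R \<Longrightarrow> emb R a * p = emb R (a \<otimes> component R p)"
proof (rule uring_eqI)
  fix s :: "'a ring"
  assume *: "a \<in> carrier R" "cring s"
  then show "uring_at s (emb R a * p) = uring_at s (emb R (a \<otimes> component R p))"
    by (cases "s = base_ring R")
      (simp_all add: uring_at_simps cring_zero_simps uring_at_closed, simp add: component_def uring_at_def)
qed (transfer, simp)

lemma emb_mult: "a \<in> carrier R \<Longrightarrow> b \<in> carrier R \<Longrightarrow> emb R (a \<otimes> b) = emb R a * emb R b"
  by (simp add: emb_times)

lemma emb_minus: "a \<in> carrier R \<Longrightarrow> b \<in> carrier R \<Longrightarrow> emb R (a \<ominus> b) = emb R a - emb R b"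
  using emb_add[of "a \<ominus> b" b] by (simp add: minus_eq a_assoc l_neg)

end

section \<open>Free modules and quotient modules\<close>

lemma free_module_carrier:
  "f \<in> carrier (free_module R X) \<longleftrightarrow>
    (\<forall>x. f x \<in> carrier R) \<and> (\<forall>x. x \<notin> X \<longrightarrow> f x = \<zero>\<^bsub>R\<^esub>) \<and> finite {x. f x \<noteq> \<zero>\<^bsub>R\<^esub>}"
  by (simp add: free_module_def)

lemma free_module_simps [simp]:
  "\<zero>\<^bsub>free_module R X\<^esub> = (\<lambda>x. \<zero>\<^bsub>R\<^esub>)" "f \<oplus>\<^bsub>free_module R X\<^esub> g = (\<lambda>x. f x \<oplus>\<^bsub>R\<^esub> g x)"
  "r \<odot>\<^bsub>free_module R X\<^esub> f = (\<lambda>x. r \<otimes>\<^bsub>R\<^esub> f x)"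
  by (simp_all add: free_module_def)

lemma (in abelian_group) minus_eq_zero_iff:
  assumes "x \<in> carrier G" "y \<in> carrier G"
  shows "x \<ominus> y = \<zero> \<longleftrightarrow> x = y"
  using assms by (metis a_minus_def add.inv_closed minus_equality r_neg)

lemma module_homI:
  assumes "\<And>x. x \<in> carrier M \<Longrightarrow> f x \<in> carrier N"
    "\<And>x y. x \<in> carrier M \<Longrightarrow> y \<in> carrier M \<Longrightarrow> f (x \<oplus>\<^bsub>M\<^esub> y) = f x \<oplus>\<^bsub>N\<^esub> f y"
    "\<And>r x. r \<in> carrier R \<Longrightarrow> x \<in> carrier M \<Longrightarrow> f (r \<odot>\<^bsub>M\<^esub> x) = r \<odot>\<^bsub>N\<^esub> f x"
  shows "f \<in> module_hom R M N"
  using assms by (auto simp: module_hom_def)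

lemma module_homD:
  assumes "f \<in> module_hom R M N"
  shows "x \<in> carrier M \<Longrightarrow> f x \<in> carrier N"
    "x \<in> carrier M \<Longrightarrow> y \<in> carrier M \<Longrightarrow> f (x \<oplus>\<^bsub>M\<^esub> y) = f x \<oplus>\<^bsub>N\<^esub> f y"
    "r \<in> carrier R \<Longrightarrow> x \<in> carrier M \<Longrightarrow> f (r \<odot>\<^bsub>M\<^esub> x) = r \<odot>\<^bsub>N\<^esub> f x"
  using assms by (auto simp: module_hom_def)

lemma module_hom_zero:
  assumes "module R M" "module R N" "f \<in> module_hom R M N"
  shows "f \<zero>\<^bsub>M\<^esub> = \<zero>\<^bsub>N\<^esub>"
proof -
  interpret M: module R M by fact
  interpret N: module R N by fact
  have "f (\<zero>\<^bsub>R\<^esub> \<odot>\<^bsub>M\<^esub> \<zero>\<^bsub>M\<^esub>) = \<zero>\<^bsub>R\<^esub> \<odot>\<^bsub>N\<^esub> f \<zero>\<^bsub>M\<^esub>"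
    using module_homD[OF assms(3)] by blast
  then show ?thesis using module_homD(1)[OF assms(3)] by simp
qed

lemma module_hom_uminus:
  assumes "module R M" "module R N" "f \<in> module_hom R M N" "x \<in> carrier M"
  shows "f (\<ominus>\<^bsub>M\<^esub> x) = \<ominus>\<^bsub>N\<^esub> f x"
proof -
  interpret M: module R M by fact
  interpret N: module R N by fact
  have "f (\<ominus>\<^bsub>M\<^esub> x) \<oplus>\<^bsub>N\<^esub> f x = \<zero>\<^bsub>N\<^esub>"
    using module_homD(2)[OF assms(3), of "\<ominus>\<^bsub>M\<^esub> x" x] module_hom_zero[OF assms(1-3)] assms(4)
    by (simp add: M.M.l_neg)
  then show ?thesis
    using module_homD(1)[OF assms(3)] assms(4) by (simp add: N.M.minus_equality)
qed

lemma module_hom_minus: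
  assumes "module R M" "module R N" "f \<in> module_hom R M N" "x \<in> carrier M" "y \<in> carrier M"
  shows "f (x \<ominus>\<^bsub>M\<^esub> y) = f x \<ominus>\<^bsub>N\<^esub> f y"
proof -
  interpret M: module R M by fact
  interpret N: module R N by fact
  show ?thesis
    using assms module_homD[OF assms(3)] by (simp add: a_minus_def module_hom_uminus)
qed

lemma module_hom_kernel:
  assumes "module R M" "module R N" "f \<in> module_hom R M N"
  shows "submodule {x \<in> carrier M. f x = \<zero>\<^bsub>N\<^esub>} R M"
proof -
  interpret M: module R M by fact
  interpret N: module R N by fact
  show ?thesis
    using assms module_homD[OF assms(3)]
    by (intro M.submoduleI) (auto simp: module_hom_zero module_hom_uminus)
qed

context module
begin

lemma generated_submodule_subset: "S \<subseteq> generated_submodule R M S"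
  unfolding generated_submodule_def by blast

lemma generated_submodule_minimal:
  "submodule N R M \<Longrightarrow> S \<subseteq> N \<Longrightarrow> generated_submodule R M S \<subseteq> N"
  unfolding generated_submodule_def by blast

lemma generated_submodule:
  assumes "S \<subseteq> carrier M"
  shows "submodule (generated_submodule R M S) R M"
proof (rule submoduleI)
  show "generated_submodule R M S \<subseteq> carrier M"
    using assms by (intro generated_submodule_minimal carrier_is_submodule)
qed (auto simp: generated_submodule_def subsetD[OF submoduleE(1)] submoduleE
    intro: submodule.axioms(1)[THEN subgroup.one_closed, simplified])

lemma submodule_zero: "submodule N R M \<Longrightarrow> \<zero>\<^bsub>M\<^esub> \<in> N"
  using submodule.axioms(1)[THEN subgroup.one_closed] by force

lemma submodule_abelian_subgroup: "submodule N R M \<Longrightarrow> abelian_subgroup N M"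
  using submodule.axioms(1) M.abelian_group_axioms
  by (intro abelian_subgroupI3 additive_subgroup.intro) auto

lemma coset_eq_iff:
  assumes "submodule N R M" "x \<in> carrier M" "y \<in> carrier M"
  shows "N +>\<^bsub>M\<^esub> x = N +>\<^bsub>M\<^esub> y \<longleftrightarrow> x \<ominus>\<^bsub>M\<^esub> y \<in> N"
proof -
  interpret abelian_subgroup N M using submodule_abelian_subgroup assms(1) .
  show ?thesis
    using a_rcos_module[OF assms(3,2)] a_repr_independence'[OF _ assms(3)] a_rcos_self[OF assms(2)]
    by (auto simp: a_minus_def)
qed

lemma coset_zero: "submodule N R M \<Longrightarrow> N +>\<^bsub>M\<^esub> \<zero>\<^bsub>M\<^esub> = N"
  using submoduleE(1) by (intro a_coset_add_zero) auto

lemma coset_eq_zero_iff: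
  assumes "submodule N R M" "x \<in> carrier M"
  shows "N +>\<^bsub>M\<^esub> x = N \<longleftrightarrow> x \<in> N"
proof -
  have *: "\<ominus>\<^bsub>M\<^esub> \<zero>\<^bsub>M\<^esub> = \<zero>\<^bsub>M\<^esub>" by (rule M.minus_equality) auto
  have "x \<ominus>\<^bsub>M\<^esub> \<zero>\<^bsub>M\<^esub> = x" unfolding a_minus_def * using assms(2) by simp
  then show ?thesis
    using coset_eq_iff[OF assms M.zero_closed] coset_zero[OF assms(1)] by simp
qed

lemma quotient_module_simps:
  assumes "submodule N R M"
  shows "carrier (quotient_module M N) = (\<lambda>x. N +>\<^bsub>M\<^esub> x) ` carrier M"
    "\<zero>\<^bsub>quotient_module M N\<^esub> = N"
    "x \<in> carrier M \<Longrightarrow> y \<in> carrier M \<Longrightarrow>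
      (N +>\<^bsub>M\<^esub> x) \<oplus>\<^bsub>quotient_module M N\<^esub> (N +>\<^bsub>M\<^esub> y) = N +>\<^bsub>M\<^esub> (x \<oplus>\<^bsub>M\<^esub> y)"
    "r \<in> carrier R \<Longrightarrow> x \<in> carrier M \<Longrightarrow>
      r \<odot>\<^bsub>quotient_module M N\<^esub> (N +>\<^bsub>M\<^esub> x) = N +>\<^bsub>M\<^esub> (r \<odot>\<^bsub>M\<^esub> x)"
proof -
  interpret abelian_subgroup N M using submodule_abelian_subgroup assms .
  show "carrier (quotient_module M N) = (\<lambda>x. N +>\<^bsub>M\<^esub> x) ` carrier M"
    unfolding quotient_module_def A_RCOSETS_def' by auto
  show "\<zero>\<^bsub>quotient_module M N\<^esub> = N"
    by (simp add: quotient_module_def)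
  show "x \<in> carrier M \<Longrightarrow> y \<in> carrier M \<Longrightarrow>
      (N +>\<^bsub>M\<^esub> x) \<oplus>\<^bsub>quotient_module M N\<^esub> (N +>\<^bsub>M\<^esub> y) = N +>\<^bsub>M\<^esub> (x \<oplus>\<^bsub>M\<^esub> y)"
    by (simp add: quotient_module_def a_rcos_sum)
  assume r: "r \<in> carrier R" and x: "x \<in> carrier M"
  have "N +>\<^bsub>M\<^esub> (r \<odot>\<^bsub>M\<^esub> y) = N +>\<^bsub>M\<^esub> (r \<odot>\<^bsub>M\<^esub> x)" if "y \<in> N +>\<^bsub>M\<^esub> x" for y
  proof -
    have y: "y \<in> carrier M" using that x a_elemrcos_carrier by blast
    have "y \<ominus>\<^bsub>M\<^esub> x \<in> N" using that x y a_rcos_module[OF x y] by (simp add: a_minus_def)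
    then have "r \<odot>\<^bsub>M\<^esub> (y \<ominus>\<^bsub>M\<^esub> x) \<in> N" using r submoduleE(4)[OF assms] by blast
    then have "r \<odot>\<^bsub>M\<^esub> y \<ominus>\<^bsub>M\<^esub> r \<odot>\<^bsub>M\<^esub> x \<in> N"
      using r x y by (simp add: a_minus_def smult_r_distr smult_r_minus)
    then show ?thesis using coset_eq_iff[OF assms] r x y by simp
  qed
  then have "(\<Union>y\<in>N +>\<^bsub>M\<^esub> x. N +>\<^bsub>M\<^esub> (r \<odot>\<^bsub>M\<^esub> y)) = (\<Union>y\<in>N +>\<^bsub>M\<^esub> x. N +>\<^bsub>M\<^esub> (r \<odot>\<^bsub>M\<^esub> x))"
    by (intro SUP_cong) auto
  moreover have "N +>\<^bsub>M\<^esub> x \<noteq> {}" using a_rcos_self[OF x] by blast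
  ultimately show "r \<odot>\<^bsub>quotient_module M N\<^esub> (N +>\<^bsub>M\<^esub> x) = N +>\<^bsub>M\<^esub> (r \<odot>\<^bsub>M\<^esub> x)"
    by (simp add: quotient_module_def)
qed

lemma quotient_module:
  assumes "submodule N R M"
  shows "module R (quotient_module M N)"
proof -
  note simps = quotient_module_simps[OF assms] coset_zero[OF assms, symmetric]
  have "abelian_group (quotient_module M N)"
  proof (rule abelian_groupI)
    fix C assume "C \<in> carrier (quotient_module M N)"
    then obtain x where x: "x \<in> carrier M" "C = N +>\<^bsub>M\<^esub> x" by (auto simp: simps(1))
    then have "(N +>\<^bsub>M\<^esub> (\<ominus>\<^bsub>M\<^esub> x)) \<oplus>\<^bsub>quotient_module M N\<^esub> C = \<zero>\<^bsub>quotient_module M N\<^esub>"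
      using coset_zero[OF assms] by (simp add: simps(2,3) M.l_neg)
    then show "\<exists>C'\<in>carrier (quotient_module M N). C' \<oplus>\<^bsub>quotient_module M N\<^esub> C = \<zero>\<^bsub>quotient_module M N\<^esub>"
      using x by (intro bexI) (auto simp: simps(1))
    show "\<zero>\<^bsub>quotient_module M N\<^esub> \<oplus>\<^bsub>quotient_module M N\<^esub> C = C"
      using simps(3)[of "\<zero>\<^bsub>M\<^esub>" x] coset_zero[OF assms] x by (simp add: simps(2))
  qed (use coset_zero[OF assms] in \<open>auto simp: simps(1-3) M.a_ac\<close>)
  then show ?thesis
    using R.is_cring
    by (intro moduleI) (auto simp: quotient_module_simps[OF assms] smult_l_distr smult_r_distr smult_assoc1)
qed

lemma quotient_module_hom: "submodule N R M \<Longrightarrow> (\<lambda>x. N +>\<^bsub>M\<^esub> x) \<in> module_hom R M (quotient_module M N)"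
  by (rule module_homI) (auto simp: quotient_module_simps)

lemma quotient_module_lift:
  assumes "submodule N R M" "f \<in> module_hom R M P" "module R P" "\<And>x. x \<in> N \<Longrightarrow> f x = \<zero>\<^bsub>P\<^esub>"
  obtains f' where "f' \<in> module_hom R (quotient_module M N) P"
    "\<And>x. x \<in> carrier M \<Longrightarrow> f' (N +>\<^bsub>M\<^esub> x) = f x"
proof -
  interpret P: module R P by fact
  note f = module_homD[OF assms(2)]
  define f' where "f' C = f (SOME x. x \<in> carrier M \<and> N +>\<^bsub>M\<^esub> x = C)" for C
  have f': "f' (N +>\<^bsub>M\<^esub> x) = f x" if "x \<in> carrier M" for x
  proof -
    define y where "y = (SOME y. y \<in> carrier M \<and> N +>\<^bsub>M\<^esub> y = N +>\<^bsub>M\<^esub> x)"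
    have y: "y \<in> carrier M \<and> N +>\<^bsub>M\<^esub> y = N +>\<^bsub>M\<^esub> x"
      unfolding y_def using that by (intro someI) auto
    then have "f (y \<ominus>\<^bsub>M\<^esub> x) = \<zero>\<^bsub>P\<^esub>" using assms(1,4) that coset_eq_iff by blast
    then have "f y \<ominus>\<^bsub>P\<^esub> f x = \<zero>\<^bsub>P\<^esub>"
      using module_hom_minus[OF module_axioms assms(3,2)] y that by simp
    then show ?thesis
      using f(1) y that unfolding f'_def y_def[symmetric] by (simp add: P.M.minus_eq_zero_iff)
  qed
  have "f' \<in> module_hom R (quotient_module M N) P"
    by (rule module_homI) (auto simp: quotient_module_simps[OF assms(1)] f' f)
  then show ?thesis using that f' by blast
qed

end

section \<open>Linear maps out of free modules\<close>

definition lincomb ::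
    "('r, 'p) ring_scheme \<Rightarrow> ('r, 'm, 'q) module_scheme \<Rightarrow> ('x \<Rightarrow> 'm) \<Rightarrow> ('x \<Rightarrow> 'r) \<Rightarrow> 'm"
  where "lincomb R M t f = (\<Oplus>\<^bsub>M\<^esub>x\<in>{x. f x \<noteq> \<zero>\<^bsub>R\<^esub>}. f x \<odot>\<^bsub>M\<^esub> t x)"

context cring
begin

lemma free_module_minus_closed:
  assumes "f \<in> carrier (free_module R X)" "g \<in> carrier (free_module R X)"
  shows "(\<lambda>x. f x \<oplus> g x) \<in> carrier (free_module R X)" "(\<lambda>x. \<ominus> f x) \<in> carrier (free_module R X)"
    "r \<in> carrier R \<Longrightarrow> (\<lambda>x. r \<otimes> f x) \<in> carrier (free_module R X)"
proof -
  have "finite ({x. f x \<noteq> \<zero>} \<union> {x. g x \<noteq> \<zero>})"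
    using assms by (simp add: free_module_carrier)
  then have "finite {x. f x \<oplus> g x \<noteq> \<zero>}"
    by (rule finite_subset[rotated]) auto
  then show "(\<lambda>x. f x \<oplus> g x) \<in> carrier (free_module R X)"
    using assms by (auto simp: free_module_carrier)
  have "finite {x. f x \<noteq> \<zero>}" using assms by (simp add: free_module_carrier)
  then have "finite {x. \<ominus> f x \<noteq> \<zero>}" "finite {x. r \<otimes> f x \<noteq> \<zero>}" if "r \<in> carrier R" for r
    using that by (auto elim!: finite_subset[rotated])
  then show "(\<lambda>x. \<ominus> f x) \<in> carrier (free_module R X)"
    "r \<in> carrier R \<Longrightarrow> (\<lambda>x. r \<otimes> f x) \<in> carrier (free_module R X)"
    using assms zero_closed by (auto simp: free_module_carrier)
qed

lemma module_free_module: "module R (free_module R X)"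
proof (rule moduleI)
  show "abelian_group (free_module R X)"
  proof (rule abelian_groupI)
    fix f assume "f \<in> carrier (free_module R X)"
    then show "\<exists>g\<in>carrier (free_module R X). g \<oplus>\<^bsub>free_module R X\<^esub> f = \<zero>\<^bsub>free_module R X\<^esub>"
      by (intro bexI[of _ "\<lambda>x. \<ominus> f x"])
        (auto simp: free_module_minus_closed fun_eq_iff l_neg, auto simp: free_module_carrier l_neg)
  qed (auto simp: free_module_minus_closed fun_eq_iff,
      auto simp: free_module_carrier fun_eq_iff a_assoc intro: a_comm)
  show "cring R" by (rule is_cring)
qed (auto simp: free_module_minus_closed, auto simp: free_module_carrier fun_eq_iff l_distr r_distr m_assoc)

lemma free_basis_closed [simp]: "x \<in> X \<Longrightarrow> free_basis R x \<in> carrier (free_module R X)"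
  by (auto simp: free_module_carrier free_basis_def)

lemma free_module_induct [consumes 1, case_names zero basis add]:
  assumes "f \<in> carrier (free_module R X)" "P (\<lambda>x. \<zero>)"
    "\<And>r x. r \<in> carrier R \<Longrightarrow> x \<in> X \<Longrightarrow> P (r \<odot>\<^bsub>free_module R X\<^esub> free_basis R x)"
    "\<And>f g. f \<in> carrier (free_module R X) \<Longrightarrow> g \<in> carrier (free_module R X) \<Longrightarrow> P f \<Longrightarrow> P g \<Longrightarrow>
      P (f \<oplus>\<^bsub>free_module R X\<^esub> g)"
  shows "P f"
proof -
  have "finite S \<Longrightarrow> f \<in> carrier (free_module R X) \<Longrightarrow> {x. f x \<noteq> \<zero>} = S \<Longrightarrow> P f" for S f
  proof (induction S arbitrary: f rule: finite_induct)
    case empty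
    then have "f = (\<lambda>x. \<zero>)" by auto
    then show ?case using assms(2) by simp
  next
    case (insert x S)
    define g where "g y = (if y = x then \<zero> else f y)" for y
    have x: "f x \<in> carrier R" "x \<in> X" using insert.prems by (auto simp: free_module_carrier)
    have g: "{y. g y \<noteq> \<zero>} = S" using insert by (auto simp: g_def)
    have gc: "g \<in> carrier (free_module R X)"
      using insert.prems g insert.hyps(1) by (auto simp: free_module_carrier g_def)
    define h where "h = f x \<odot>\<^bsub>free_module R X\<^esub> free_basis R x"
    have h: "h \<in> carrier (free_module R X)" "P h"
      unfolding h_def
      by (rule module.smult_closed[OF module_free_module x(1) free_basis_closed[OF x(2)]], rule assms(3)[OF x])
    have "f = h \<oplus>\<^bsub>free_module R X\<^esub> g"
      using insert.prems by (auto simp: fun_eq_iff g_def h_def free_basis_def free_module_carrier)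
    then show ?case
      using assms(4)[OF h(1) gc h(2) insert.IH[OF gc g]] by simp
  qed
  then show ?thesis using assms(1) by (auto simp: free_module_carrier)
qed

lemma module_hom_free_eqI:
  assumes "module R N" "F \<in> module_hom R (free_module R X) N" "G \<in> module_hom R (free_module R X) N"
    "\<And>x. x \<in> X \<Longrightarrow> F (free_basis R x) = G (free_basis R x)" "f \<in> carrier (free_module R X)"
  shows "F f = G f"
  using assms(5)
proof (induction f rule: free_module_induct)
  case zero
  then show ?case
    using module_hom_zero[OF module_free_module assms(1,2)] module_hom_zero[OF module_free_module assms(1,3)]
    by simp
next
  case (basis r x)
  then show ?case
    using module_homD(3)[OF assms(2)] module_homD(3)[OF assms(3)] assms(4) free_basis_closed by metis
next
  case (add f g)
  then show ?case
    using module_homD(2)[OF assms(2)] module_homD(2)[OF assms(3)] by metis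
qed

end

lemma (in module) lincomb_superset:
  assumes "finite S" "{x. f x \<noteq> \<zero>} \<subseteq> S" "f \<in> S \<rightarrow> carrier R" "t \<in> S \<rightarrow> carrier M"
  shows "lincomb R M t f = (\<Oplus>\<^bsub>M\<^esub>x\<in>S. f x \<odot>\<^bsub>M\<^esub> t x)"
  unfolding lincomb_def
  using assms by (intro M.add.finprod_mono_neutral_cong_left) (auto simp: Pi_def)

lemma (in module) lincomb_hom:
  assumes "t \<in> X \<rightarrow> carrier M"
  shows "lincomb R M t \<in> module_hom R (free_module R X) M"
    "x \<in> X \<Longrightarrow> lincomb R M t (free_basis R x) = t x"
proof -
  have supp: "finite {x. f x \<noteq> \<zero>}" "{x. f x \<noteq> \<zero>} \<subseteq> X" "f \<in> S \<rightarrow> carrier R"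
    if "f \<in> carrier (free_module R X)" for f S
    using that by (auto simp: free_module_carrier)
  show "lincomb R M t \<in> module_hom R (free_module R X) M"
  proof (rule module_homI)
    fix f assume f: "f \<in> carrier (free_module R X)"
    show "lincomb R M t f \<in> carrier M"
      unfolding lincomb_def using supp[OF f] assms by (intro M.finsum_closed) (auto simp: Pi_iff)
    fix r assume r: "r \<in> carrier R"
    let ?S = "{x. f x \<noteq> \<zero>}"
    have "lincomb R M t (r \<odot>\<^bsub>free_module R X\<^esub> f) = (\<Oplus>\<^bsub>M\<^esub>x\<in>?S. (r \<otimes> f x) \<odot>\<^bsub>M\<^esub> t x)"
      unfolding free_module_simps using supp[OF f] assms r
      by (intro lincomb_superset) (auto simp: Pi_iff)
    also have "\<dots> = (\<Oplus>\<^bsub>M\<^esub>x\<in>?S. r \<odot>\<^bsub>M\<^esub> (f x \<odot>\<^bsub>M\<^esub> t x))"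
      using supp[OF f] assms r by (intro M.finsum_cong') (auto simp: Pi_iff smult_assoc1)
    also have "\<dots> = r \<odot>\<^bsub>M\<^esub> lincomb R M t f"
      unfolding lincomb_def using supp[OF f] assms r
      by (intro finsum_smult_ldistr[symmetric]) (auto simp: Pi_iff)
    finally show "lincomb R M t (r \<odot>\<^bsub>free_module R X\<^esub> f) = r \<odot>\<^bsub>M\<^esub> lincomb R M t f" .
  next
    fix f g assume f: "f \<in> carrier (free_module R X)" and g: "g \<in> carrier (free_module R X)"
    let ?S = "{x. f x \<noteq> \<zero>} \<union> {x. g x \<noteq> \<zero>}"
    have "lincomb R M t (f \<oplus>\<^bsub>free_module R X\<^esub> g) = (\<Oplus>\<^bsub>M\<^esub>x\<in>?S. (f x \<oplus> g x) \<odot>\<^bsub>M\<^esub> t x)"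
      unfolding free_module_simps using supp[OF f] supp[OF g] assms
      by (intro lincomb_superset) (auto simp: Pi_iff)
    also have "\<dots> = (\<Oplus>\<^bsub>M\<^esub>x\<in>?S. (f x \<odot>\<^bsub>M\<^esub> t x) \<oplus>\<^bsub>M\<^esub> (g x \<odot>\<^bsub>M\<^esub> t x))"
      using supp[OF f] supp[OF g] assms by (intro M.finsum_cong') (auto simp: Pi_iff smult_l_distr)
    also have "\<dots> = (\<Oplus>\<^bsub>M\<^esub>x\<in>?S. f x \<odot>\<^bsub>M\<^esub> t x) \<oplus>\<^bsub>M\<^esub> (\<Oplus>\<^bsub>M\<^esub>x\<in>?S. g x \<odot>\<^bsub>M\<^esub> t x)"
      using supp[OF f] supp[OF g] assms by (intro M.finsum_addf) (auto simp: Pi_iff)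
    also have "(\<Oplus>\<^bsub>M\<^esub>x\<in>?S. f x \<odot>\<^bsub>M\<^esub> t x) = lincomb R M t f"
      using supp[OF f] supp[OF g] assms by (intro lincomb_superset[symmetric]) (auto simp: Pi_iff)
    also have "(\<Oplus>\<^bsub>M\<^esub>x\<in>?S. g x \<odot>\<^bsub>M\<^esub> t x) = lincomb R M t g"
      using supp[OF f] supp[OF g] assms by (intro lincomb_superset[symmetric]) (auto simp: Pi_iff)
    finally show "lincomb R M t (f \<oplus>\<^bsub>free_module R X\<^esub> g) = lincomb R M t f \<oplus>\<^bsub>M\<^esub> lincomb R M t g" .
  qed
  assume x: "x \<in> X"
  have "lincomb R M t (free_basis R x) = (\<Oplus>\<^bsub>M\<^esub>y\<in>{x}. free_basis R x y \<odot>\<^bsub>M\<^esub> t y)"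
    using assms x by (intro lincomb_superset) (auto simp: free_basis_def split: if_splits)
  then show "lincomb R M t (free_basis R x) = t x"
    using assms x by (auto simp: free_basis_def Pi_iff)
qed

section \<open>Free algebras and presented algebras\<close>

lemma module_hom_comp:
  "f \<in> module_hom R M N \<Longrightarrow> g \<in> module_hom R N P \<Longrightarrow> (\<lambda>x. g (f x)) \<in> module_hom R M P"
  by (auto intro!: module_homI simp: module_homD)

lemma module_cong:
  assumes "module R M" "carrier N = carrier M" "add N = add M" "zero N = zero M" "smult N = smult M"
  shows "module R N"
proof -
  interpret module R M by fact
  show ?thesis
  proof (rule moduleI)
    show "abelian_group N"
      by (rule abelian_groupI) (use assms in \<open>auto simp: M.a_assoc intro: M.a_comm M.a_inv_closed M.l_neg\<close>)
  qed (use assms R.is_cring in \<open>auto simp: smult_l_distr smult_r_distr smult_assoc1\<close>)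
qed

lemma a_minus_cong:
  assumes "carrier N = carrier M" "add N = add M" "zero N = zero M"
  shows "x \<ominus>\<^bsub>N\<^esub> y = x \<ominus>\<^bsub>M\<^esub> y"
  using assms by (simp add: a_minus_def a_inv_def m_inv_def)

text \<open>Products need not commute, so scalars must be moved out of each factor separately. Free
  algebras and the enveloping algebra over \<open>K\<close> are of this kind.\<close>

locale assoc_algebra = module + ring M +
  assumes smult_mult_left:
      "\<lbrakk>a \<in> carrier R; x \<in> carrier M; y \<in> carrier M\<rbrakk> \<Longrightarrow> (a \<odot>\<^bsub>M\<^esub> x) \<otimes>\<^bsub>M\<^esub> y = a \<odot>\<^bsub>M\<^esub> (x \<otimes>\<^bsub>M\<^esub> y)"
    and smult_mult_right:
      "\<lbrakk>a \<in> carrier R; x \<in> carrier M; y \<in> carrier M\<rbrakk> \<Longrightarrow> x \<otimes>\<^bsub>M\<^esub> (a \<odot>\<^bsub>M\<^esub> y) = a \<odot>\<^bsub>M\<^esub> (x \<otimes>\<^bsub>M\<^esub> y)"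
begin

lemma module_self: "module R M"
  by (rule module_axioms)

lemma ring_self: "ring M"
  by (rule ring_axioms)

end

definition word_mult :: "('r, 'p) ring_scheme \<Rightarrow> ('x list \<Rightarrow> 'r) \<Rightarrow> ('x list \<Rightarrow> 'r) \<Rightarrow> 'x list \<Rightarrow> 'r"
  where "word_mult R f g w = (\<Oplus>\<^bsub>R\<^esub>i\<in>{..length w}. f (take i w) \<otimes>\<^bsub>R\<^esub> g (drop i w))"

lemma free_algebra_simps:
  "carrier (free_algebra R X) = carrier (free_module R (lists X))"
  "zero (free_algebra R X) = zero (free_module R (lists X))"
  "add (free_algebra R X) = add (free_module R (lists X))"
  "smult (free_algebra R X) = smult (free_module R (lists X))"
  "monoid.mult (free_algebra R X) = word_mult R"
  "one (free_algebra R X) = free_basis R []"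
  by (simp_all add: free_algebra_def word_mult_def fun_eq_iff)

context cring
begin

lemma word_mult_closed:
  assumes f: "f \<in> carrier (free_module R (lists X))" and g: "g \<in> carrier (free_module R (lists X))"
  shows "word_mult R f g \<in> carrier (free_module R (lists X))"
proof -
  have fc: "f u \<in> carrier R" and gc: "g u \<in> carrier R" for u
    using assms by (auto simp: free_module_carrier)
  have nz: "\<exists>i. f (take i w) \<noteq> \<zero> \<and> g (drop i w) \<noteq> \<zero>" if "word_mult R f g w \<noteq> \<zero>" for w
  proof (rule ccontr)
    assume "\<not> ?thesis"
    then have "f (take i w) \<otimes> g (drop i w) = \<zero>" for i
      using fc gc by (metis l_null r_null)
    then show False using that by (simp add: word_mult_def)
  qed
  have "w \<in> lists X" if "word_mult R f g w \<noteq> \<zero>" for w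
  proof -
    from nz[OF that] obtain i where "f (take i w) \<noteq> \<zero>" "g (drop i w) \<noteq> \<zero>" by blast
    then have "take i w \<in> lists X" "drop i w \<in> lists X" using f g by (auto simp: free_module_carrier)
    then have "take i w @ drop i w \<in> lists X" by (simp only: append_in_lists_conv)
    then show ?thesis by simp
  qed
  moreover have "finite {w. word_mult R f g w \<noteq> \<zero>}"
  proof (rule finite_subset)
    show "{w. word_mult R f g w \<noteq> \<zero>} \<subseteq> (\<lambda>(u, v). u @ v) ` ({u. f u \<noteq> \<zero>} \<times> {v. g v \<noteq> \<zero>})"
    proof
      fix w assume "w \<in> {w. word_mult R f g w \<noteq> \<zero>}"
      then obtain i where "f (take i w) \<noteq> \<zero>" "g (drop i w) \<noteq> \<zero>" using nz by blast
      then show "w \<in> (\<lambda>(u, v). u @ v) ` ({u. f u \<noteq> \<zero>} \<times> {v. g v \<noteq> \<zero>})"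
        by (intro image_eqI[of _ _ "(take i w, drop i w)"]) auto
    qed
    show "finite ((\<lambda>(u, v). u @ v) ` ({u. f u \<noteq> \<zero>} \<times> {v. g v \<noteq> \<zero>}))"
      using f g by (simp add: free_module_carrier)
  qed
  moreover have "word_mult R f g w \<in> carrier R" for w
    unfolding word_mult_def using fc gc by (intro finsum_closed) auto
  ultimately show ?thesis by (auto simp: free_module_carrier)
qed

lemma word_mult_hom_left:
  assumes g: "g \<in> carrier (free_module R (lists X))"
  shows "(\<lambda>f. word_mult R f g) \<in> module_hom R (free_module R (lists X)) (free_module R (lists X))"
proof (rule module_homI)
  fix f assume f: "f \<in> carrier (free_module R (lists X))"
  then show "word_mult R f g \<in> carrier (free_module R (lists X))" using g by (rule word_mult_closed)
  have fc: "f u \<in> carrier R" and gc: "g u \<in> carrier R" for u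
    using f g by (auto simp: free_module_carrier)
  show "word_mult R (r \<odot>\<^bsub>free_module R (lists X)\<^esub> f) g = r \<odot>\<^bsub>free_module R (lists X)\<^esub> word_mult R f g"
    if "r \<in> carrier R" for r
    using that fc gc by (simp add: word_mult_def fun_eq_iff finsum_rdistr m_assoc Pi_iff)
  fix f' assume f': "f' \<in> carrier (free_module R (lists X))"
  then have fc': "f' u \<in> carrier R" for u by (auto simp: free_module_carrier)
  show "word_mult R (f \<oplus>\<^bsub>free_module R (lists X)\<^esub> f') g =
      word_mult R f g \<oplus>\<^bsub>free_module R (lists X)\<^esub> word_mult R f' g"
  proof
    fix w
    have "word_mult R (f \<oplus>\<^bsub>free_module R (lists X)\<^esub> f') g w =
        (\<Oplus>i\<in>{..length w}. f (take i w) \<otimes> g (drop i w) \<oplus> f' (take i w) \<otimes> g (drop i w))"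
      unfolding word_mult_def using fc gc fc' by (intro finsum_cong') (auto simp: l_distr)
    also have "\<dots> = (word_mult R f g \<oplus>\<^bsub>free_module R (lists X)\<^esub> word_mult R f' g) w"
      unfolding word_mult_def free_module_simps using fc gc fc' by (intro finsum_addf) auto
    finally show "word_mult R (f \<oplus>\<^bsub>free_module R (lists X)\<^esub> f') g w =
        (word_mult R f g \<oplus>\<^bsub>free_module R (lists X)\<^esub> word_mult R f' g) w" .
  qed
qed

lemma word_mult_hom_right:
  assumes f: "f \<in> carrier (free_module R (lists X))"
  shows "word_mult R f \<in> module_hom R (free_module R (lists X)) (free_module R (lists X))"
proof (rule module_homI)
  fix g assume g: "g \<in> carrier (free_module R (lists X))"
  with f show "word_mult R f g \<in> carrier (free_module R (lists X))" by (rule word_mult_closed)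
  have fc: "f u \<in> carrier R" and gc: "g u \<in> carrier R" for u
    using f g by (auto simp: free_module_carrier)
  show "word_mult R f (r \<odot>\<^bsub>free_module R (lists X)\<^esub> g) = r \<odot>\<^bsub>free_module R (lists X)\<^esub> word_mult R f g"
    if "r \<in> carrier R" for r
    using that fc gc by (simp add: word_mult_def fun_eq_iff finsum_rdistr m_lcomm Pi_iff)
  fix g' assume g': "g' \<in> carrier (free_module R (lists X))"
  then have gc': "g' u \<in> carrier R" for u by (auto simp: free_module_carrier)
  show "word_mult R f (g \<oplus>\<^bsub>free_module R (lists X)\<^esub> g') =
      word_mult R f g \<oplus>\<^bsub>free_module R (lists X)\<^esub> word_mult R f g'"
  proof
    fix w
    have "word_mult R f (g \<oplus>\<^bsub>free_module R (lists X)\<^esub> g') w =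
        (\<Oplus>i\<in>{..length w}. f (take i w) \<otimes> g (drop i w) \<oplus> f (take i w) \<otimes> g' (drop i w))"
      unfolding word_mult_def using fc gc gc' by (intro finsum_cong') (auto simp: r_distr)
    also have "\<dots> = (word_mult R f g \<oplus>\<^bsub>free_module R (lists X)\<^esub> word_mult R f g') w"
      unfolding word_mult_def free_module_simps using fc gc gc' by (intro finsum_addf) auto
    finally show "word_mult R f (g \<oplus>\<^bsub>free_module R (lists X)\<^esub> g') w =
        (word_mult R f g \<oplus>\<^bsub>free_module R (lists X)\<^esub> word_mult R f g') w" .
  qed
qed

lemma word_mult_basis: "word_mult R (free_basis R u) (free_basis R v) = free_basis R (u @ v)"
proof
  fix w
  \<comment> \<open>A word splits into \<open>u\<close> and \<open>v\<close> at one position at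
    most, so at most one summand of the product survives.\<close>
  have eq: "take i w = u \<and> drop i w = v \<longleftrightarrow> w = u @ v \<and> i = length u" if "i \<le> length w" for i
    using that by (metis append_eq_conv_conj append_take_drop_id length_take min.absorb2)
  have "word_mult R (free_basis R u) (free_basis R v) w =
      (\<Oplus>i\<in>{..length w}. if length u = i then (if w = u @ v then \<one> else \<zero>) else \<zero>)"
    unfolding word_mult_def
    using eq by (intro finsum_cong') (auto simp: free_basis_def)
  also have "\<dots> = free_basis R (u @ v) w"
  proof (cases "w = u @ v")
    case True
    then show ?thesis
      using finsum_singleton[of "length u" "{..length w}" "\<lambda>_. \<one>"] by (simp add: free_basis_def)
  next
    case False
    then have "(\<lambda>i. if length u = i then (if w = u @ v then \<one> else \<zero>) else \<zero>) = (\<lambda>_. \<zero>)" by auto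
    then show ?thesis using False by (simp add: free_basis_def)
  qed
  finally show "word_mult R (free_basis R u) (free_basis R v) w = free_basis R (u @ v) w" .
qed

text \<open>Both sides are linear in each argument. Reducing the three arguments to words one after
  the other leaves the associativity of concatenation.\<close>

lemma word_mult_assoc:
  assumes f: "f \<in> carrier (free_module R (lists X))" and g: "g \<in> carrier (free_module R (lists X))"
    and h: "h \<in> carrier (free_module R (lists X))"
  shows "word_mult R (word_mult R f g) h = word_mult R f (word_mult R g h)"
proof -
  note L = word_mult_hom_left[where X = X] and Rt = word_mult_hom_right[where X = X]
  let ?b = "free_basis R"
  have bc: "?b u \<in> carrier (free_module R (lists X))" if "u \<in> lists X" for u
    using that by (rule free_basis_closed)
  have 1: "word_mult R (word_mult R (?b u) (?b v)) h = word_mult R (?b u) (word_mult R (?b v) h)"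
    if "u \<in> lists X" "v \<in> lists X" for u v
    using _ _ _ h
  proof (rule module_hom_free_eqI[OF module_free_module])
    show "word_mult R (word_mult R (?b u) (?b v)) \<in> module_hom R (free_module R (lists X)) (free_module R (lists X))"
      by (intro Rt word_mult_closed bc that)
    show "(\<lambda>h. word_mult R (?b u) (word_mult R (?b v) h)) \<in> module_hom R (free_module R (lists X)) (free_module R (lists X))"
      by (intro module_hom_comp[OF Rt Rt] bc that)
  qed (simp add: word_mult_basis)
  have 2: "word_mult R (word_mult R (?b u) g) h = word_mult R (?b u) (word_mult R g h)"
    if "u \<in> lists X" for u
    using _ _ _ g
  proof (rule module_hom_free_eqI[OF module_free_module])
    show "(\<lambda>g. word_mult R (word_mult R (?b u) g) h) \<in> module_hom R (free_module R (lists X)) (free_module R (lists X))"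
      by (intro module_hom_comp[OF Rt L] bc that h)
    show "(\<lambda>g. word_mult R (?b u) (word_mult R g h)) \<in> module_hom R (free_module R (lists X)) (free_module R (lists X))"
      by (intro module_hom_comp[OF L Rt] bc that h)
  qed (rule 1[OF that])
  show ?thesis
    using _ _ _ f
  proof (rule module_hom_free_eqI[OF module_free_module])
    show "(\<lambda>f. word_mult R (word_mult R f g) h) \<in> module_hom R (free_module R (lists X)) (free_module R (lists X))"
      by (intro module_hom_comp[OF L L] g h)
    show "(\<lambda>f. word_mult R f (word_mult R g h)) \<in> module_hom R (free_module R (lists X)) (free_module R (lists X))"
      by (intro L word_mult_closed g h)
  qed (rule 2)
qed

lemma word_mult_one:
  assumes f: "f \<in> carrier (free_module R (lists X))"
  shows "word_mult R (free_basis R []) f = f" "word_mult R f (free_basis R []) = f"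
proof -
  have id: "(\<lambda>f. f) \<in> module_hom R (free_module R (lists X)) (free_module R (lists X))"
    by (auto simp: module_hom_def)
  have 1: "free_basis R [] \<in> carrier (free_module R (lists X))"
    by (intro free_basis_closed) simp
  show "word_mult R (free_basis R []) f = f"
    using module_hom_free_eqI[OF module_free_module word_mult_hom_right[OF 1] id _ f]
    by (simp add: word_mult_basis)
  show "word_mult R f (free_basis R []) = f"
    using module_hom_free_eqI[OF module_free_module word_mult_hom_left[OF 1] id _ f]
    by (simp add: word_mult_basis)
qed

lemma assoc_algebra_free_algebra: "assoc_algebra R (free_algebra R X)"
proof -
  have m: "module R (free_algebra R X)"
    by (rule module_cong[OF module_free_module[of "lists X"]]) (simp_all add: free_algebra_simps)
  note homs = module_homD[OF word_mult_hom_left[of _ X]] module_homD[OF word_mult_hom_right[of _ X]]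
  have "ring (free_algebra R X)"
  proof (rule ringI)
    show "abelian_group (free_algebra R X)" using m by (rule module.axioms)
    show "Group.monoid (free_algebra R X)"
      by (rule monoidI)
        (auto simp: free_algebra_simps word_mult_assoc word_mult_one intro: word_mult_closed free_basis_closed)
  qed (simp_all add: free_algebra_simps homs del: free_module_simps)
  then show ?thesis
    using m by (intro assoc_algebra.intro assoc_algebra_axioms.intro)
      (simp_all add: free_algebra_simps homs del: free_module_simps)
qed

end

lemma quotient_algebra_simps:
  "carrier (quotient_algebra B I) = carrier (quotient_module B I)"
  "zero (quotient_algebra B I) = zero (quotient_module B I)"
  "add (quotient_algebra B I) = add (quotient_module B I)"
  "smult (quotient_algebra B I) = smult (quotient_module B I)"
  "monoid.mult (quotient_algebra B I) = rcoset_mult B I"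
  "one (quotient_algebra B I) = I +>\<^bsub>B\<^esub> \<one>\<^bsub>B\<^esub>"
  by (simp_all add: quotient_algebra_def FactRing_def)

context assoc_algebra
begin

lemma ideal_submodule:
  assumes "ideal I M"
  shows "submodule I R M"
proof -
  interpret I: ideal I M by fact
  show ?thesis
  proof (rule submoduleI)
    fix a x assume a: "a \<in> carrier R" and x: "x \<in> I"
    have "(a \<odot>\<^bsub>M\<^esub> \<one>\<^bsub>M\<^esub>) \<otimes>\<^bsub>M\<^esub> x \<in> I" using a x by (intro I.I_l_closed) auto
    then show "a \<odot>\<^bsub>M\<^esub> x \<in> I" using a x by (simp add: smult_mult_left)
  qed (auto simp: I.a_Hcarr)
qed

lemma quotient_algebra:
  assumes "ideal I M"
  shows "assoc_algebra R (quotient_algebra M I)"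
proof -
  interpret I: ideal I M by fact
  note sub = ideal_submodule[OF assms]
  have m: "module R (quotient_algebra M I)"
    by (rule module_cong[OF quotient_module[OF sub]]) (simp_all add: quotient_algebra_simps)
  note simps = quotient_algebra_simps quotient_module_simps[OF sub] I.rcoset_mult_add
  have "ring (quotient_algebra M I)"
  proof (rule ringI)
    show "abelian_group (quotient_algebra M I)" using m by (rule module.axioms)
    show "Group.monoid (quotient_algebra M I)"
      by (rule monoidI) (auto simp: simps m_assoc)
  qed (auto simp: simps l_distr r_distr)
  then show ?thesis
    using m by (intro assoc_algebra.intro assoc_algebra_axioms.intro)
      (auto simp: simps smult_mult_left smult_mult_right)
qed

end

definition word_val :: "('b, 'q) monoid_scheme \<Rightarrow> ('x \<Rightarrow> 'b) \<Rightarrow> 'x list \<Rightarrow> 'b"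
  where "word_val B t w = foldr (\<lambda>x u. t x \<otimes>\<^bsub>B\<^esub> u) w \<one>\<^bsub>B\<^esub>"

lemma word_val_simps [simp]:
  "word_val B t [] = \<one>\<^bsub>B\<^esub>" "word_val B t (x # w) = t x \<otimes>\<^bsub>B\<^esub> word_val B t w"
  by (simp_all add: word_val_def)

lemma (in Group.monoid) word_val_closed:
  "t \<in> X \<rightarrow> carrier G \<Longrightarrow> w \<in> lists X \<Longrightarrow> word_val G t w \<in> carrier G"
  by (induction w) auto

lemma (in Group.monoid) word_val_append:
  "t \<in> X \<rightarrow> carrier G \<Longrightarrow> u \<in> lists X \<Longrightarrow> v \<in> lists X \<Longrightarrow>
    word_val G t (u @ v) = word_val G t u \<otimes> word_val G t v"
proof (induction u)
  case Nil
  then show ?case using word_val_closed[of t X v] by simp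
next
  case (Cons x u)
  then have "t x \<in> carrier G" by auto
  with Cons show ?case
    using word_val_closed[of t X u] word_val_closed[of t X v] by (simp add: m_assoc)
qed

context assoc_algebra
begin

text \<open>Both sides are linear in \<open>f\<close> and in \<open>g\<close>; on words the claim is
  that evaluation turns concatenation into multiplication.\<close>

lemma lincomb_word_mult:
  assumes t: "t \<in> X \<rightarrow> carrier M"
    and f: "f \<in> carrier (free_module R (lists X))" and g: "g \<in> carrier (free_module R (lists X))"
  shows "lincomb R M (word_val M t) (word_mult R f g)
    = lincomb R M (word_val M t) f \<otimes>\<^bsub>M\<^esub> lincomb R M (word_val M t) g"
proof -
  let ?e = "lincomb R M (word_val M t)" and ?F = "free_module R (lists X)"
  have wc: "word_val M t \<in> lists X \<rightarrow> carrier M" using word_val_closed[OF t] by blast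
  note e = lincomb_hom(1)[OF wc] and eb = lincomb_hom(2)[OF wc]
  note ec = module_homD(1)[OF e]
  have L: "(\<lambda>y. x \<otimes>\<^bsub>M\<^esub> y) \<in> module_hom R M M" "(\<lambda>y. y \<otimes>\<^bsub>M\<^esub> x) \<in> module_hom R M M"
    if "x \<in> carrier M" for x
    using that by (auto intro!: module_homI simp: l_distr r_distr smult_mult_left smult_mult_right)
  have bc: "free_basis R u \<in> carrier ?F" if "u \<in> lists X" for u
    using that by (rule R.free_basis_closed)
  have 1: "?e (word_mult R (free_basis R u) g) = ?e (free_basis R u) \<otimes>\<^bsub>M\<^esub> ?e g" if "u \<in> lists X" for u
    using _ _ _ g
  proof (rule R.module_hom_free_eqI[OF module_self])
    show "(\<lambda>g. ?e (word_mult R (free_basis R u) g)) \<in> module_hom R ?F M"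
      by (intro module_hom_comp[OF R.word_mult_hom_right e] bc that)
    show "(\<lambda>g. ?e (free_basis R u) \<otimes>\<^bsub>M\<^esub> ?e g) \<in> module_hom R ?F M"
      by (intro module_hom_comp[OF e L(1)] ec bc that)
    show "?e (word_mult R (free_basis R u) (free_basis R v)) = ?e (free_basis R u) \<otimes>\<^bsub>M\<^esub> ?e (free_basis R v)"
      if v: "v \<in> lists X" for v
      using \<open>u \<in> lists X\<close> v by (simp add: R.word_mult_basis eb word_val_append[OF t])
  qed
  show ?thesis
    using _ _ _ f
  proof (rule R.module_hom_free_eqI[OF module_self])
    show "(\<lambda>f. ?e (word_mult R f g)) \<in> module_hom R ?F M"
      by (intro module_hom_comp[OF R.word_mult_hom_left e] g)
    show "(\<lambda>f. ?e f \<otimes>\<^bsub>M\<^esub> ?e g) \<in> module_hom R ?F M"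
      by (intro module_hom_comp[OF e L(2)] ec g)
  qed (rule 1)
qed

end

section \<open>Presented algebras and their universal property\<close>

locale presentation = cring R for R (structure) +
  fixes X :: "'x set" and rels :: "('x list \<Rightarrow> 'a) set"
  assumes rels: "rels \<subseteq> carrier (free_algebra R X)"
begin

abbreviation FA where "FA \<equiv> free_algebra R X"
abbreviation PA where "PA \<equiv> presented_algebra R X rels"
abbreviation var where "var \<equiv> presented_var R X rels"

sublocale FA: assoc_algebra R FA
  by (rule assoc_algebra_free_algebra)

definition rel_ideal where "rel_ideal = Idl\<^bsub>FA\<^esub> rels"

lemma rel_ideal: "ideal rel_ideal FA"
  unfolding rel_ideal_def using rels by (rule FA.genideal_ideal)

lemma presented_algebra_eq: "PA = quotient_algebra FA rel_ideal"
  by (simp add: presented_algebra_def rel_ideal_def)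

sublocale PA: assoc_algebra R PA
  unfolding presented_algebra_eq by (rule FA.quotient_algebra[OF rel_ideal])

definition cls where "cls z = rel_ideal +>\<^bsub>FA\<^esub> z"

lemma cls:
  "carrier PA = cls ` carrier FA" "\<one>\<^bsub>PA\<^esub> = cls \<one>\<^bsub>FA\<^esub>" "\<zero>\<^bsub>PA\<^esub> = cls \<zero>\<^bsub>FA\<^esub>"
  "z \<in> carrier FA \<Longrightarrow> cls z \<in> carrier PA"
  "z \<in> carrier FA \<Longrightarrow> z' \<in> carrier FA \<Longrightarrow> cls (z \<oplus>\<^bsub>FA\<^esub> z') = cls z \<oplus>\<^bsub>PA\<^esub> cls z'"
  "z \<in> carrier FA \<Longrightarrow> z' \<in> carrier FA \<Longrightarrow> cls (z \<otimes>\<^bsub>FA\<^esub> z') = cls z \<otimes>\<^bsub>PA\<^esub> cls z'"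
  "r \<in> carrier R \<Longrightarrow> z \<in> carrier FA \<Longrightarrow> cls (r \<odot>\<^bsub>FA\<^esub> z) = r \<odot>\<^bsub>PA\<^esub> cls z"
  using FA.quotient_module_simps[OF FA.ideal_submodule[OF rel_ideal]]
    ideal.rcoset_mult_add[OF rel_ideal] FA.coset_zero[OF FA.ideal_submodule[OF rel_ideal]]
  by (auto simp: presented_algebra_eq quotient_algebra_simps cls_def)

lemma cls_hom: "cls \<in> module_hom R FA PA"
  by (rule module_homI) (simp_all add: cls)

lemma cls_minus: "z \<in> carrier FA \<Longrightarrow> z' \<in> carrier FA \<Longrightarrow> cls (z \<ominus>\<^bsub>FA\<^esub> z') = cls z \<ominus>\<^bsub>PA\<^esub> cls z'"
  by (rule module_hom_minus[OF FA.module_self PA.module_self cls_hom])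

lemma cls_rel: "z \<in> rels \<Longrightarrow> cls z = \<zero>\<^bsub>PA\<^esub>"
  using FA.genideal_self[OF rels] FA.coset_eq_zero_iff[OF FA.ideal_submodule[OF rel_ideal], of z] rels
    FA.quotient_module_simps(2)[OF FA.ideal_submodule[OF rel_ideal]]
  by (auto simp: cls_def rel_ideal_def[symmetric] presented_algebra_eq quotient_algebra_simps)

lemma cls_eqI:
  assumes "u \<ominus>\<^bsub>FA\<^esub> v \<in> rels" "u \<in> carrier FA" "v \<in> carrier FA"
  shows "cls u = cls v"
  using cls_rel[OF assms(1)] assms(2,3) by (simp add: cls_minus cls(4) PA.minus_eq_zero_iff)

lemma free_var_closed: "x \<in> X \<Longrightarrow> free_var R x \<in> carrier FA"
  by (simp add: free_var_def free_algebra_simps free_basis_closed)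

lemma var_eq: "var x = cls (free_var R x)"
  by (simp add: presented_var_def cls_def rel_ideal_def)

lemma var_closed: "var \<in> X \<rightarrow> carrier PA"
  by (simp add: var_eq cls free_var_closed)

lemma basis_closed: "w \<in> lists X \<Longrightarrow> free_basis R w \<in> carrier FA"
  by (simp add: free_algebra_simps free_basis_closed)

lemma word_val_var: "w \<in> lists X \<Longrightarrow> word_val PA var w = cls (free_basis R w)"
proof (induction w)
  case Nil
  then show ?case by (simp add: cls(2)) (simp add: free_algebra_simps)
next
  case (Cons x w)
  then have x: "x \<in> X" and w: "w \<in> lists X" by auto
  have "word_val PA var (x # w) = cls (free_var R x \<otimes>\<^bsub>FA\<^esub> free_basis R w)"
    using w x by (simp add: Cons.IH var_eq[of x] cls(6) free_var_closed basis_closed)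
  also have "free_var R x \<otimes>\<^bsub>FA\<^esub> free_basis R w = free_basis R (x # w)"
    by (simp add: free_algebra_simps free_var_def word_mult_basis)
  finally show ?case .
qed

lemma PA_induct [consumes 1, case_names word add]:
  assumes "z \<in> carrier PA"
    "\<And>r w. r \<in> carrier R \<Longrightarrow> w \<in> lists X \<Longrightarrow> P (r \<odot>\<^bsub>PA\<^esub> word_val PA var w)"
    "\<And>y z. y \<in> carrier PA \<Longrightarrow> z \<in> carrier PA \<Longrightarrow> P y \<Longrightarrow> P z \<Longrightarrow> P (y \<oplus>\<^bsub>PA\<^esub> z)"
  shows "P z"
proof -
  obtain f where f: "f \<in> carrier FA" "z = cls f" using assms(1) cls(1) by auto
  have "f \<in> carrier (free_module R (lists X))" using f by (simp add: free_algebra_simps)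
  then have "P (cls f)"
  proof (induction f rule: free_module_induct)
    case zero
    have "P (\<zero> \<odot>\<^bsub>PA\<^esub> word_val PA var [])" by (rule assms(2)) auto
    then show ?case by (simp add: cls(3)) (simp add: free_algebra_simps)
  next
    case (basis r w)
    then show ?case
      using assms(2)[of r w] basis_closed[of w] cls(7)[of r "free_basis R w"]
      by (simp add: word_val_var free_algebra_simps)
  next
    case (add f g)
    then show ?case
      using assms(3)[of "cls f" "cls g"] cls(4)[of f] cls(4)[of g] cls(5)[of f g]
      by (simp add: free_algebra_simps)
  qed
  then show ?thesis using f by simp
qed

text \<open>An element that commutes with all generators is central. This applies first to the
  generators themselves, and then, since every element now commutes with the generators, to
  everything.\<close>

lemma PA_commute:
  assumes "\<And>x y. x \<in> X \<Longrightarrow> y \<in> X \<Longrightarrow> var x \<otimes>\<^bsub>PA\<^esub> var y = var y \<otimes>\<^bsub>PA\<^esub> var x"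
  shows "cring PA"
proof -
  have vc: "var x \<in> carrier PA" if "x \<in> X" for x using var_closed that by auto
  have wc: "word_val PA var w \<in> carrier PA" if "w \<in> lists X" for w
    using PA.word_val_closed[OF var_closed that] .
  have words: "word_val PA var w \<otimes>\<^bsub>PA\<^esub> z = z \<otimes>\<^bsub>PA\<^esub> word_val PA var w"
    if "z \<in> carrier PA" "w \<in> lists X" "\<And>x. x \<in> X \<Longrightarrow> var x \<otimes>\<^bsub>PA\<^esub> z = z \<otimes>\<^bsub>PA\<^esub> var x" for z w
    using that(2)
  proof (induction w)
    case Nil
    then show ?case using that(1) by simp
  next
    case (Cons x w)
    then have "x \<in> X" "w \<in> lists X" by auto
    then show ?case
      using Cons.IH that(1) vc wc by (simp add: PA.m_assoc) (simp add: PA.m_assoc[symmetric] that(3))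
  qed
  have all: "y \<otimes>\<^bsub>PA\<^esub> z = z \<otimes>\<^bsub>PA\<^esub> y"
    if "y \<in> carrier PA" "z \<in> carrier PA" "\<And>x. x \<in> X \<Longrightarrow> var x \<otimes>\<^bsub>PA\<^esub> z = z \<otimes>\<^bsub>PA\<^esub> var x" for y z
    using that(1)
  proof (induction y rule: PA_induct)
    case (word r w)
    then show ?case
      using words[of z w] that(2,3) wc by (simp add: PA.smult_mult_left PA.smult_mult_right)
  next
    case (add u v)
    then show ?case using that(2) by (simp add: PA.l_distr PA.r_distr)
  qed
  have "z \<otimes>\<^bsub>PA\<^esub> var x = var x \<otimes>\<^bsub>PA\<^esub> z" if "z \<in> carrier PA" "x \<in> X" for z x
    using all[OF that(1) vc[OF that(2)]] assms that(2) by metis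
  then have "y \<otimes>\<^bsub>PA\<^esub> z = z \<otimes>\<^bsub>PA\<^esub> y" if "y \<in> carrier PA" "z \<in> carrier PA" for y z
    using all[OF that] that(2) by metis
  then show ?thesis
    using PA.ring_self by (intro cring.intro comm_monoid.intro comm_monoid_axioms.intro)
      (auto simp: ring_def)
qed

text \<open>Evaluation on the free algebra kills the relations, and its kernel is a two-sided ideal,
  hence contains the ideal that they generate; so it descends to the quotient.\<close>

lemma PA_hom:
  assumes B: "assoc_algebra R B" and t: "t \<in> X \<rightarrow> carrier B"
    and zero: "\<And>z. z \<in> rels \<Longrightarrow> lincomb R B (word_val B t) z = \<zero>\<^bsub>B\<^esub>"
  obtains F where "F \<in> ring_hom PA B" "F \<in> module_hom R PA B" "\<And>x. x \<in> X \<Longrightarrow> F (var x) = t x"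
proof -
  interpret B: assoc_algebra R B by fact
  let ?e = "lincomb R B (word_val B t)"
  have wc: "word_val B t \<in> lists X \<rightarrow> carrier B" using B.word_val_closed[OF t] by blast
  have e: "?e \<in> module_hom R FA B"
    using B.lincomb_hom(1)[OF wc] by (auto simp: module_hom_def free_algebra_simps)
  have eb: "?e (free_basis R w) = word_val B t w" if "w \<in> lists X" for w
    using B.lincomb_hom(2)[OF wc that] .
  have em: "?e (f \<otimes>\<^bsub>FA\<^esub> g) = ?e f \<otimes>\<^bsub>B\<^esub> ?e g" if "f \<in> carrier FA" "g \<in> carrier FA" for f g
    using B.lincomb_word_mult[OF t] that by (simp add: free_algebra_simps)
  let ?K = "{z \<in> carrier FA. ?e z = \<zero>\<^bsub>B\<^esub>}"
  have "ideal ?K FA"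
  proof (rule idealI)
    show "ring FA" by (rule FA.ring_self)
    show "subgroup ?K (add_monoid FA)"
      using module_hom_kernel[OF FA.module_self B.module_self e] by (rule submodule.axioms)
    show "x \<otimes>\<^bsub>FA\<^esub> a \<in> ?K" "a \<otimes>\<^bsub>FA\<^esub> x \<in> ?K" if "a \<in> ?K" "x \<in> carrier FA" for a x
      using that module_homD(1)[OF e] by (auto simp: em)
  qed
  then have "rel_ideal \<subseteq> ?K"
    unfolding rel_ideal_def using rels zero by (intro FA.genideal_minimal) auto
  then obtain F where F: "F \<in> module_hom R (quotient_module FA rel_ideal) B"
      "\<And>z. z \<in> carrier FA \<Longrightarrow> F (rel_ideal +>\<^bsub>FA\<^esub> z) = ?e z"
    using FA.quotient_module_lift[OF FA.ideal_submodule[OF rel_ideal] e B.module_self] by blast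
  have Fc: "F (cls z) = ?e z" if "z \<in> carrier FA" for z
    using F(2)[OF that] by (simp add: cls_def)
  have 1: "F \<in> module_hom R PA B"
    using F(1) by (simp add: module_hom_def presented_algebra_eq quotient_algebra_simps)
  have 2: "F \<in> ring_hom PA B"
  proof (rule ring_hom_memI)
    show "F \<one>\<^bsub>PA\<^esub> = \<one>\<^bsub>B\<^esub>"
      using eb[of "[]"] Fc[of "\<one>\<^bsub>FA\<^esub>"] by (simp add: cls(2)) (simp add: free_algebra_simps)
    fix x y assume "x \<in> carrier PA" "y \<in> carrier PA"
    then obtain z z' where z: "z \<in> carrier FA" "z' \<in> carrier FA" "x = cls z" "y = cls z'"
      by (auto simp: cls(1))
    then show "F (x \<otimes>\<^bsub>PA\<^esub> y) = F x \<otimes>\<^bsub>B\<^esub> F y"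
      by (simp add: cls(6)[symmetric] Fc em)
    show "F (x \<oplus>\<^bsub>PA\<^esub> y) = F x \<oplus>\<^bsub>B\<^esub> F y"
      using module_homD(2)[OF 1] z by (simp add: cls(4))
  next
    show "F x \<in> carrier B" if "x \<in> carrier PA" for x using module_homD(1)[OF 1 that] .
  qed
  have "F (var x) = t x" if "x \<in> X" for x
  proof -
    have "t x \<in> carrier B" using t that by auto
    then show ?thesis
      using Fc[OF free_var_closed[OF that]] eb[of "[x]"] that by (simp add: var_eq free_var_def)
  qed
  then show ?thesis using that 1 2 by blast
qed

end

section \<open>Graded algebras of filtered algebras\<close>

text \<open>\<open>F_comm\<close> has two effects. It makes the graded algebra commutative and,
  applied to multiples of the unit in \<open>F 0\<close>, makes it an algebra over \<open>R\<close>
  although \<open>R\<close> need not act centrally on \<open>E\<close>.\<close>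

locale filtered_algebra = module R E + ring E for R (structure) and E (structure) +
  fixes F :: "nat \<Rightarrow> 'c set"
  assumes smult_mult_left:
      "\<lbrakk>a \<in> carrier R; x \<in> carrier E; y \<in> carrier E\<rbrakk> \<Longrightarrow> (a \<odot>\<^bsub>E\<^esub> x) \<otimes>\<^bsub>E\<^esub> y = a \<odot>\<^bsub>E\<^esub> (x \<otimes>\<^bsub>E\<^esub> y)"
    and F_submodule: "submodule (F n) R E"
    and F_mono: "F n \<subseteq> F (Suc n)"
    and F_one: "\<one>\<^bsub>E\<^esub> \<in> F 0"
    and F_mult: "x \<in> F i \<Longrightarrow> y \<in> F j \<Longrightarrow> x \<otimes>\<^bsub>E\<^esub> y \<in> F (i + j)"
    and F_comm: "x \<in> F i \<Longrightarrow> y \<in> F j \<Longrightarrow> x \<otimes>\<^bsub>E\<^esub> y \<ominus>\<^bsub>E\<^esub> y \<otimes>\<^bsub>E\<^esub> x \<in> filt_pred E F (i + j)"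
begin

abbreviation FP where "FP \<equiv> filt_pred E F"
abbreviation GR where "GR \<equiv> gr_algebra E F"

lemma module_E: "module R E"
  by (rule module_axioms)

lemma F_carrier: "x \<in> F n \<Longrightarrow> x \<in> carrier E"
  using submoduleE(1)[OF F_submodule] by blast

lemma FP_submodule: "submodule (FP n) R E"
proof (cases n)
  case 0
  have "\<ominus>\<^bsub>E\<^esub> \<zero>\<^bsub>E\<^esub> = \<zero>\<^bsub>E\<^esub>" by (rule M.minus_equality) auto
  then show ?thesis using 0 by (intro submoduleI) (auto simp: filt_pred_def)
qed (simp add: filt_pred_def F_submodule)

lemma FP_F: "FP n \<subseteq> F n"
  using F_mono submodule_zero[OF F_submodule] by (cases n) (auto simp: filt_pred_def)

lemma FP_mult:
  "x \<in> FP i \<Longrightarrow> y \<in> F j \<Longrightarrow> x \<otimes>\<^bsub>E\<^esub> y \<in> FP (i + j)"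
  "x \<in> F i \<Longrightarrow> y \<in> FP j \<Longrightarrow> x \<otimes>\<^bsub>E\<^esub> y \<in> FP (i + j)"
proof -
  show "x \<in> FP i \<Longrightarrow> y \<in> F j \<Longrightarrow> x \<otimes>\<^bsub>E\<^esub> y \<in> FP (i + j)"
  proof (cases i)
    case 0
    assume "x \<in> FP i" "y \<in> F j"
    then have "x \<otimes>\<^bsub>E\<^esub> y = \<zero>\<^bsub>E\<^esub>" using 0 F_carrier by (simp add: filt_pred_def)
    then show ?thesis using submodule_zero[OF FP_submodule] by simp
  next
    case (Suc k)
    assume "x \<in> FP i" "y \<in> F j"
    then show ?thesis using Suc F_mult[of x k y j] by (simp add: filt_pred_def)
  qed
  show "x \<in> F i \<Longrightarrow> y \<in> FP j \<Longrightarrow> x \<otimes>\<^bsub>E\<^esub> y \<in> FP (i + j)"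
  proof (cases j)
    case 0
    assume "x \<in> F i" "y \<in> FP j"
    then have "x \<otimes>\<^bsub>E\<^esub> y = \<zero>\<^bsub>E\<^esub>" using 0 F_carrier by (simp add: filt_pred_def)
    then show ?thesis using submodule_zero[OF FP_submodule] by simp
  next
    case (Suc k)
    assume "x \<in> F i" "y \<in> FP j"
    then show ?thesis using Suc F_mult[of x i y k] by (simp add: filt_pred_def)
  qed
qed

definition hcls :: "nat \<Rightarrow> 'c \<Rightarrow> 'c set" where "hcls n x = FP n +>\<^bsub>E\<^esub> x"

lemma hcls_eq_iff: "x \<in> F n \<Longrightarrow> y \<in> F n \<Longrightarrow> hcls n x = hcls n y \<longleftrightarrow> x \<ominus>\<^bsub>E\<^esub> y \<in> FP n"
  unfolding hcls_def by (intro coset_eq_iff FP_submodule F_carrier)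

lemma hcls_eq_zero_iff: "x \<in> F n \<Longrightarrow> hcls n x = FP n \<longleftrightarrow> x \<in> FP n"
  unfolding hcls_def by (intro coset_eq_zero_iff FP_submodule F_carrier)

abbreviation G where "G n \<equiv> gr_piece E F n"

lemma G_facts:
  "module R (G n)" "carrier (G n) = hcls n ` F n" "\<zero>\<^bsub>G n\<^esub> = FP n"
  "x \<in> F n \<Longrightarrow> y \<in> F n \<Longrightarrow> hcls n x \<oplus>\<^bsub>G n\<^esub> hcls n y = hcls n (x \<oplus>\<^bsub>E\<^esub> y)"
  "r \<in> carrier R \<Longrightarrow> x \<in> F n \<Longrightarrow> r \<odot>\<^bsub>G n\<^esub> hcls n x = hcls n (r \<odot>\<^bsub>E\<^esub> x)"
proof -
  let ?E = "E\<lparr>carrier := F n\<rparr>"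
  have E: "module R ?E" by (rule submodule.submodule_is_module[OF F_submodule module_E])
  have "module R (?E\<lparr>carrier := FP n\<rparr>)"
    using submodule.submodule_is_module[OF FP_submodule module_E, of n] by simp
  then have sub: "submodule (FP n) R ?E"
    using FP_F by (intro module.module_incl_imp_submodule[OF E]) auto
  have cos: "FP n +>\<^bsub>?E\<^esub> x = hcls n x" for x
    by (simp add: hcls_def a_r_coset_def r_coset_def)
  note q = module.quotient_module_simps[OF E sub]
  show "module R (G n)" unfolding gr_piece_def by (rule module.quotient_module[OF E sub])
  show "carrier (G n) = hcls n ` F n" "\<zero>\<^bsub>G n\<^esub> = FP n"
    "x \<in> F n \<Longrightarrow> y \<in> F n \<Longrightarrow> hcls n x \<oplus>\<^bsub>G n\<^esub> hcls n y = hcls n (x \<oplus>\<^bsub>E\<^esub> y)"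
    "r \<in> carrier R \<Longrightarrow> x \<in> F n \<Longrightarrow> r \<odot>\<^bsub>G n\<^esub> hcls n x = hcls n (r \<odot>\<^bsub>E\<^esub> x)"
    using q by (simp_all add: gr_piece_def cos)
qed

lemma F_closed:
  "x \<in> F n \<Longrightarrow> y \<in> F n \<Longrightarrow> x \<oplus>\<^bsub>E\<^esub> y \<in> F n" "r \<in> carrier R \<Longrightarrow> x \<in> F n \<Longrightarrow> r \<odot>\<^bsub>E\<^esub> x \<in> F n"
  "x \<in> F n \<Longrightarrow> \<ominus>\<^bsub>E\<^esub> x \<in> F n"
  using submoduleE[OF F_submodule] by blast+

definition gmul :: "nat \<Rightarrow> 'c set \<Rightarrow> 'c set \<Rightarrow> 'c set"
  where "gmul n = rcoset_mult E (FP n)"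

text \<open>\<open>rcoset_mult\<close> is a union over all pairs of representatives. Changing
  \<open>x\<close> by \<open>a\<close> and \<open>y\<close> by \<open>b\<close> changes the product
  by \<open>a y' + x b\<close>, which has lower filtration, so all pairs contribute the same
  coset.\<close>

lemma gmul_hcls:
  assumes x: "x \<in> F i" and y: "y \<in> F j" and n: "n = i + j"
  shows "gmul n (hcls i x) (hcls j y) = hcls n (x \<otimes>\<^bsub>E\<^esub> y)"
proof -
  interpret Pi: abelian_subgroup "FP i" E by (rule submodule_abelian_subgroup[OF FP_submodule])
  interpret Pj: abelian_subgroup "FP j" E by (rule submodule_abelian_subgroup[OF FP_submodule])
  have "FP n +>\<^bsub>E\<^esub> (x' \<otimes>\<^bsub>E\<^esub> y') = hcls n (x \<otimes>\<^bsub>E\<^esub> y)" if "x' \<in> hcls i x" "y' \<in> hcls j y" for x' y'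
  proof -
    obtain a where a: "a \<in> FP i" "x' = a \<oplus>\<^bsub>E\<^esub> x"
      using \<open>x' \<in> hcls i x\<close> by (auto simp: hcls_def a_r_coset_def r_coset_def)
    obtain b where b: "b \<in> FP j" "y' = b \<oplus>\<^bsub>E\<^esub> y"
      using \<open>y' \<in> hcls j y\<close> by (auto simp: hcls_def a_r_coset_def r_coset_def)
    have aF: "a \<in> F i" "b \<in> F j" using a b FP_F by blast+
    note c = F_carrier[OF x] F_carrier[OF y] F_carrier[OF aF(1)] F_carrier[OF aF(2)]
    have y': "y' \<in> F j" using b aF y by (auto intro: F_closed)
    have x': "x' \<in> F i" using a aF x by (auto intro: F_closed)
    have 1: "a \<otimes>\<^bsub>E\<^esub> y' \<in> FP n" "x \<otimes>\<^bsub>E\<^esub> b \<in> FP n"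
      using FP_mult a b x y' n by blast+
    have "x' \<otimes>\<^bsub>E\<^esub> y' = (a \<otimes>\<^bsub>E\<^esub> y' \<oplus>\<^bsub>E\<^esub> x \<otimes>\<^bsub>E\<^esub> b) \<oplus>\<^bsub>E\<^esub> x \<otimes>\<^bsub>E\<^esub> y"
      using a(2) b(2) c F_carrier[OF y'] by (simp add: l_distr r_distr M.a_ac)
    then have "x' \<otimes>\<^bsub>E\<^esub> y' \<ominus>\<^bsub>E\<^esub> x \<otimes>\<^bsub>E\<^esub> y = a \<otimes>\<^bsub>E\<^esub> y' \<oplus>\<^bsub>E\<^esub> x \<otimes>\<^bsub>E\<^esub> b"
      using c F_carrier[OF y'] by (simp add: a_minus_def M.a_assoc M.r_neg)
    also have "\<dots> \<in> FP n" using 1 submoduleE(5)[OF FP_submodule] by blast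
    finally show ?thesis
      using hcls_eq_iff[of "x' \<otimes>\<^bsub>E\<^esub> y'" n "x \<otimes>\<^bsub>E\<^esub> y"] F_mult x y x' y' n by (simp add: hcls_def)
  qed
  then have "gmul n (hcls i x) (hcls j y) = (\<Union>x'\<in>hcls i x. \<Union>y'\<in>hcls j y. hcls n (x \<otimes>\<^bsub>E\<^esub> y))"
    unfolding gmul_def rcoset_mult_def by (intro SUP_cong) auto
  moreover have "x \<in> hcls i x" "y \<in> hcls j y"
    unfolding hcls_def using x y F_carrier by (auto intro: Pi.a_rcos_self Pj.a_rcos_self)
  ultimately show ?thesis by auto
qed

lemma G_module: "module R (G n)"
  by (rule G_facts)

lemma G_closed:
  "a \<in> carrier (G n) \<Longrightarrow> b \<in> carrier (G n) \<Longrightarrow> a \<oplus>\<^bsub>G n\<^esub> b \<in> carrier (G n)"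
  "r \<in> carrier R \<Longrightarrow> a \<in> carrier (G n) \<Longrightarrow> r \<odot>\<^bsub>G n\<^esub> a \<in> carrier (G n)"
  "FP n \<in> carrier (G n)"
proof -
  interpret Gn: module R "G n" by (rule G_facts)
  show "a \<in> carrier (G n) \<Longrightarrow> b \<in> carrier (G n) \<Longrightarrow> a \<oplus>\<^bsub>G n\<^esub> b \<in> carrier (G n)"
    "r \<in> carrier R \<Longrightarrow> a \<in> carrier (G n) \<Longrightarrow> r \<odot>\<^bsub>G n\<^esub> a \<in> carrier (G n)"
    "FP n \<in> carrier (G n)"
    using Gn.M.zero_closed by (auto simp: G_facts(3))
qed

lemma gmul_left_hom:
  assumes "n = i + j" "b \<in> carrier (G j)"
  shows "(\<lambda>a. gmul n a b) \<in> module_hom R (G i) (G n)"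
proof -
  obtain y where y: "y \<in> F j" "b = hcls j y" using assms(2) by (auto simp: G_facts)
  show ?thesis
    using assms(1) y F_mult[of _ i y j] F_carrier
    by (intro module_homI)
      (auto simp: G_facts gmul_hcls F_closed l_distr smult_mult_left)
qed

text \<open>In \<open>E\<close> a scalar passes only the left factor. The failure on the right is
  the commutator of \<open>x\<close> with a multiple of the unit, which lies in lower filtration and
  disappears in the graded algebra.\<close>

lemma smult_mult_right:
  assumes "r \<in> carrier R" "x \<in> F i" "y \<in> F j"
  shows "hcls (i + j) (x \<otimes>\<^bsub>E\<^esub> (r \<odot>\<^bsub>E\<^esub> y)) = hcls (i + j) (r \<odot>\<^bsub>E\<^esub> (x \<otimes>\<^bsub>E\<^esub> y))"
proof -
  let ?s = "r \<odot>\<^bsub>E\<^esub> \<one>\<^bsub>E\<^esub>"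
  note c = F_carrier[OF assms(2)] F_carrier[OF assms(3)]
  have "x \<otimes>\<^bsub>E\<^esub> ?s \<ominus>\<^bsub>E\<^esub> ?s \<otimes>\<^bsub>E\<^esub> x \<in> FP (i + 0)"
    by (intro F_comm F_closed assms F_one)
  then have "(x \<otimes>\<^bsub>E\<^esub> ?s \<ominus>\<^bsub>E\<^esub> ?s \<otimes>\<^bsub>E\<^esub> x) \<otimes>\<^bsub>E\<^esub> y \<in> FP (i + j)"
    using FP_mult(1) assms(3) by simp
  also have "(x \<otimes>\<^bsub>E\<^esub> ?s \<ominus>\<^bsub>E\<^esub> ?s \<otimes>\<^bsub>E\<^esub> x) \<otimes>\<^bsub>E\<^esub> y = x \<otimes>\<^bsub>E\<^esub> (?s \<otimes>\<^bsub>E\<^esub> y) \<ominus>\<^bsub>E\<^esub> ?s \<otimes>\<^bsub>E\<^esub> (x \<otimes>\<^bsub>E\<^esub> y)"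
    using c assms(1) by (simp add: a_minus_def l_distr l_minus m_assoc)
  also have "\<dots> = x \<otimes>\<^bsub>E\<^esub> (r \<odot>\<^bsub>E\<^esub> y) \<ominus>\<^bsub>E\<^esub> r \<odot>\<^bsub>E\<^esub> (x \<otimes>\<^bsub>E\<^esub> y)"
    using c assms(1) by (simp add: smult_mult_left)
  finally show ?thesis
    using assms F_mult F_closed by (subst hcls_eq_iff) auto
qed

lemma gmul_right_hom:
  assumes "n = i + j" "a \<in> carrier (G i)"
  shows "gmul n a \<in> module_hom R (G j) (G n)"
proof -
  obtain x where x: "x \<in> F i" "a = hcls i x" using assms(2) by (auto simp: G_facts)
  show ?thesis
    using assms(1) x F_mult[of x i _ j] F_carrier
    by (intro module_homI)
      (auto simp: G_facts gmul_hcls F_closed r_distr smult_mult_right)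
qed

lemma GR_simps:
  "u \<in> carrier GR \<longleftrightarrow> (\<forall>n. u n \<in> carrier (G n)) \<and> finite {n. u n \<noteq> FP n}"
  "zero GR = FP" "add GR = (\<lambda>u v n. u n \<oplus>\<^bsub>G n\<^esub> v n)" "smult GR = (\<lambda>r u n. r \<odot>\<^bsub>G n\<^esub> u n)"
  "monoid.mult GR = (\<lambda>u v n. \<Oplus>\<^bsub>G n\<^esub>i\<in>{..n}. gmul n (u i) (v (n - i)))"
  "one GR = (\<lambda>n. if n = 0 then hcls 0 \<one>\<^bsub>E\<^esub> else FP n)"
  by (simp_all add: gr_algebra_def gmul_def hcls_def G_facts(3) fun_eq_iff)

lemma GR_module: "module R GR"
proof (rule moduleI)
  interpret G: module R "G n" for n by (rule G_facts)
  have zero: "a \<oplus>\<^bsub>G n\<^esub> FP n = a" "FP n \<oplus>\<^bsub>G n\<^esub> a = a" if "a \<in> carrier (G n)" for a n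
    using G.M.l_zero[OF that] G.M.r_zero[OF that] by (simp_all add: G_facts(3))
  show "abelian_group GR"
  proof (rule abelian_groupI)
    fix u v assume u: "u \<in> carrier GR" and v: "v \<in> carrier GR"
    have "finite ({n. u n \<noteq> FP n} \<union> {n. v n \<noteq> FP n})" using u v by (simp add: GR_simps)
    then have "finite {n. u n \<oplus>\<^bsub>G n\<^esub> v n \<noteq> FP n}"
      by (rule finite_subset[rotated]) (auto simp: zero G_closed)
    then show "u \<oplus>\<^bsub>GR\<^esub> v \<in> carrier GR" using u v by (simp add: GR_simps)
    show "u \<oplus>\<^bsub>GR\<^esub> v = v \<oplus>\<^bsub>GR\<^esub> u" using u v by (simp add: GR_simps fun_eq_iff G.M.a_comm)
    show "\<zero>\<^bsub>GR\<^esub> \<oplus>\<^bsub>GR\<^esub> u = u" using u by (simp add: GR_simps fun_eq_iff zero)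
    show "u \<oplus>\<^bsub>GR\<^esub> v \<oplus>\<^bsub>GR\<^esub> w = u \<oplus>\<^bsub>GR\<^esub> (v \<oplus>\<^bsub>GR\<^esub> w)" if "w \<in> carrier GR" for w
      using u v that by (simp add: GR_simps fun_eq_iff G.M.a_assoc)
    have "finite {n. \<ominus>\<^bsub>G n\<^esub> u n \<noteq> FP n}"
      using u G.M.minus_equality[OF G.M.l_zero[OF G.M.zero_closed] G.M.zero_closed G.M.zero_closed]
      by (auto simp: GR_simps G_facts(3) elim!: finite_subset[rotated])
    then show "\<exists>v\<in>carrier GR. v \<oplus>\<^bsub>GR\<^esub> u = \<zero>\<^bsub>GR\<^esub>"
      using u by (intro bexI[of _ "\<lambda>n. \<ominus>\<^bsub>G n\<^esub> u n"])
        (auto simp: GR_simps fun_eq_iff G.M.l_neg G_facts(3)[symmetric])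
  qed (simp add: GR_simps G_closed)
  show "cring R" by (rule R.is_cring)
  fix r u assume r: "r \<in> carrier R" and u: "u \<in> carrier GR"
  have "r \<odot>\<^bsub>G n\<^esub> FP n = FP n" for n using G.smult_r_null[OF r] by (simp add: G_facts(3))
  then show "r \<odot>\<^bsub>GR\<^esub> u \<in> carrier GR"
    using r u by (auto simp: GR_simps G_closed elim!: finite_subset[rotated])
qed (simp_all add: GR_simps fun_eq_iff module.smult_l_distr[OF G_module]
    module.smult_r_distr[OF G_module] module.smult_assoc1[OF G_module] module.smult_one[OF G_module])

section \<open>Homogeneous elements and the ring structure of the graded algebra\<close>

definition homog :: "nat \<Rightarrow> 'c \<Rightarrow> nat \<Rightarrow> 'c set"
  where "homog n x = (\<lambda>k. if k = n then hcls n x else FP k)"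

lemma homog_closed: "x \<in> F n \<Longrightarrow> homog n x \<in> carrier GR"
proof -
  assume "x \<in> F n"
  moreover have "finite {k. homog n x k \<noteq> FP k}"
    by (rule finite_subset[of _ "{n}"]) (auto simp: homog_def)
  ultimately show ?thesis by (simp add: GR_simps homog_def G_closed) (simp add: G_facts)
qed

lemma homog_hom: "homog n \<in> module_hom R (E\<lparr>carrier := F n\<rparr>) GR"
proof (rule module_homI)
  interpret G: module R "G n" for n by (rule G_facts)
  show "homog n (x \<oplus>\<^bsub>E\<lparr>carrier := F n\<rparr>\<^esub> y) = homog n x \<oplus>\<^bsub>GR\<^esub> homog n y"
    if "x \<in> carrier (E\<lparr>carrier := F n\<rparr>)" "y \<in> carrier (E\<lparr>carrier := F n\<rparr>)" for x y
    using that G.M.l_zero[OF G.M.zero_closed]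
    by (auto simp: homog_def GR_simps G_facts(3,4) fun_eq_iff)
  show "homog n (r \<odot>\<^bsub>E\<lparr>carrier := F n\<rparr>\<^esub> x) = r \<odot>\<^bsub>GR\<^esub> homog n x"
    if "r \<in> carrier R" "x \<in> carrier (E\<lparr>carrier := F n\<rparr>)" for r x
    using that G.smult_r_null by (auto simp: homog_def GR_simps G_facts(3,5) fun_eq_iff)
qed (simp add: homog_closed)

lemma GR_induct [consumes 1, case_names zero homog add]:
  assumes "u \<in> carrier GR" "P \<zero>\<^bsub>GR\<^esub>" "\<And>n x. x \<in> F n \<Longrightarrow> P (homog n x)"
    "\<And>u v. u \<in> carrier GR \<Longrightarrow> v \<in> carrier GR \<Longrightarrow> P u \<Longrightarrow> P v \<Longrightarrow> P (u \<oplus>\<^bsub>GR\<^esub> v)"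
  shows "P u"
proof -
  interpret G: module R "G n" for n by (rule G_facts)
  have "finite S \<Longrightarrow> u \<in> carrier GR \<Longrightarrow> {n. u n \<noteq> FP n} = S \<Longrightarrow> P u" for S u
  proof (induction S arbitrary: u rule: finite_induct)
    case empty
    then have "u = \<zero>\<^bsub>GR\<^esub>" by (auto simp: GR_simps)
    then show ?case using assms(2) by simp
  next
    case (insert n S)
    define v where "v k = (if k = n then FP k else u k)" for k
    have "u n \<in> carrier (G n)" using insert.prems by (auto simp: GR_simps)
    then obtain x where x: "x \<in> F n" "u n = hcls n x" by (auto simp: G_facts)
    have S: "{k. v k \<noteq> FP k} = S" using insert by (auto simp: v_def)
    have v: "v \<in> carrier GR" using insert.prems insert.hyps(1) S by (auto simp: GR_simps v_def G_closed)
    have "u = homog n x \<oplus>\<^bsub>GR\<^esub> v"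
    proof
      fix k
      have "u k \<in> carrier (G k)" using insert.prems by (auto simp: GR_simps)
      then show "u k = (homog n x \<oplus>\<^bsub>GR\<^esub> v) k"
        using x G.M.l_zero[of "u k" k] G.M.r_zero[of "u k" k]
        by (auto simp: GR_simps homog_def v_def G_facts(3))
    qed
    then show ?case
      using assms(4)[OF homog_closed[OF x(1)] v assms(3)[OF x(1)] insert.IH[OF v S]] by simp
  qed
  then show ?thesis using assms(1) by (auto simp: GR_simps)
qed

text \<open>Homogeneous elements play the part of a basis: commutativity, associativity and the unit
  law are linear in each argument and follow from the case of homogeneous factors.\<close>

lemma GR_hom_eqI:
  assumes "module R N" "f \<in> module_hom R GR N" "g \<in> module_hom R GR N"
    "\<And>n x. x \<in> F n \<Longrightarrow> f (homog n x) = g (homog n x)" "u \<in> carrier GR"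
  shows "f u = g u"
  using assms(5)
proof (induction u rule: GR_induct)
  case zero
  then show ?case
    using module_hom_zero[OF GR_module assms(1,2)] module_hom_zero[OF GR_module assms(1,3)] by simp
next
  case (add u v)
  then show ?case using module_homD(2)[OF assms(2)] module_homD(2)[OF assms(3)] by simp
qed (rule assms(4))

lemma gmul_closed: "u \<in> carrier GR \<Longrightarrow> v \<in> carrier GR \<Longrightarrow> i \<le> n \<Longrightarrow> gmul n (u i) (v (n - i)) \<in> carrier (G n)"
  using module_homD(1)[OF gmul_left_hom[of n i "n - i" "v (n - i)"]] by (simp add: GR_simps)

lemma gmul_zero:
  "a \<in> carrier (G i) \<Longrightarrow> i \<le> n \<Longrightarrow> gmul n a (FP (n - i)) = FP n"
  "b \<in> carrier (G (n - i)) \<Longrightarrow> i \<le> n \<Longrightarrow> gmul n (FP i) b = FP n"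
  using module_hom_zero[OF G_module G_module gmul_right_hom[of n i "n - i" a]]
    module_hom_zero[OF G_module G_module gmul_left_hom[of n i "n - i" b]]
  by (simp_all add: G_facts(3))

lemma GR_mult_closed:
  assumes u: "u \<in> carrier GR" and v: "v \<in> carrier GR"
  shows "u \<otimes>\<^bsub>GR\<^esub> v \<in> carrier GR"
proof -
  interpret G: module R "G n" for n by (rule G_facts)
  have uc: "u n \<in> carrier (G n)" and vc: "v n \<in> carrier (G n)" for n
    using u v by (auto simp: GR_simps)
  \<comment> \<open>Finite support: a nonzero component in degree \<open>n\<close> requires
    \<open>n = i + j\<close> with nonzero components \<open>u i\<close> and
    \<open>v j\<close>.\<close>
  have "(u \<otimes>\<^bsub>GR\<^esub> v) n = FP n" if "n \<notin> (\<lambda>(i, j). i + j) ` ({n. u n \<noteq> FP n} \<times> {n. v n \<noteq> FP n})" for n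
  proof -
    have "gmul n (u i) (v (n - i)) = \<zero>\<^bsub>G n\<^esub>" if i: "i \<in> {..n}" for i
    proof (cases "u i = FP i")
      case True
      then show ?thesis using gmul_zero(2)[of "v (n - i)" n i] vc i by (simp add: G_facts(3))
    next
      case False
      then have "v (n - i) = FP (n - i)"
        using i \<open>n \<notin> _\<close> by (force intro: image_eqI[of _ _ "(i, n - i)"])
      then show ?thesis using gmul_zero(1)[of "u i" i n] uc i by (simp add: G_facts(3))
    qed
    then have "(u \<otimes>\<^bsub>GR\<^esub> v) n = (\<Oplus>\<^bsub>G n\<^esub>i\<in>{..n}. \<zero>\<^bsub>G n\<^esub>)"
      unfolding GR_simps(5) by (intro G.M.finsum_cong') auto
    then show ?thesis by (simp add: G_facts(3)[symmetric])
  qed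
  then have "{n. (u \<otimes>\<^bsub>GR\<^esub> v) n \<noteq> FP n} \<subseteq> (\<lambda>(i, j). i + j) ` ({n. u n \<noteq> FP n} \<times> {n. v n \<noteq> FP n})"
    by blast
  then have "finite {n. (u \<otimes>\<^bsub>GR\<^esub> v) n \<noteq> FP n}"
    by (rule finite_subset) (use u v in \<open>simp add: GR_simps(1)\<close>)
  moreover have "(u \<otimes>\<^bsub>GR\<^esub> v) n \<in> carrier (G n)" for n
    unfolding GR_simps(5) by (intro G.M.finsum_closed) (auto intro: gmul_closed[OF u v])
  ultimately show ?thesis by (simp add: GR_simps(1))
qed

lemma GR_mult_hom_left:
  assumes v: "v \<in> carrier GR"
  shows "(\<lambda>u. u \<otimes>\<^bsub>GR\<^esub> v) \<in> module_hom R GR GR"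
proof (rule module_homI)
  interpret G: module R "G n" for n by (rule G_facts)
  interpret GR: module R GR by (rule GR_module)
  fix u assume u: "u \<in> carrier GR"
  show "u \<otimes>\<^bsub>GR\<^esub> v \<in> carrier GR" using u v by (rule GR_mult_closed)
  have hom: "(\<lambda>a. gmul n a (v (n - i))) \<in> module_hom R (G i) (G n)" if "i \<le> n" for i n
    using gmul_left_hom[of n i "n - i" "v (n - i)"] that v by (simp add: GR_simps)
  have c: "w n \<in> carrier (G n)" if "w \<in> carrier GR" for w n using that by (simp add: GR_simps)
  show "(r \<odot>\<^bsub>GR\<^esub> u) \<otimes>\<^bsub>GR\<^esub> v = r \<odot>\<^bsub>GR\<^esub> (u \<otimes>\<^bsub>GR\<^esub> v)" if r: "r \<in> carrier R" for r
  proof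
    fix n
    have "((r \<odot>\<^bsub>GR\<^esub> u) \<otimes>\<^bsub>GR\<^esub> v) n = (\<Oplus>\<^bsub>G n\<^esub>i\<in>{..n}. r \<odot>\<^bsub>G n\<^esub> gmul n (u i) (v (n - i)))"
      unfolding GR_simps(4,5) using module_homD(3)[OF hom r] c[OF u] gmul_closed[OF u v] r
      by (intro G.M.finsum_cong') auto
    also have "\<dots> = (r \<odot>\<^bsub>GR\<^esub> (u \<otimes>\<^bsub>GR\<^esub> v)) n"
      unfolding GR_simps(4,5) using gmul_closed[OF u v] r
      by (intro G.finsum_smult_ldistr[symmetric]) auto
    finally show "((r \<odot>\<^bsub>GR\<^esub> u) \<otimes>\<^bsub>GR\<^esub> v) n = (r \<odot>\<^bsub>GR\<^esub> (u \<otimes>\<^bsub>GR\<^esub> v)) n" .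
  qed
  fix u' assume u': "u' \<in> carrier GR"
  show "(u \<oplus>\<^bsub>GR\<^esub> u') \<otimes>\<^bsub>GR\<^esub> v = u \<otimes>\<^bsub>GR\<^esub> v \<oplus>\<^bsub>GR\<^esub> u' \<otimes>\<^bsub>GR\<^esub> v"
  proof
    fix n
    have "((u \<oplus>\<^bsub>GR\<^esub> u') \<otimes>\<^bsub>GR\<^esub> v) n =
        (\<Oplus>\<^bsub>G n\<^esub>i\<in>{..n}. gmul n (u i) (v (n - i)) \<oplus>\<^bsub>G n\<^esub> gmul n (u' i) (v (n - i)))"
      unfolding GR_simps(3,5)
      using module_homD(2)[OF hom] c[OF u] c[OF u'] gmul_closed[OF u v] gmul_closed[OF u' v]
      by (intro G.M.finsum_cong') auto
    also have "\<dots> = (u \<otimes>\<^bsub>GR\<^esub> v \<oplus>\<^bsub>GR\<^esub> u' \<otimes>\<^bsub>GR\<^esub> v) n"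
      unfolding GR_simps(3,5) using gmul_closed[OF u v] gmul_closed[OF u' v]
      by (intro G.M.finsum_addf) auto
    finally show "((u \<oplus>\<^bsub>GR\<^esub> u') \<otimes>\<^bsub>GR\<^esub> v) n = (u \<otimes>\<^bsub>GR\<^esub> v \<oplus>\<^bsub>GR\<^esub> u' \<otimes>\<^bsub>GR\<^esub> v) n" .
  qed
qed

lemma GR_mult_hom_right:
  assumes v: "v \<in> carrier GR"
  shows "(\<lambda>u. v \<otimes>\<^bsub>GR\<^esub> u) \<in> module_hom R GR GR"
proof (rule module_homI)
  interpret G: module R "G n" for n by (rule G_facts)
  interpret GR: module R GR by (rule GR_module)
  fix u assume u: "u \<in> carrier GR"
  show "v \<otimes>\<^bsub>GR\<^esub> u \<in> carrier GR" using v u by (rule GR_mult_closed)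
  have hom: "gmul n (v i) \<in> module_hom R (G (n - i)) (G n)" if "i \<le> n" for i n
    using gmul_right_hom[of n i "n - i" "v i"] that v by (simp add: GR_simps)
  have c: "w n \<in> carrier (G n)" if "w \<in> carrier GR" for w n using that by (simp add: GR_simps)
  show "v \<otimes>\<^bsub>GR\<^esub> (r \<odot>\<^bsub>GR\<^esub> u) = r \<odot>\<^bsub>GR\<^esub> (v \<otimes>\<^bsub>GR\<^esub> u)" if r: "r \<in> carrier R" for r
  proof
    fix n
    have "(v \<otimes>\<^bsub>GR\<^esub> (r \<odot>\<^bsub>GR\<^esub> u)) n = (\<Oplus>\<^bsub>G n\<^esub>i\<in>{..n}. r \<odot>\<^bsub>G n\<^esub> gmul n (v i) (u (n - i)))"
      unfolding GR_simps(4,5) using module_homD(3)[OF hom r] c[OF u] gmul_closed[OF v u] r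
      by (intro G.M.finsum_cong') auto
    also have "\<dots> = (r \<odot>\<^bsub>GR\<^esub> (v \<otimes>\<^bsub>GR\<^esub> u)) n"
      unfolding GR_simps(4,5) using gmul_closed[OF v u] r
      by (intro G.finsum_smult_ldistr[symmetric]) auto
    finally show "(v \<otimes>\<^bsub>GR\<^esub> (r \<odot>\<^bsub>GR\<^esub> u)) n = (r \<odot>\<^bsub>GR\<^esub> (v \<otimes>\<^bsub>GR\<^esub> u)) n" .
  qed
  fix u' assume u': "u' \<in> carrier GR"
  show "v \<otimes>\<^bsub>GR\<^esub> (u \<oplus>\<^bsub>GR\<^esub> u') = v \<otimes>\<^bsub>GR\<^esub> u \<oplus>\<^bsub>GR\<^esub> v \<otimes>\<^bsub>GR\<^esub> u'"
  proof
    fix n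
    have "(v \<otimes>\<^bsub>GR\<^esub> (u \<oplus>\<^bsub>GR\<^esub> u')) n =
        (\<Oplus>\<^bsub>G n\<^esub>i\<in>{..n}. gmul n (v i) (u (n - i)) \<oplus>\<^bsub>G n\<^esub> gmul n (v i) (u' (n - i)))"
      unfolding GR_simps(3,5)
      using module_homD(2)[OF hom] c[OF u] c[OF u'] gmul_closed[OF v u] gmul_closed[OF v u']
      by (intro G.M.finsum_cong') auto
    also have "\<dots> = (v \<otimes>\<^bsub>GR\<^esub> u \<oplus>\<^bsub>GR\<^esub> v \<otimes>\<^bsub>GR\<^esub> u') n"
      unfolding GR_simps(3,5) using gmul_closed[OF v u] gmul_closed[OF v u']
      by (intro G.M.finsum_addf) auto
    finally show "(v \<otimes>\<^bsub>GR\<^esub> (u \<oplus>\<^bsub>GR\<^esub> u')) n = (v \<otimes>\<^bsub>GR\<^esub> u \<oplus>\<^bsub>GR\<^esub> v \<otimes>\<^bsub>GR\<^esub> u') n" .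
  qed
qed

lemma homog_mult:
  assumes x: "x \<in> F i" and y: "y \<in> F j"
  shows "homog i x \<otimes>\<^bsub>GR\<^esub> homog j y = homog (i + j) (x \<otimes>\<^bsub>E\<^esub> y)"
proof
  fix n
  interpret Gn: module R "G n" by (rule G_facts)
  have xc: "homog i x k \<in> carrier (G k)" and yc: "homog j y k \<in> carrier (G k)" for k
    using homog_closed[OF x] homog_closed[OF y] by (auto simp: GR_simps)
  have xy: "x \<otimes>\<^bsub>E\<^esub> y \<in> F (i + j)" using F_mult x y by blast
  have "gmul n (homog i x k) (homog j y (n - k)) =
      (if i = k then homog (i + j) (x \<otimes>\<^bsub>E\<^esub> y) n else \<zero>\<^bsub>G n\<^esub>)" if "k \<in> {..n}" for k
  \<comment> \<open>If \<open>k = i\<close> but \<open>n - k\<close> differs from \<open>j\<close>,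
    then \<open>n\<close> differs from \<open>i + j\<close>, and both sides are zero.\<close>
  proof (cases "k = i \<and> n - k = j")
    case True
    then show ?thesis using that gmul_hcls[OF x y, of n] by (auto simp: homog_def)
  next
    case False
    then show ?thesis
      using that gmul_zero(1)[of "homog i x k" k n] gmul_zero(2)[of "homog j y (n - k)" n k] xc yc
      by (auto simp: homog_def G_facts(3))
  qed
  moreover have "homog (i + j) (x \<otimes>\<^bsub>E\<^esub> y) n \<in> carrier (G n)"
    using homog_closed[OF xy] by (auto simp: GR_simps)
  ultimately have "(homog i x \<otimes>\<^bsub>GR\<^esub> homog j y) n =
      (\<Oplus>\<^bsub>G n\<^esub>k\<in>{..n}. if i = k then homog (i + j) (x \<otimes>\<^bsub>E\<^esub> y) n else \<zero>\<^bsub>G n\<^esub>)"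
    unfolding GR_simps(5) by (intro Gn.M.finsum_cong') auto
  also have "\<dots> = homog (i + j) (x \<otimes>\<^bsub>E\<^esub> y) n"
  proof (cases "i \<le> n")
    case True
    then show ?thesis
      using Gn.M.finsum_singleton[of i "{..n}" "\<lambda>_. homog (i + j) (x \<otimes>\<^bsub>E\<^esub> y) n"]
        \<open>homog (i + j) (x \<otimes>\<^bsub>E\<^esub> y) n \<in> carrier (G n)\<close> by simp
  next
    case False
    then have "(\<Oplus>\<^bsub>G n\<^esub>k\<in>{..n}. if i = k then homog (i + j) (x \<otimes>\<^bsub>E\<^esub> y) n else \<zero>\<^bsub>G n\<^esub>)
        = (\<Oplus>\<^bsub>G n\<^esub>k\<in>{..n}. \<zero>\<^bsub>G n\<^esub>)"
      by (intro Gn.M.finsum_cong') auto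
    then show ?thesis using False by (simp add: homog_def G_facts(3)[symmetric])
  qed
  finally show "(homog i x \<otimes>\<^bsub>GR\<^esub> homog j y) n = homog (i + j) (x \<otimes>\<^bsub>E\<^esub> y) n" .
qed

lemma GR_m_comm:
  assumes u: "u \<in> carrier GR" and v: "v \<in> carrier GR"
  shows "u \<otimes>\<^bsub>GR\<^esub> v = v \<otimes>\<^bsub>GR\<^esub> u"
proof -
  have 1: "homog i x \<otimes>\<^bsub>GR\<^esub> homog j y = homog j y \<otimes>\<^bsub>GR\<^esub> homog i x" if "x \<in> F i" "y \<in> F j" for i j x y
  proof -
    have "hcls (i + j) (x \<otimes>\<^bsub>E\<^esub> y) = hcls (i + j) (y \<otimes>\<^bsub>E\<^esub> x)"
      using F_comm[OF that] F_mult[OF that] F_mult[OF that(2,1)]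
      by (subst hcls_eq_iff) (auto simp: add.commute)
    then have "homog (i + j) (x \<otimes>\<^bsub>E\<^esub> y) = homog (i + j) (y \<otimes>\<^bsub>E\<^esub> x)"
      by (simp add: homog_def fun_eq_iff)
    then show ?thesis using that by (simp add: homog_mult add.commute[of j i])
  qed
  have 2: "homog i x \<otimes>\<^bsub>GR\<^esub> v = v \<otimes>\<^bsub>GR\<^esub> homog i x" if "x \<in> F i" for i x
    using GR_hom_eqI[OF GR_module GR_mult_hom_right[OF homog_closed[OF that]]
        GR_mult_hom_left[OF homog_closed[OF that]] 1[OF that] v] .
  show ?thesis
    using GR_hom_eqI[OF GR_module GR_mult_hom_left[OF v] GR_mult_hom_right[OF v] 2 u] .
qed

lemma GR_m_assoc:
  assumes u: "u \<in> carrier GR" and v: "v \<in> carrier GR" and w: "w \<in> carrier GR"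
  shows "(u \<otimes>\<^bsub>GR\<^esub> v) \<otimes>\<^bsub>GR\<^esub> w = u \<otimes>\<^bsub>GR\<^esub> (v \<otimes>\<^bsub>GR\<^esub> w)"
proof -
  note L = GR_mult_hom_left and Rt = GR_mult_hom_right and c = homog_closed
  have 1: "(homog i x \<otimes>\<^bsub>GR\<^esub> homog j y) \<otimes>\<^bsub>GR\<^esub> homog k z = homog i x \<otimes>\<^bsub>GR\<^esub> (homog j y \<otimes>\<^bsub>GR\<^esub> homog k z)"
    if "x \<in> F i" "y \<in> F j" "z \<in> F k" for i j k x y z
    using that F_mult[OF that(1,2)] F_mult[OF that(2,3)] by (simp add: homog_mult F_carrier m_assoc add.assoc)
  have 2: "(homog i x \<otimes>\<^bsub>GR\<^esub> homog j y) \<otimes>\<^bsub>GR\<^esub> w = homog i x \<otimes>\<^bsub>GR\<^esub> (homog j y \<otimes>\<^bsub>GR\<^esub> w)"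
    if "x \<in> F i" "y \<in> F j" for i j x y
    using GR_hom_eqI[OF GR_module Rt[OF GR_mult_closed[OF c[OF that(1)] c[OF that(2)]]]
        module_hom_comp[OF Rt[OF c[OF that(2)]] Rt[OF c[OF that(1)]]] 1[OF that] w] .
  have 3: "(homog i x \<otimes>\<^bsub>GR\<^esub> v) \<otimes>\<^bsub>GR\<^esub> w = homog i x \<otimes>\<^bsub>GR\<^esub> (v \<otimes>\<^bsub>GR\<^esub> w)"
    if "x \<in> F i" for i x
    using GR_hom_eqI[OF GR_module module_hom_comp[OF Rt[OF c[OF that]] L[OF w]]
        module_hom_comp[OF L[OF w] Rt[OF c[OF that]]] 2[OF that] v] .
  show ?thesis
    using GR_hom_eqI[OF GR_module module_hom_comp[OF L[OF v] L[OF w]]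
        L[OF GR_mult_closed[OF v w]] 3 u] .
qed

lemma GR_one: "\<one>\<^bsub>GR\<^esub> = homog 0 \<one>\<^bsub>E\<^esub>"
  by (simp add: GR_simps homog_def fun_eq_iff)

lemma GR_algebra: "algebra R GR"
proof (rule algebraI)
  interpret GR: module R GR by (rule GR_module)
  show "cring R" by (rule R.is_cring)
  have one: "\<one>\<^bsub>GR\<^esub> \<in> carrier GR" by (simp add: GR_one homog_closed F_one)
  have id: "(\<lambda>u. u) \<in> module_hom R GR GR" by (auto simp: module_hom_def)
  have l_one: "\<one>\<^bsub>GR\<^esub> \<otimes>\<^bsub>GR\<^esub> u = u" if "u \<in> carrier GR" for u
    using GR_hom_eqI[OF GR_module GR_mult_hom_right[OF one] id _ that]
    by (simp add: GR_one homog_mult[OF F_one] F_carrier)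
  show "cring GR"
    by (rule cringI[OF GR.M.abelian_group_axioms comm_monoidI])
      (auto simp: GR_mult_closed one l_one GR_m_assoc
        intro: GR_m_comm module_homD(2)[OF GR_mult_hom_left])
  show "(a \<odot>\<^bsub>GR\<^esub> x) \<otimes>\<^bsub>GR\<^esub> y = a \<odot>\<^bsub>GR\<^esub> (x \<otimes>\<^bsub>GR\<^esub> y)"
    if "a \<in> carrier R" "x \<in> carrier GR" "y \<in> carrier GR" for a x y
    using module_homD(3)[OF GR_mult_hom_left[OF that(3)]] that by blast
qed (use module.smult_l_distr[OF GR_module] module.smult_r_distr[OF GR_module]
    module.smult_assoc1[OF GR_module] module.smult_one[OF GR_module] module.smult_closed[OF GR_module] in auto)

end

section \<open>The filtration of the enveloping algebra\<close>

definition (in ring) commutator :: "'a \<Rightarrow> 'a \<Rightarrow> 'a" where "commutator x y = x \<otimes> y \<ominus> y \<otimes> x"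

lemma (in ring) commutator_closed [simp]:
  "x \<in> carrier R \<Longrightarrow> y \<in> carrier R \<Longrightarrow> commutator x y \<in> carrier R"
  by (simp add: commutator_def)

lemma (in ring) commutator_mult_left:
  assumes "x \<in> carrier R" "y \<in> carrier R" "z \<in> carrier R"
  shows "commutator (x \<otimes> y) z = x \<otimes> commutator y z \<oplus> commutator x z \<otimes> y"
  unfolding commutator_def using assms by algebra

lemma (in ring) commutator_mult_right:
  assumes "x \<in> carrier R" "y \<in> carrier R" "z \<in> carrier R"
  shows "commutator z (x \<otimes> y) = x \<otimes> commutator z y \<oplus> commutator z x \<otimes> y"
  unfolding commutator_def using assms by algebra

lemma (in ring) commutator_add_left:
  assumes "x \<in> carrier R" "y \<in> carrier R" "z \<in> carrier R"
  shows "commutator (x \<oplus> y) z = commutator x z \<oplus> commutator y z"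
  unfolding commutator_def using assms by algebra

lemma (in ring) commutator_add_right:
  assumes "x \<in> carrier R" "y \<in> carrier R" "z \<in> carrier R"
  shows "commutator z (x \<oplus> y) = commutator z x \<oplus> commutator z y"
  unfolding commutator_def using assms by algebra

lemma (in ring) commutator_swap:
  assumes "x \<in> carrier R" "y \<in> carrier R"
  shows "commutator x y = \<ominus> commutator y x"
  unfolding commutator_def using assms by algebra

lemma (in ring) commutator_one: "x \<in> carrier R \<Longrightarrow> commutator \<one> x = \<zero>" "x \<in> carrier R \<Longrightarrow> commutator x \<one> = \<zero>"
  by (simp_all add: commutator_def a_minus_def r_neg)

context poisson_algebra
begin

lemmas A_simps = cring.cring_simprules[OF M_cring]
lemmas A_minus_closed = cring.cring_simprules(4)[OF M_cring]
lemmas A_m_closed = cring.cring_simprules(5)[OF M_cring]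
lemmas A_one_closed = cring.cring_simprules(6)[OF M_cring]
lemmas A_l_one = cring.cring_simprules(12)[OF M_cring]
lemmas A_m_comm = cring.cring_simprules(14)[OF M_cring]

abbreviation mF where "mF x \<equiv> free_var K (GenM x)"
abbreviation hF where "hF x \<equiv> free_var K (GenH x)"

lemma env_relations_closed: "env_relations K A bracket \<subseteq> carrier (free_algebra K (env_gens A))"
proof -
  interpret F: assoc_algebra K "free_algebra K (env_gens A)" by (rule K.assoc_algebra_free_algebra)
  have g: "mF x \<in> carrier (free_algebra K (env_gens A))" "hF x \<in> carrier (free_algebra K (env_gens A))"
    if "x \<in> carrier A" for x
    using that by (simp_all add: free_var_def free_algebra_simps K.free_basis_closed env_gens_def)
  show ?thesis
    unfolding env_relations_def Let_def
    by (auto simp: g bracket_closed)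
qed

sublocale PE: presentation K "env_gens A" "env_relations K A bracket"
  by (intro presentation.intro presentation_axioms.intro env_relations_closed) (rule K.is_cring)

abbreviation E where "E \<equiv> poisson_env K A bracket"
abbreviation EL where "EL \<equiv> poisson_env_left K A bracket"
abbreviation m where "m \<equiv> env_m K A bracket"
abbreviation h where "h \<equiv> env_h K A bracket"
abbreviation F where "F \<equiv> env_filtration K A bracket"

lemma E_eq: "E = PE.PA"
  by (simp add: poisson_env_def)

sublocale E: assoc_algebra K E
  unfolding E_eq by (rule PE.PA.assoc_algebra_axioms)

lemma mh_eq: "m x = PE.cls (mF x)" "h x = PE.cls (hF x)"
  by (simp_all add: env_m_def env_h_def PE.var_eq)

lemma mhF_closed: "x \<in> carrier A \<Longrightarrow> mF x \<in> carrier PE.FA" "x \<in> carrier A \<Longrightarrow> hF x \<in> carrier PE.FA"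
  using PE.free_var_closed[of "GenM x"] PE.free_var_closed[of "GenH x"]
  by (simp_all add: env_gens_def)

lemma mh_closed [simp]: "x \<in> carrier A \<Longrightarrow> m x \<in> carrier E" "x \<in> carrier A \<Longrightarrow> h x \<in> carrier E"
  unfolding mh_eq E_eq by (simp_all add: PE.cls mhF_closed)

lemma env_rules:
  assumes x: "x \<in> carrier A" and y: "y \<in> carrier A"
  shows "m (x \<oplus>\<^bsub>A\<^esub> y) = m x \<oplus>\<^bsub>E\<^esub> m y"
    "c \<in> carrier K \<Longrightarrow> m (c \<odot>\<^bsub>A\<^esub> x) = c \<odot>\<^bsub>E\<^esub> m x"
    "h (x \<oplus>\<^bsub>A\<^esub> y) = h x \<oplus>\<^bsub>E\<^esub> h y"
    "c \<in> carrier K \<Longrightarrow> h (c \<odot>\<^bsub>A\<^esub> x) = c \<odot>\<^bsub>E\<^esub> h x"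
    "m (x \<otimes>\<^bsub>A\<^esub> y) = m x \<otimes>\<^bsub>E\<^esub> m y"
    "h (bracket x y) = E.commutator (h x) (h y)"
    "h (x \<otimes>\<^bsub>A\<^esub> y) = (m y \<otimes>\<^bsub>E\<^esub> h x) \<oplus>\<^bsub>E\<^esub> (m x \<otimes>\<^bsub>E\<^esub> h y)"
    "m (bracket x y) = E.commutator (h x) (m y)"
proof -
  let ?R = "env_relations K A bracket"
  have r: "mF (x \<oplus>\<^bsub>A\<^esub> y) \<ominus>\<^bsub>PE.FA\<^esub> (mF x \<oplus>\<^bsub>PE.FA\<^esub> mF y) \<in> ?R"
    "c \<in> carrier K \<Longrightarrow> mF (c \<odot>\<^bsub>A\<^esub> x) \<ominus>\<^bsub>PE.FA\<^esub> (c \<odot>\<^bsub>PE.FA\<^esub> mF x) \<in> ?R"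
    "hF (x \<oplus>\<^bsub>A\<^esub> y) \<ominus>\<^bsub>PE.FA\<^esub> (hF x \<oplus>\<^bsub>PE.FA\<^esub> hF y) \<in> ?R"
    "c \<in> carrier K \<Longrightarrow> hF (c \<odot>\<^bsub>A\<^esub> x) \<ominus>\<^bsub>PE.FA\<^esub> (c \<odot>\<^bsub>PE.FA\<^esub> hF x) \<in> ?R"
    "mF (x \<otimes>\<^bsub>A\<^esub> y) \<ominus>\<^bsub>PE.FA\<^esub> (mF x \<otimes>\<^bsub>PE.FA\<^esub> mF y) \<in> ?R"
    "hF (bracket x y) \<ominus>\<^bsub>PE.FA\<^esub> ((hF x \<otimes>\<^bsub>PE.FA\<^esub> hF y) \<ominus>\<^bsub>PE.FA\<^esub> (hF y \<otimes>\<^bsub>PE.FA\<^esub> hF x)) \<in> ?R"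
    "hF (x \<otimes>\<^bsub>A\<^esub> y) \<ominus>\<^bsub>PE.FA\<^esub> ((mF y \<otimes>\<^bsub>PE.FA\<^esub> hF x) \<oplus>\<^bsub>PE.FA\<^esub> (mF x \<otimes>\<^bsub>PE.FA\<^esub> hF y)) \<in> ?R"
    "mF (bracket x y) \<ominus>\<^bsub>PE.FA\<^esub> ((hF x \<otimes>\<^bsub>PE.FA\<^esub> mF y) \<ominus>\<^bsub>PE.FA\<^esub> (mF y \<otimes>\<^bsub>PE.FA\<^esub> hF x)) \<in> ?R"
    unfolding env_relations_def Let_def using x y by blast+
  note * = r[THEN PE.cls_eqI]
  note simps = mhF_closed mh_eq E_eq PE.cls PE.cls_minus bracket_closed x y
  show "m (x \<oplus>\<^bsub>A\<^esub> y) = m x \<oplus>\<^bsub>E\<^esub> m y"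
    using *(1) by (simp add: simps)
  show "c \<in> carrier K \<Longrightarrow> m (c \<odot>\<^bsub>A\<^esub> x) = c \<odot>\<^bsub>E\<^esub> m x"
    using *(2) by (simp add: simps)
  show "h (x \<oplus>\<^bsub>A\<^esub> y) = h x \<oplus>\<^bsub>E\<^esub> h y"
    using *(3) by (simp add: simps)
  show "c \<in> carrier K \<Longrightarrow> h (c \<odot>\<^bsub>A\<^esub> x) = c \<odot>\<^bsub>E\<^esub> h x"
    using *(4) by (simp add: simps)
  show "m (x \<otimes>\<^bsub>A\<^esub> y) = m x \<otimes>\<^bsub>E\<^esub> m y"
    using *(5) by (simp add: simps)
  show "h (bracket x y) = E.commutator (h x) (h y)"
    unfolding E.commutator_def using *(6) by (simp add: simps)
  show "h (x \<otimes>\<^bsub>A\<^esub> y) = (m y \<otimes>\<^bsub>E\<^esub> h x) \<oplus>\<^bsub>E\<^esub> (m x \<otimes>\<^bsub>E\<^esub> h y)"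
    using *(7) by (simp add: simps)
  show "m (bracket x y) = E.commutator (h x) (m y)"
    unfolding E.commutator_def using *(8) by (simp add: simps)
qed

lemma m_one: "m \<one>\<^bsub>A\<^esub> = \<one>\<^bsub>E\<^esub>"
proof -
  have "mF \<one>\<^bsub>A\<^esub> \<ominus>\<^bsub>PE.FA\<^esub> \<one>\<^bsub>PE.FA\<^esub> \<in> env_relations K A bracket"
    unfolding env_relations_def Let_def by blast
  then have "PE.cls (mF \<one>\<^bsub>A\<^esub>) = PE.cls \<one>\<^bsub>PE.FA\<^esub>"
    by (rule PE.cls_eqI) (simp_all add: mhF_closed)
  then show ?thesis by (simp add: mh_eq E_eq PE.cls(2))
qed

lemma EL_simps:
  "carrier EL = carrier E" "monoid.mult EL = monoid.mult E" "one EL = one E" "zero EL = zero E"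
  "add EL = add E" "smult EL = (\<lambda>a u. m a \<otimes>\<^bsub>E\<^esub> u)"
  by (simp_all add: poisson_env_left_def Let_def)

lemma EL_minus: "x \<ominus>\<^bsub>EL\<^esub> y = x \<ominus>\<^bsub>E\<^esub> y"
  by (rule a_minus_cong) (simp_all add: EL_simps)

lemma EL_ring: "ring EL"
proof (rule ringI)
  show "abelian_group EL"
  proof (rule abelian_groupI)
    show "x \<oplus>\<^bsub>EL\<^esub> y = y \<oplus>\<^bsub>EL\<^esub> x" if "x \<in> carrier EL" "y \<in> carrier EL" for x y
      using that by (simp add: EL_simps E.M.a_comm)
    show "\<exists>y\<in>carrier EL. y \<oplus>\<^bsub>EL\<^esub> x = \<zero>\<^bsub>EL\<^esub>" if "x \<in> carrier EL" for x
      using that by (intro bexI[of _ "\<ominus>\<^bsub>E\<^esub> x"]) (simp_all add: EL_simps E.M.l_neg)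
  qed (simp_all add: EL_simps E.M.a_assoc)
  show "Group.monoid EL"
    by (rule monoidI) (auto simp: EL_simps E.m_assoc)
qed (auto simp: EL_simps E.l_distr E.r_distr)

lemma EL_module: "module A EL"
proof (rule moduleI)
  show "abelian_group EL" using EL_ring by (rule ring.axioms)
qed (auto simp: EL_simps env_rules m_one E.l_distr E.r_distr E.m_assoc M_cring)

sublocale EL: module A EL
  by (rule EL_module)

abbreviation hw where "hw \<equiv> word_val E h"

lemma h_fun: "h \<in> carrier A \<rightarrow> carrier E"
  by simp

lemma hw_closed [simp]: "w \<in> lists (carrier A) \<Longrightarrow> hw w \<in> carrier E"
  by (rule E.word_val_closed[OF h_fun])

lemma F_eq: "F n = generated_submodule A EL {hw w | w. w \<in> lists (carrier A) \<and> length w \<le> n}"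
  by (simp add: env_filtration_def word_val_def EL_simps Let_def)

lemma F_submodule: "submodule (F n) A EL"
  unfolding F_eq by (rule EL.generated_submodule) (auto simp: EL_simps intro!: hw_closed)

lemma F_subset: "u \<in> F n \<Longrightarrow> u \<in> carrier E"
  using EL.submoduleE(1)[OF F_submodule] by (auto simp: EL_simps)

lemma F_rules:
  "\<zero>\<^bsub>E\<^esub> \<in> F n" "u \<in> F n \<Longrightarrow> v \<in> F n \<Longrightarrow> u \<oplus>\<^bsub>E\<^esub> v \<in> F n" "u \<in> F n \<Longrightarrow> \<ominus>\<^bsub>E\<^esub> u \<in> F n"
  "a \<in> carrier A \<Longrightarrow> u \<in> F n \<Longrightarrow> m a \<otimes>\<^bsub>E\<^esub> u \<in> F n"
proof -
  have "a_inv EL = a_inv E" by (simp add: fun_eq_iff a_inv_def m_inv_def EL_simps)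
  then show "u \<in> F n \<Longrightarrow> \<ominus>\<^bsub>E\<^esub> u \<in> F n"
    using EL.submoduleE(3)[OF F_submodule] by metis
qed (use EL.submodule_zero[OF F_submodule] EL.submoduleE(4,5)[OF F_submodule] in \<open>auto simp: EL_simps\<close>)

lemma hw_F: "w \<in> lists (carrier A) \<Longrightarrow> length w \<le> n \<Longrightarrow> hw w \<in> F n"
  unfolding F_eq by (rule subsetD[OF EL.generated_submodule_subset]) blast

lemma F_induct [consumes 1, case_names word add]:
  assumes "u \<in> F n"
    and word: "\<And>a w. a \<in> carrier A \<Longrightarrow> w \<in> lists (carrier A) \<Longrightarrow> length w \<le> n \<Longrightarrow> P (m a \<otimes>\<^bsub>E\<^esub> hw w)"
    and add: "\<And>u v. u \<in> F n \<Longrightarrow> v \<in> F n \<Longrightarrow> P u \<Longrightarrow> P v \<Longrightarrow> P (u \<oplus>\<^bsub>E\<^esub> v)"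
  shows "P u"
proof -
  \<comment> \<open>Quantifying over all left multiples makes this set closed under the action of
    \<open>A\<close>; the unit of \<open>A\<close> recovers \<open>P u\<close> at the end.\<close>
  let ?N = "{u \<in> F n. \<forall>a\<in>carrier A. P (m a \<otimes>\<^bsub>E\<^esub> u)}"
  have zero: "P \<zero>\<^bsub>E\<^esub>"
    using word[of "\<zero>\<^bsub>A\<^esub>" "[]"] EL.smult_l_null[of "\<one>\<^bsub>E\<^esub>"] by (simp add: EL_simps)
  have "submodule ?N A EL"
  proof (rule EL.submoduleI)
    show "?N \<subseteq> carrier EL" using F_subset by (auto simp: EL_simps)
    show "\<zero>\<^bsub>EL\<^esub> \<in> ?N" using F_rules(1) zero by (auto simp: EL_simps)
    fix u assume u: "u \<in> ?N"
    then have uE: "u \<in> carrier EL" using F_subset by (auto simp: EL_simps)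
    have "m a \<otimes>\<^bsub>E\<^esub> (\<ominus>\<^bsub>EL\<^esub> u) = m (\<ominus>\<^bsub>A\<^esub> a) \<otimes>\<^bsub>E\<^esub> u" if "a \<in> carrier A" for a
      using EL.smult_r_minus[OF that uE] EL.smult_l_minus[OF that uE] by (simp add: EL_simps)
    then show "\<ominus>\<^bsub>EL\<^esub> u \<in> ?N" using u EL.submoduleE(3)[OF F_submodule] by auto
    show "u \<oplus>\<^bsub>EL\<^esub> v \<in> ?N" if "v \<in> ?N" for v
      using u that F_subset by (auto simp: EL_simps E.r_distr intro!: add F_rules)
    show "a \<odot>\<^bsub>EL\<^esub> u \<in> ?N" if "a \<in> carrier A" for a
      using u that F_subset by (auto simp: EL_simps E.m_assoc[symmetric] env_rules(5)[symmetric] intro!: F_rules)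
  qed
  moreover have "{hw w | w. w \<in> lists (carrier A) \<and> length w \<le> n} \<subseteq> ?N"
    using hw_F word by auto
  ultimately have "F n \<subseteq> ?N"
    unfolding F_eq[of n] by (intro EL.generated_submodule_minimal) (simp_all only: F_eq[of n])
  then have "P (m \<one>\<^bsub>A\<^esub> \<otimes>\<^bsub>E\<^esub> u)" using assms(1) A_one_closed by blast
  then show ?thesis using F_subset[OF assms(1)] by (simp add: m_one)
qed

lemma F_mono: "i \<le> j \<Longrightarrow> F i \<subseteq> F j"
proof -
  assume "i \<le> j"
  then show ?thesis
    unfolding F_eq[of i] by (intro EL.generated_submodule_minimal F_submodule) (auto intro!: hw_F)
qed

text \<open>Moving a scalar to the left past \<open>h y\<close> costs a term without
  \<open>h y\<close>. This is why a filtration by left multiples of words is stable under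
  multiplication by \<open>h y\<close> and, in consequence, multiplicative.\<close>

lemma h_m: "a \<in> carrier A \<Longrightarrow> y \<in> carrier A \<Longrightarrow> u \<in> carrier E \<Longrightarrow>
    h y \<otimes>\<^bsub>E\<^esub> (m a \<otimes>\<^bsub>E\<^esub> u) = m a \<otimes>\<^bsub>E\<^esub> (h y \<otimes>\<^bsub>E\<^esub> u) \<oplus>\<^bsub>E\<^esub> m (bracket y a) \<otimes>\<^bsub>E\<^esub> u"
proof -
  assume "a \<in> carrier A" "y \<in> carrier A" "u \<in> carrier E"
  then have "m a \<in> carrier E" "h y \<in> carrier E" "m (bracket y a) = E.commutator (h y) (m a)"
    by (auto simp: env_rules)
  then show ?thesis
    using \<open>u \<in> carrier E\<close> by (simp add: E.commutator_def a_minus_def E.l_distr E.l_minus E.m_assoc E.M.a_ac E.r_neg2 E.M.r_neg)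
qed

lemma h_F: "y \<in> carrier A \<Longrightarrow> u \<in> F n \<Longrightarrow> h y \<otimes>\<^bsub>E\<^esub> u \<in> F (Suc n)"
proof -
  assume y: "y \<in> carrier A" and u: "u \<in> F n"
  from u show ?thesis
  proof (induction u rule: F_induct)
    case (word a w)
    then have "hw (y # w) \<in> F (Suc n)" "hw w \<in> F (Suc n)" using y by (auto intro!: hw_F simp del: word_val_simps)
    then show ?case using word y by (auto simp: h_m bracket_closed intro!: F_rules)
  next
    case (add u v)
    then show ?case using y by (auto simp: E.r_distr F_subset intro!: F_rules)
  qed
qed

lemma hw_mult_F: "w \<in> lists (carrier A) \<Longrightarrow> v \<in> F j \<Longrightarrow> hw w \<otimes>\<^bsub>E\<^esub> v \<in> F (length w + j)"
proof (induction w)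
  case (Cons y w)
  then have "h y \<otimes>\<^bsub>E\<^esub> (hw w \<otimes>\<^bsub>E\<^esub> v) \<in> F (Suc (length w + j))" by (intro h_F) auto
  then show ?case using Cons.prems F_subset by (simp add: E.m_assoc)
qed (simp add: F_subset)

lemma F_mult: "u \<in> F i \<Longrightarrow> v \<in> F j \<Longrightarrow> u \<otimes>\<^bsub>E\<^esub> v \<in> F (i + j)"
proof (induction u rule: F_induct)
  case (word a w)
  then have "hw w \<otimes>\<^bsub>E\<^esub> v \<in> F (i + j)"
    using hw_mult_F[of w v j] F_mono[of "length w + j" "i + j"] by auto
  then show ?case using word F_subset[of v] by (simp add: E.m_assoc F_rules)
next
  case (add u u')
  then show ?case using F_subset by (simp add: E.l_distr F_rules)
qed

abbreviation FP where "FP \<equiv> filt_pred EL F"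

lemma FP_simps: "FP 0 = {\<zero>\<^bsub>E\<^esub>}" "FP (Suc n) = F n"
  by (simp_all add: filt_pred_def EL_simps)

lemma FP_F: "FP n \<subseteq> F n"
  using F_mono[of "n - 1" n] F_rules(1) by (cases n) (auto simp: FP_simps)

lemma FP_mono: "i \<le> j \<Longrightarrow> FP i \<subseteq> FP j"
  by (cases i; cases j) (auto simp: FP_simps F_rules(1) dest: F_mono)

lemma FP_rules:
  "\<zero>\<^bsub>E\<^esub> \<in> FP n" "u \<in> FP n \<Longrightarrow> v \<in> FP n \<Longrightarrow> u \<oplus>\<^bsub>E\<^esub> v \<in> FP n" "u \<in> FP n \<Longrightarrow> \<ominus>\<^bsub>E\<^esub> u \<in> FP n"
  "a \<in> carrier A \<Longrightarrow> u \<in> FP n \<Longrightarrow> m a \<otimes>\<^bsub>E\<^esub> u \<in> FP n"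
proof -
  have "\<ominus>\<^bsub>E\<^esub> \<zero>\<^bsub>E\<^esub> = \<zero>\<^bsub>E\<^esub>" by (rule E.M.minus_equality) auto
  then show "\<zero>\<^bsub>E\<^esub> \<in> FP n" "u \<in> FP n \<Longrightarrow> v \<in> FP n \<Longrightarrow> u \<oplus>\<^bsub>E\<^esub> v \<in> FP n"
    "u \<in> FP n \<Longrightarrow> \<ominus>\<^bsub>E\<^esub> u \<in> FP n" "a \<in> carrier A \<Longrightarrow> u \<in> FP n \<Longrightarrow> m a \<otimes>\<^bsub>E\<^esub> u \<in> FP n"
    by (cases n; auto simp: FP_simps F_rules)+
qed

lemma FP_subset: "u \<in> FP n \<Longrightarrow> u \<in> carrier E"
  using FP_F F_subset by blast

lemma h_FP: "y \<in> carrier A \<Longrightarrow> u \<in> FP n \<Longrightarrow> h y \<otimes>\<^bsub>E\<^esub> u \<in> F n"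
  by (cases n) (auto simp: FP_simps F_rules(1) h_F)

lemma FP_mult: "u \<in> FP i \<Longrightarrow> v \<in> F j \<Longrightarrow> u \<otimes>\<^bsub>E\<^esub> v \<in> FP (i + j)"
  using F_mult FP_rules(1) by (cases i) (auto simp: FP_simps F_subset)

text \<open>Each factor \<open>h y\<close> that \<open>m a\<close> passes is replaced by
  \<open>m (bracket y a)\<close>, so one factor is lost.\<close>

lemma hw_m: "a \<in> carrier A \<Longrightarrow> w \<in> lists (carrier A) \<Longrightarrow> E.commutator (hw w) (m a) \<in> FP (length w)"
proof (induction w)
  case (Cons y w)
  then have y: "y \<in> carrier A" "w \<in> lists (carrier A)" by auto
  have "h y \<otimes>\<^bsub>E\<^esub> E.commutator (hw w) (m a) \<in> F (length w)" using Cons y by (intro h_FP) auto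
  moreover have "m (bracket y a) \<otimes>\<^bsub>E\<^esub> hw w \<in> F (length w)"
    using Cons y by (intro F_rules hw_F bracket_closed) auto
  ultimately show ?case
    using Cons.prems y
    by (simp add: E.commutator_mult_left env_rules(8)[symmetric] FP_simps F_rules)
qed (simp add: E.commutator_one FP_simps)

lemma m_commutator: "a \<in> carrier A \<Longrightarrow> b \<in> carrier A \<Longrightarrow> E.commutator (m a) (m b) = \<zero>\<^bsub>E\<^esub>"
  by (simp add: E.commutator_def env_rules(5)[symmetric] A_m_comm[of a b] a_minus_def E.M.r_neg)

lemma F_m: "u \<in> F n \<Longrightarrow> a \<in> carrier A \<Longrightarrow> E.commutator u (m a) \<in> FP n"
proof (induction u rule: F_induct)
  case (word b w)
  then have "E.commutator (hw w) (m a) \<in> FP n" using hw_m FP_mono by blast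
  then show ?case using word by (simp add: E.commutator_mult_left m_commutator FP_rules FP_subset)
next
  case (add u v)
  then show ?case using F_subset by (simp add: E.commutator_add_left FP_rules)
qed

text \<open>Each factor \<open>h z\<close> that \<open>h y\<close> passes is replaced by
  \<open>h (bracket y z)\<close>. The number of factors of \<open>hw w\<close> is kept, which is one
  less than in the products themselves.\<close>

lemma h_hw: "y \<in> carrier A \<Longrightarrow> w \<in> lists (carrier A) \<Longrightarrow> E.commutator (h y) (hw w) \<in> F (length w)"
proof (induction w)
  case (Cons z w)
  then have z: "z \<in> carrier A" "w \<in> lists (carrier A)" by auto
  have "h z \<otimes>\<^bsub>E\<^esub> E.commutator (h y) (hw w) \<in> F (Suc (length w))" using Cons z by (intro h_F) auto
  moreover have "hw (bracket y z # w) \<in> F (Suc (length w))"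
    using Cons.prems z by (intro hw_F) (auto simp: bracket_closed)
  ultimately show ?case
    using Cons.prems z by (simp add: E.commutator_mult_right env_rules(6)[symmetric] F_rules)
qed (simp add: E.commutator_one F_rules)

lemma h_F_commutator: "u \<in> F n \<Longrightarrow> y \<in> carrier A \<Longrightarrow> E.commutator (h y) u \<in> F n"
proof (induction u rule: F_induct)
  case (word b w)
  then have "E.commutator (h y) (hw w) \<in> F n" using h_hw F_mono by blast
  moreover have "m (bracket y b) \<otimes>\<^bsub>E\<^esub> hw w \<in> F n"
    using word by (intro F_rules hw_F bracket_closed) auto
  ultimately show ?case
    using word by (simp add: E.commutator_mult_right env_rules(8)[symmetric] F_rules)
next
  case (add u v)
  then show ?case using F_subset by (simp add: E.commutator_add_right F_rules)
qed

lemma hw_F_commutator: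
  "w \<in> lists (carrier A) \<Longrightarrow> v \<in> F j \<Longrightarrow> E.commutator (hw w) v \<in> FP (length w + j)"
proof (induction w)
  case (Cons y w)
  then have y: "y \<in> carrier A" "w \<in> lists (carrier A)" by auto
  have "h y \<otimes>\<^bsub>E\<^esub> E.commutator (hw w) v \<in> F (length w + j)" using Cons y by (intro h_FP) auto
  moreover have "E.commutator (h y) v \<otimes>\<^bsub>E\<^esub> hw w \<in> F (j + length w)"
    using Cons y by (intro F_mult h_F_commutator hw_F) auto
  ultimately show ?case
    using Cons.prems y F_subset[of v]
    by (simp add: E.commutator_mult_left FP_simps F_rules add.commute)
qed (simp add: E.commutator_one FP_rules F_subset)

text \<open>This is the commutativity of the graded algebra. Taking the commutator with
  \<open>v\<close> is a derivation, so only scalars and words in \<open>h\<close> need treatment,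
  and there the defining relations lose one factor.\<close>

lemma F_commutator: "u \<in> F i \<Longrightarrow> v \<in> F j \<Longrightarrow> E.commutator u v \<in> FP (i + j)"
proof (induction u rule: F_induct)
  case (word a w)
  have vE: "v \<in> carrier E" using word F_subset by blast
  have le: "FP (length w + j) \<subseteq> FP (i + j)" using word by (intro FP_mono) auto
  have "E.commutator (m a) v \<in> FP j"
    using word F_m[of v j a] E.commutator_swap[of "m a" v] F_subset by (auto intro: FP_rules)
  then have "E.commutator (m a) v \<otimes>\<^bsub>E\<^esub> hw w \<in> FP (i + j)"
    using FP_mult[of _ j "hw w" "length w"] hw_F word le by (auto simp: add.commute)
  moreover have "m a \<otimes>\<^bsub>E\<^esub> E.commutator (hw w) v \<in> FP (i + j)"
    using hw_F_commutator word le by (intro FP_rules) auto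
  ultimately show ?case
    using word vE by (simp add: E.commutator_mult_left FP_rules)
next
  case (add u u')
  then show ?case using F_subset by (simp add: E.commutator_add_left FP_rules)
qed

lemma env_filtered: "filtered_algebra A EL F"
proof (intro filtered_algebra.intro filtered_algebra_axioms.intro)
  show "module A EL" by (rule EL_module)
  show "ring EL" by (rule EL_ring)
  show "F n \<subseteq> F (Suc n)" for n by (rule F_mono) simp
  show "\<one>\<^bsub>EL\<^esub> \<in> F 0" using hw_F[of "[]" 0] by (simp add: EL_simps)
  show "x \<otimes>\<^bsub>EL\<^esub> y \<ominus>\<^bsub>EL\<^esub> y \<otimes>\<^bsub>EL\<^esub> x \<in> FP (i + j)" if "x \<in> F i" "y \<in> F j" for x y i j
    using F_commutator[OF that] by (simp add: EL_minus EL_simps E.commutator_def)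
qed (auto simp: EL_simps E.m_assoc F_submodule F_mult)

end

section \<open>Kaehler differentials\<close>

lemma (in module) submoduleI':
  assumes "H \<subseteq> carrier M" "\<zero>\<^bsub>M\<^esub> \<in> H" "\<And>a b. a \<in> H \<Longrightarrow> b \<in> H \<Longrightarrow> a \<oplus>\<^bsub>M\<^esub> b \<in> H"
    "\<And>a x. a \<in> carrier R \<Longrightarrow> x \<in> H \<Longrightarrow> a \<odot>\<^bsub>M\<^esub> x \<in> H"
  shows "submodule H R M"
proof (rule submoduleI)
  fix x assume x: "x \<in> H"
  then have "\<ominus>\<^bsub>M\<^esub> x = (\<ominus> \<one>) \<odot>\<^bsub>M\<^esub> x"
    using assms(1) by (auto simp: smult_l_minus)
  then show "\<ominus>\<^bsub>M\<^esub> x \<in> H" using assms(4) x by simp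
qed (use assms in auto)

context poisson_algebra
begin

abbreviation FM where "FM \<equiv> free_module A (carrier A)"
abbreviation bas where "bas \<equiv> free_basis A"
abbreviation NN where "NN \<equiv> generated_submodule A FM (kaehler_relations K A)"
abbreviation Om where "Om \<equiv> kaehler K A"
abbreviation quo where "quo f \<equiv> NN +>\<^bsub>FM\<^esub> f"
definition dd where "dd x = quo (bas x)"

sublocale FM: module A FM
  by (rule cring.module_free_module[OF M_cring])

lemma bas_closed [simp]: "x \<in> carrier A \<Longrightarrow> bas x \<in> carrier FM"
  by (rule cring.free_basis_closed[OF M_cring])

lemma const_closed [simp]: "c \<in> carrier K \<Longrightarrow> c \<odot>\<^bsub>A\<^esub> \<one>\<^bsub>A\<^esub> \<in> carrier A"
  using A_one_closed by simp

lemma kaehler_relations_cases: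
  assumes "z \<in> kaehler_relations K A"
  obtains (add) x y where "x \<in> carrier A" "y \<in> carrier A"
      "z = bas (x \<oplus>\<^bsub>A\<^esub> y) \<ominus>\<^bsub>FM\<^esub> (bas x \<oplus>\<^bsub>FM\<^esub> bas y)"
    | (smult) c x where "c \<in> carrier K" "x \<in> carrier A"
      "z = bas (c \<odot>\<^bsub>A\<^esub> x) \<ominus>\<^bsub>FM\<^esub> ((c \<odot>\<^bsub>A\<^esub> \<one>\<^bsub>A\<^esub>) \<odot>\<^bsub>FM\<^esub> bas x)"
    | (mult) x y where "x \<in> carrier A" "y \<in> carrier A"
      "z = bas (x \<otimes>\<^bsub>A\<^esub> y) \<ominus>\<^bsub>FM\<^esub> ((x \<odot>\<^bsub>FM\<^esub> bas y) \<oplus>\<^bsub>FM\<^esub> (y \<odot>\<^bsub>FM\<^esub> bas x))"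
  using assms unfolding kaehler_relations_def Let_def by blast

lemma kaehler_relations_closed: "kaehler_relations K A \<subseteq> carrier FM"
proof
  fix z assume "z \<in> kaehler_relations K A"
  then show "z \<in> carrier FM"
    by (cases rule: kaehler_relations_cases) (simp_all del: free_module_simps)
qed

lemma NN_submodule: "submodule NN A FM"
  by (rule FM.generated_submodule[OF kaehler_relations_closed])

lemma NN_minimal: "submodule N A FM \<Longrightarrow> kaehler_relations K A \<subseteq> N \<Longrightarrow> NN \<subseteq> N"
  by (rule FM.generated_submodule_minimal)

lemma Om_eq: "Om = quotient_module FM NN"
  by (simp add: kaehler_def Let_def)

sublocale Om: module A Om
  unfolding Om_eq by (rule FM.quotient_module[OF NN_submodule])

lemma quo_hom: "(\<lambda>f. quo f) \<in> module_hom A FM Om"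
  unfolding Om_eq by (rule FM.quotient_module_hom[OF NN_submodule])

lemmas quo_rules = module_homD[OF quo_hom]

lemma Om_cases: "w \<in> carrier Om \<Longrightarrow> \<exists>f\<in>carrier FM. w = quo f"
  unfolding Om_eq FM.quotient_module_simps(1)[OF NN_submodule] by auto

lemma quo_eq_zero_iff: "f \<in> carrier FM \<Longrightarrow> quo f = \<zero>\<^bsub>Om\<^esub> \<longleftrightarrow> f \<in> NN"
  unfolding Om_eq FM.quotient_module_simps(2)[OF NN_submodule]
  by (rule FM.coset_eq_zero_iff[OF NN_submodule])

lemma dd_closed [simp]: "x \<in> carrier A \<Longrightarrow> dd x \<in> carrier Om"
  unfolding dd_def by (intro quo_rules bas_closed)

lemma quo_minus_eq:
  assumes "f \<ominus>\<^bsub>FM\<^esub> g \<in> kaehler_relations K A" "f \<in> carrier FM" "g \<in> carrier FM"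
  shows "quo f = quo g"
proof -
  have "f \<ominus>\<^bsub>FM\<^esub> g \<in> NN" using FM.generated_submodule_subset assms(1) by blast
  then show ?thesis using FM.coset_eq_iff[OF NN_submodule assms(2,3)] by blast
qed

lemma dd_rules:
  assumes x: "x \<in> carrier A" and y: "y \<in> carrier A"
  shows "dd (x \<oplus>\<^bsub>A\<^esub> y) = dd x \<oplus>\<^bsub>Om\<^esub> dd y"
    "c \<in> carrier K \<Longrightarrow> dd (c \<odot>\<^bsub>A\<^esub> x) = (c \<odot>\<^bsub>A\<^esub> \<one>\<^bsub>A\<^esub>) \<odot>\<^bsub>Om\<^esub> dd x"
    "dd (x \<otimes>\<^bsub>A\<^esub> y) = (x \<odot>\<^bsub>Om\<^esub> dd y) \<oplus>\<^bsub>Om\<^esub> (y \<odot>\<^bsub>Om\<^esub> dd x)"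
proof -
  let ?R = "kaehler_relations K A"
  have r: "bas (x \<oplus>\<^bsub>A\<^esub> y) \<ominus>\<^bsub>FM\<^esub> (bas x \<oplus>\<^bsub>FM\<^esub> bas y) \<in> ?R"
    "c \<in> carrier K \<Longrightarrow> bas (c \<odot>\<^bsub>A\<^esub> x) \<ominus>\<^bsub>FM\<^esub> ((c \<odot>\<^bsub>A\<^esub> \<one>\<^bsub>A\<^esub>) \<odot>\<^bsub>FM\<^esub> bas x) \<in> ?R"
    "bas (x \<otimes>\<^bsub>A\<^esub> y) \<ominus>\<^bsub>FM\<^esub> ((x \<odot>\<^bsub>FM\<^esub> bas y) \<oplus>\<^bsub>FM\<^esub> (y \<odot>\<^bsub>FM\<^esub> bas x)) \<in> ?R"
    unfolding kaehler_relations_def Let_def using x y by blast+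
  note * = r[THEN quo_minus_eq]
  show "dd (x \<oplus>\<^bsub>A\<^esub> y) = dd x \<oplus>\<^bsub>Om\<^esub> dd y"
    using *(1) x y by (simp add: dd_def quo_rules del: free_module_simps)
  show "c \<in> carrier K \<Longrightarrow> dd (c \<odot>\<^bsub>A\<^esub> x) = (c \<odot>\<^bsub>A\<^esub> \<one>\<^bsub>A\<^esub>) \<odot>\<^bsub>Om\<^esub> dd x"
    using *(2) x y by (simp add: dd_def quo_rules del: free_module_simps)
  show "dd (x \<otimes>\<^bsub>A\<^esub> y) = (x \<odot>\<^bsub>Om\<^esub> dd y) \<oplus>\<^bsub>Om\<^esub> (y \<odot>\<^bsub>Om\<^esub> dd x)"
    using *(3) x y by (simp add: dd_def quo_rules del: free_module_simps)
qed

lemma kaehler_lift: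
  assumes N: "module A N" and t: "\<And>x. x \<in> carrier A \<Longrightarrow> t x \<in> carrier N"
    and add: "\<And>x y. x \<in> carrier A \<Longrightarrow> y \<in> carrier A \<Longrightarrow> t (x \<oplus>\<^bsub>A\<^esub> y) = t x \<oplus>\<^bsub>N\<^esub> t y"
    and smult: "\<And>c x. c \<in> carrier K \<Longrightarrow> x \<in> carrier A \<Longrightarrow> t (c \<odot>\<^bsub>A\<^esub> x) = (c \<odot>\<^bsub>A\<^esub> \<one>\<^bsub>A\<^esub>) \<odot>\<^bsub>N\<^esub> t x"
    and mult: "\<And>x y. x \<in> carrier A \<Longrightarrow> y \<in> carrier A \<Longrightarrow>
      t (x \<otimes>\<^bsub>A\<^esub> y) = (x \<odot>\<^bsub>N\<^esub> t y) \<oplus>\<^bsub>N\<^esub> (y \<odot>\<^bsub>N\<^esub> t x)"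
  obtains H where "H \<in> module_hom A Om N" "\<And>x. x \<in> carrier A \<Longrightarrow> H (dd x) = t x"
proof -
  interpret N: module A N by fact
  have tf: "t \<in> carrier A \<rightarrow> carrier N" using t by blast
  let ?e = "lincomb A N t"
  note e = N.lincomb_hom(1)[OF tf] and eb = N.lincomb_hom(2)[OF tf]
  have "kaehler_relations K A \<subseteq> {z \<in> carrier FM. ?e z = \<zero>\<^bsub>N\<^esub>}"
  proof
    fix z assume z: "z \<in> kaehler_relations K A"
    then have "?e z = \<zero>\<^bsub>N\<^esub>"
      by (cases rule: kaehler_relations_cases)
        (simp_all add: module_hom_minus[OF FM.module_axioms N e] module_homD[OF e] eb t add smult mult
          N.M.minus_eq_zero_iff del: free_module_simps)
    then show "z \<in> {z \<in> carrier FM. ?e z = \<zero>\<^bsub>N\<^esub>}" using z kaehler_relations_closed by blast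
  qed
  then have "NN \<subseteq> {z \<in> carrier FM. ?e z = \<zero>\<^bsub>N\<^esub>}"
    by (intro NN_minimal module_hom_kernel FM.module_axioms N e)
  then obtain H where "H \<in> module_hom A (quotient_module FM NN) N" "\<And>f. f \<in> carrier FM \<Longrightarrow> H (quo f) = ?e f"
    using FM.quotient_module_lift[OF NN_submodule e N] by blast
  then show ?thesis using that[of H] by (simp add: Om_eq dd_def eb)
qed

section \<open>Identities for the Poisson bracket\<close>

lemma bracket_zero:
  assumes x: "x \<in> carrier A"
  shows "bracket x \<zero>\<^bsub>A\<^esub> = \<zero>\<^bsub>A\<^esub>" "bracket \<zero>\<^bsub>A\<^esub> x = \<zero>\<^bsub>A\<^esub>"
proof -
  have "\<zero>\<^bsub>K\<^esub> \<odot>\<^bsub>A\<^esub> \<zero>\<^bsub>A\<^esub> = \<zero>\<^bsub>A\<^esub>" by simp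
  then show "bracket x \<zero>\<^bsub>A\<^esub> = \<zero>\<^bsub>A\<^esub>" "bracket \<zero>\<^bsub>A\<^esub> x = \<zero>\<^bsub>A\<^esub>"
    using bracket_smult_right[of "\<zero>\<^bsub>K\<^esub>" x "\<zero>\<^bsub>A\<^esub>"] bracket_smult_left[of "\<zero>\<^bsub>K\<^esub>" "\<zero>\<^bsub>A\<^esub>" x] x
    by (simp_all add: bracket_closed)
qed

lemma bracket_anti:
  assumes x: "x \<in> carrier A" and y: "y \<in> carrier A"
  shows "bracket y x = \<ominus>\<^bsub>A\<^esub> bracket x y"
proof -
  have "bracket (x \<oplus>\<^bsub>A\<^esub> y) (x \<oplus>\<^bsub>A\<^esub> y) =
      (bracket x x \<oplus>\<^bsub>A\<^esub> bracket y x) \<oplus>\<^bsub>A\<^esub> (bracket x y \<oplus>\<^bsub>A\<^esub> bracket y y)"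
    using x y bracket_add_left[of x y x] bracket_add_left[of x y y] bracket_add_right[of "x \<oplus>\<^bsub>A\<^esub> y" x y]
    by simp
  then have "bracket y x \<oplus>\<^bsub>A\<^esub> bracket x y = \<zero>\<^bsub>A\<^esub>"
    using x y by (simp add: bracket_alternating bracket_closed)
  then show ?thesis using x y bracket_closed by (metis M.minus_equality)
qed

lemma bracket_one: "x \<in> carrier A \<Longrightarrow> bracket x \<one>\<^bsub>A\<^esub> = \<zero>\<^bsub>A\<^esub>"
proof -
  assume x: "x \<in> carrier A"
  let ?b = "bracket x \<one>\<^bsub>A\<^esub>"
  have b: "?b \<in> carrier A" using x A_one_closed by (simp add: bracket_closed)
  have "?b = ?b \<oplus>\<^bsub>A\<^esub> ?b"
    using bracket_leibniz[of x "\<one>\<^bsub>A\<^esub>" "\<one>\<^bsub>A\<^esub>"] x b A_one_closed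
    by (simp add: A_m_comm[of _ "\<one>\<^bsub>A\<^esub>"] A_l_one)
  then show ?thesis using b by (metis M.add.l_cancel_one')
qed

lemma bracket_const: "x \<in> carrier A \<Longrightarrow> c \<in> carrier K \<Longrightarrow> bracket x (c \<odot>\<^bsub>A\<^esub> \<one>\<^bsub>A\<^esub>) = \<zero>\<^bsub>A\<^esub>"
  using A_one_closed by (simp add: bracket_smult_right bracket_one)

lemma smult_const: "x \<in> carrier A \<Longrightarrow> c \<in> carrier K \<Longrightarrow> c \<odot>\<^bsub>A\<^esub> x = (c \<odot>\<^bsub>A\<^esub> \<one>\<^bsub>A\<^esub>) \<otimes>\<^bsub>A\<^esub> x"
  using A_one_closed A_l_one by (simp add: smult_assoc2)

lemma bracket_leibniz_left:
  assumes "x \<in> carrier A" "y \<in> carrier A" "z \<in> carrier A"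
  shows "bracket (x \<otimes>\<^bsub>A\<^esub> y) z = (x \<otimes>\<^bsub>A\<^esub> bracket y z) \<oplus>\<^bsub>A\<^esub> (y \<otimes>\<^bsub>A\<^esub> bracket x z)"
proof -
  have c: "x \<otimes>\<^bsub>A\<^esub> y \<in> carrier A" "bracket z x \<in> carrier A" "bracket z y \<in> carrier A"
    using assms A_m_closed by (auto simp: bracket_closed)
  have "bracket (x \<otimes>\<^bsub>A\<^esub> y) z = \<ominus>\<^bsub>A\<^esub> ((bracket z x \<otimes>\<^bsub>A\<^esub> y) \<oplus>\<^bsub>A\<^esub> (x \<otimes>\<^bsub>A\<^esub> bracket z y))"
    using assms c by (simp add: bracket_anti[of z "x \<otimes>\<^bsub>A\<^esub> y"] bracket_leibniz)
  also have "\<dots> = (x \<otimes>\<^bsub>A\<^esub> (\<ominus>\<^bsub>A\<^esub> bracket z y)) \<oplus>\<^bsub>A\<^esub> (y \<otimes>\<^bsub>A\<^esub> (\<ominus>\<^bsub>A\<^esub> bracket z x))"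
    using assms c by (simp add: A_simps)
  finally show ?thesis using assms by (simp add: bracket_anti[of z y] bracket_anti[of z x])
qed

lemma bracket_jacobi':
  assumes "x \<in> carrier A" "y \<in> carrier A" "z \<in> carrier A"
  shows "bracket (bracket x y) z = bracket x (bracket y z) \<ominus>\<^bsub>A\<^esub> bracket y (bracket x z)"
proof -
  have c: "bracket x (bracket y z) \<in> carrier A" "bracket y (bracket x z) \<in> carrier A"
    "bracket (bracket x y) z \<in> carrier A" "bracket x y \<in> carrier A" "bracket x z \<in> carrier A"
    using assms by (auto simp: bracket_closed)
  have "bracket y (bracket z x) = \<ominus>\<^bsub>A\<^esub> bracket y (bracket x z)"
  proof -
    have "bracket y (bracket z x) \<oplus>\<^bsub>A\<^esub> bracket y (bracket x z) = bracket y (bracket z x \<oplus>\<^bsub>A\<^esub> bracket x z)"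
      using assms by (simp add: bracket_add_right bracket_closed)
    also have "\<dots> = \<zero>\<^bsub>A\<^esub>"
      using assms c by (simp add: bracket_anti[of x z] bracket_zero A_simps)
    finally show ?thesis using assms c by (metis M.minus_equality bracket_closed)
  qed
  moreover have "bracket z (bracket x y) = \<ominus>\<^bsub>A\<^esub> bracket (bracket x y) z"
    using assms c by (simp add: bracket_anti[of "bracket x y" z])
  ultimately have *: "bracket x (bracket y z) \<oplus>\<^bsub>A\<^esub> \<ominus>\<^bsub>A\<^esub> bracket y (bracket x z)
      \<oplus>\<^bsub>A\<^esub> \<ominus>\<^bsub>A\<^esub> bracket (bracket x y) z = \<zero>\<^bsub>A\<^esub>"
    using bracket_jacobi[OF assms] by simp
  have "bracket x (bracket y z) \<ominus>\<^bsub>A\<^esub> bracket y (bracket x z) \<ominus>\<^bsub>A\<^esub> bracket (bracket x y) z = \<zero>\<^bsub>A\<^esub>"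
    using * by (simp add: a_minus_def)
  then show ?thesis using c by (simp add: M.minus_eq_zero_iff A_minus_closed)
qed

end

section \<open>The Lie-Rinehart algebra of differentials\<close>

locale projective_poisson = poisson_algebra K A bracket
  for K (structure) and A (structure) and bracket +
  assumes projective: "projective_module A (kaehler K A)"
begin

text \<open>The test modules \<open>N\<close> in \<open>projective_module\<close> consist of
  functions on the type of differentials, whereas \<open>FM\<close> consists of functions on the
  type of \<open>A\<close>. A free module on a relabelled basis bridges the two.\<close>

lemma ex_section: "\<exists>s\<in>module_hom A Om FM. \<forall>w\<in>carrier Om. quo (s w) = w"
proof -
  \<comment> \<open>Any injection into the type of differentials would do; its image indexes a free
    module of the type that \<open>projective_module\<close> quantifies over.\<close>
  define j :: "'c \<Rightarrow> ('c \<Rightarrow> 'c) set" where "j a = {\<lambda>_. a}" for a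
  have j: "inj j" by (auto simp: inj_def j_def fun_eq_iff)
  define X where "X = j ` carrier A"
  have jX: "j a \<in> X \<longleftrightarrow> a \<in> carrier A" for a using j by (auto simp: X_def inj_def)
  let ?N = "free_module A X" and ?g = "\<lambda>p. quo (\<lambda>a. p (j a))"
  have pj: "(\<lambda>a. p (j a)) \<in> carrier FM" if "p \<in> carrier ?N" for p
  proof -
    have "finite (j -` {w. p w \<noteq> \<zero>\<^bsub>A\<^esub>})"
      using that j by (intro finite_vimageI) (auto simp: free_module_carrier)
    then show ?thesis using that jX by (auto simp: free_module_carrier vimage_def)
  qed
  have "(\<lambda>p a. p (j a)) \<in> module_hom A ?N FM"
    by (rule module_homI) (auto simp: pj)
  then have g: "?g \<in> module_hom A ?N Om"
    by (rule module_hom_comp[OF _ quo_hom])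
  have surj: "?g ` carrier ?N = carrier Om"
  proof
    show "?g ` carrier ?N \<subseteq> carrier Om" using module_homD(1)[OF g] by blast
    show "carrier Om \<subseteq> ?g ` carrier ?N"
    proof
      fix w assume "w \<in> carrier Om"
      then obtain f where f: "f \<in> carrier FM" "w = quo f" using Om_cases by blast
      define p where "p v = (if v \<in> X then f (inv_into UNIV j v) else \<zero>\<^bsub>A\<^esub>)" for v
      have pf: "(\<lambda>a. p (j a)) = f"
        using f(1) jX j by (auto simp: p_def fun_eq_iff free_module_carrier)
      have "{v. p v \<noteq> \<zero>\<^bsub>A\<^esub>} \<subseteq> j ` {a. f a \<noteq> \<zero>\<^bsub>A\<^esub>}"
        using j by (auto simp: p_def X_def)
      then have "finite {v. p v \<noteq> \<zero>\<^bsub>A\<^esub>}"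
        using f(1) by (auto simp: free_module_carrier intro: finite_subset)
      then have "p \<in> carrier ?N"
        using f(1) M.zero_closed by (auto simp: free_module_carrier p_def)
      then show "w \<in> ?g ` carrier ?N" using f(2) pf by (intro image_eqI[of _ _ p]) auto
    qed
  qed
  have "(\<lambda>w. w) \<in> module_hom A Om Om" by (auto simp: module_hom_def)
  then have "\<exists>q\<in>module_hom A Om ?N. \<forall>w\<in>carrier Om. ?g (q w) = w"
    using projective[unfolded projective_module_def, THEN conjunct2, rule_format, of ?N Om ?g "\<lambda>w. w"]
      cring.module_free_module[OF M_cring, of X] Om.module_axioms g surj by simp
  then obtain q where q: "q \<in> module_hom A Om ?N" "\<And>w. w \<in> carrier Om \<Longrightarrow> ?g (q w) = w"
    by blast
  from q(1) have "(\<lambda>w a. q w (j a)) \<in> module_hom A Om FM"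
    using \<open>(\<lambda>p a. p (j a)) \<in> module_hom A ?N FM\<close> by (rule module_hom_comp)
  then show ?thesis using q(2) by (intro bexI[of _ "\<lambda>w a. q w (j a)"]) auto
qed

definition sec where "sec = (SOME s. s \<in> module_hom A Om FM \<and> (\<forall>w\<in>carrier Om. quo (s w) = w))"

lemma sec: "sec \<in> module_hom A Om FM" "w \<in> carrier Om \<Longrightarrow> quo (sec w) = w"
proof -
  have "\<exists>s. s \<in> module_hom A Om FM \<and> (\<forall>w\<in>carrier Om. quo (s w) = w)"
    using ex_section by (simp add: Bex_def)
  then have "sec \<in> module_hom A Om FM \<and> (\<forall>w\<in>carrier Om. quo (sec w) = w)"
    unfolding sec_def by (rule someI_ex)
  then show "sec \<in> module_hom A Om FM" "w \<in> carrier Om \<Longrightarrow> quo (sec w) = w"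
    by simp_all
qed

lemmas sec_rules = module_homD[OF sec(1)]

section \<open>Differentials in coordinates over the product ring\<close>

abbreviation ua :: "'c \<Rightarrow> 'c uring" where "ua \<equiv> emb A"
abbreviation co :: "'c uring \<Rightarrow> 'c" where "co \<equiv> component A"

lemmas ua_rules = cring.emb_add[OF M_cring] cring.emb_mult[OF M_cring] cring.emb_zero[OF M_cring]
  cring.emb_times[OF M_cring] cring.emb_minus[OF M_cring]
lemmas co_rules [simp] = cring.component_add[OF M_cring] cring.component_mult[OF M_cring]
  cring.component_zero[OF M_cring] cring.component_emb[OF M_cring] cring.component_closed[OF M_cring]

lemma ua_zero [simp]: "ua \<zero>\<^bsub>A\<^esub> = 0"
  by (rule ua_rules)

lemma ua_one_times: "a \<in> carrier A \<Longrightarrow> ua \<one>\<^bsub>A\<^esub> * ua a = ua a"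
  using A_one_closed A_l_one by (simp add: ua_rules(4))

lemma ua_uminus: "a \<in> carrier A \<Longrightarrow> ua (\<ominus>\<^bsub>A\<^esub> a) = - ua a"
  using ua_rules(1)[of "\<ominus>\<^bsub>A\<^esub> a" a] by (simp add: M.l_neg eq_neg_iff_add_eq_0)

definition hat :: "('c \<Rightarrow> 'c) \<Rightarrow> 'c \<Rightarrow>\<^sub>0 'c uring"
  where "hat f = Abs_poly_mapping (\<lambda>x. ua (f x))"

lemma lookup_hat: "f \<in> carrier FM \<Longrightarrow> Poly_Mapping.lookup (hat f) x = ua (f x)"
proof -
  assume f: "f \<in> carrier FM"
  have "{x. ua (f x) \<noteq> 0} \<subseteq> {x. f x \<noteq> \<zero>\<^bsub>A\<^esub>}" by auto
  then have "finite {x. ua (f x) \<noteq> 0}"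
    using f by (auto simp: free_module_carrier intro: finite_subset)
  then show ?thesis by (simp add: hat_def)
qed

lemma hat_rules:
  assumes f: "f \<in> carrier FM"
  shows "g \<in> carrier FM \<Longrightarrow> hat (f \<oplus>\<^bsub>FM\<^esub> g) = hat f + hat g"
    "r \<in> carrier A \<Longrightarrow> hat (r \<odot>\<^bsub>FM\<^esub> f) = scl (ua r) (hat f)"
    "scl q (hat f) = hat (co q \<odot>\<^bsub>FM\<^esub> f)"
proof -
  have fc: "f x \<in> carrier A" for x using f by (simp add: free_module_carrier)
  have smult: "r \<odot>\<^bsub>FM\<^esub> f \<in> carrier FM" if "r \<in> carrier A" for r
    by (rule FM.smult_closed[OF that f])
  show "hat (f \<oplus>\<^bsub>FM\<^esub> g) = hat f + hat g" if g: "g \<in> carrier FM"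
  proof (rule poly_mapping_eqI)
    have gc: "g x \<in> carrier A" for x using g by (simp add: free_module_carrier)
    show "Poly_Mapping.lookup (hat (f \<oplus>\<^bsub>FM\<^esub> g)) x = Poly_Mapping.lookup (hat f + hat g) x" for x
      using lookup_hat[OF FM.M.a_closed[OF f g]] fc gc by (simp add: lookup_hat f g lookup_add ua_rules(1))
  qed
  show "hat (r \<odot>\<^bsub>FM\<^esub> f) = scl (ua r) (hat f)" if r: "r \<in> carrier A"
    by (rule poly_mapping_eqI)
      (use lookup_hat[OF smult[OF r]] fc r in \<open>simp add: lookup_hat f ua_rules(4)\<close>)
  show "scl q (hat f) = hat (co q \<odot>\<^bsub>FM\<^esub> f)"
    by (rule poly_mapping_eqI)
      (use lookup_hat[OF smult[of "co q"]] fc in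
        \<open>simp add: lookup_hat f mult.commute[of q] ua_rules(4) A_m_comm\<close>)
qed

lemma hat_zero [simp]: "hat \<zero>\<^bsub>FM\<^esub> = 0"
  by (rule poly_mapping_eqI) (use lookup_hat[OF FM.M.zero_closed] in simp)

lemma hat_minus: "f \<in> carrier FM \<Longrightarrow> g \<in> carrier FM \<Longrightarrow> hat (f \<ominus>\<^bsub>FM\<^esub> g) = hat f - hat g"
  using hat_rules(1)[of "f \<ominus>\<^bsub>FM\<^esub> g" g] by (simp add: a_minus_def FM.M.a_assoc FM.M.l_neg del: free_module_simps)

lemma hat_bas: "x \<in> carrier A \<Longrightarrow> hat (bas x) = Poly_Mapping.single x (ua \<one>\<^bsub>A\<^esub>)"
  unfolding poly_mapping_eq_iff fun_eq_iff lookup_hat[OF bas_closed]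
  by (auto simp: free_basis_def lookup_single when_def)

lemma hat_inj: "f \<in> carrier FM \<Longrightarrow> hat f = 0 \<Longrightarrow> f = \<zero>\<^bsub>FM\<^esub>"
proof -
  assume f: "f \<in> carrier FM" and 0: "hat f = 0"
  have "f x = \<zero>\<^bsub>A\<^esub>" for x
  proof -
    have "co (ua (f x)) = \<zero>\<^bsub>A\<^esub>" using lookup_hat[OF f, of x] 0 by simp
    then show ?thesis using f by (simp add: free_module_carrier)
  qed
  then show ?thesis by auto
qed

text \<open>Embeds the differentials into the free module over \<open>uring\<close>. By
  \<open>lin_Dx_dn\<close> the image is the range of the projection \<open>lin Dx\<close>, that is,
  the module \<open>L\<close> of the projective case.\<close>

definition hs :: "('c \<Rightarrow> 'c) set \<Rightarrow> 'c \<Rightarrow>\<^sub>0 'c uring" where "hs w = hat (sec w)"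

lemma hs_rules:
  assumes w: "w \<in> carrier Om"
  shows "v \<in> carrier Om \<Longrightarrow> hs (w \<oplus>\<^bsub>Om\<^esub> v) = hs w + hs v"
    "r \<in> carrier A \<Longrightarrow> hs (r \<odot>\<^bsub>Om\<^esub> w) = scl (ua r) (hs w)" "scl q (hs w) = hs (co q \<odot>\<^bsub>Om\<^esub> w)"
proof -
  show "v \<in> carrier Om \<Longrightarrow> hs (w \<oplus>\<^bsub>Om\<^esub> v) = hs w + hs v"
    "r \<in> carrier A \<Longrightarrow> hs (r \<odot>\<^bsub>Om\<^esub> w) = scl (ua r) (hs w)"
    using w unfolding hs_def by (simp_all add: sec_rules hat_rules(1,2) del: free_module_simps)
  show "scl q (hs w) = hs (co q \<odot>\<^bsub>Om\<^esub> w)"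
    using w unfolding hs_def by (simp add: sec_rules hat_rules(3) del: free_module_simps)
qed

lemma hs_zero [simp]: "hs \<zero>\<^bsub>Om\<^esub> = 0"
  unfolding hs_def using module_hom_zero[OF Om.module_axioms FM.module_axioms sec(1)]
  by (simp del: free_module_simps)

lemma hs_inj: "w \<in> carrier Om \<Longrightarrow> hs w = 0 \<Longrightarrow> w = \<zero>\<^bsub>Om\<^esub>"
  using hat_inj[OF sec_rules(1)[of w]] sec(2)[of w] module_hom_zero[OF FM.module_axioms Om.module_axioms quo_hom]
  by (simp add: hs_def del: free_module_simps)

text \<open>In \<open>projective_lie_rinehart\<close> every element of the type is a basis index.
  Indices outside the carrier are made to contribute nothing: \<open>Dx\<close> and
  \<open>ancx\<close> vanish on them, and \<open>brx\<close> returns the zero of \<open>A\<close>,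
  which \<open>Dx\<close> kills.\<close>

definition Dx :: "'c \<Rightarrow> 'c \<Rightarrow>\<^sub>0 'c uring" where "Dx x = (if x \<in> carrier A then hs (dd x) else 0)"
definition ancx :: "'c \<Rightarrow> 'c uring \<Rightarrow> 'c uring"
  where "ancx x r = (if x \<in> carrier A then ua (bracket x (co r)) else 0)"
definition brx :: "'c \<Rightarrow> 'c \<Rightarrow> 'c"
  where "brx x y = (if x \<in> carrier A \<and> y \<in> carrier A then bracket x y else \<zero>\<^bsub>A\<^esub>)"

lemma Dx_rules:
  assumes x: "x \<in> carrier A" and y: "y \<in> carrier A"
  shows "Dx (x \<oplus>\<^bsub>A\<^esub> y) = Dx x + Dx y"
    "c \<in> carrier K \<Longrightarrow> Dx (c \<odot>\<^bsub>A\<^esub> x) = scl (ua (c \<odot>\<^bsub>A\<^esub> \<one>\<^bsub>A\<^esub>)) (Dx x)"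
    "Dx (x \<otimes>\<^bsub>A\<^esub> y) = scl (ua x) (Dx y) + scl (ua y) (Dx x)"
    "scl (ua \<one>\<^bsub>A\<^esub>) (Dx x) = Dx x"
  using x y A_m_closed A_one_closed hs_rules(2)[of "dd x" "\<one>\<^bsub>A\<^esub>", symmetric] by (simp_all add: Dx_def dd_rules hs_rules(1,2))

lemma Dx_zero [simp]: "Dx \<zero>\<^bsub>A\<^esub> = 0"
  using Dx_rules(1)[of "\<zero>\<^bsub>A\<^esub>" "\<zero>\<^bsub>A\<^esub>"] by simp

lemma Dx_uminus: "x \<in> carrier A \<Longrightarrow> Dx (\<ominus>\<^bsub>A\<^esub> x) = - Dx x"
  using Dx_rules(1)[of "\<ominus>\<^bsub>A\<^esub> x" x] by (simp add: M.l_neg eq_neg_iff_add_eq_0)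

text \<open>So \<open>lin Dx\<close> is, in coordinates, the canonical map to the differentials
  followed by the section. It is idempotent because \<open>quo\<close> after \<open>sec\<close> is
  the identity.\<close>

lemma lin_Dx_hat: "f \<in> carrier FM \<Longrightarrow> lin Dx (hat f) = hs (quo f)"
proof (induction f rule: cring.free_module_induct[OF M_cring, consumes 1, case_names zero basis add])
  case zero
  then show ?case
    using hat_zero module_hom_zero[OF FM.module_axioms Om.module_axioms quo_hom] hs_zero by simp
next
  case (basis r x)
  have "lin Dx (hat (r \<odot>\<^bsub>FM\<^esub> bas x)) = scl (ua r) (scl (ua \<one>\<^bsub>A\<^esub>) (Dx x))"
    using basis by (simp add: hat_rules(2) hat_bas lin_scl del: free_module_simps scl_simps)
  then show ?case
    using basis by (simp only: Dx_rules) (simp add: quo_rules hs_rules(2) Dx_def dd_def[symmetric] del: free_module_simps)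
next
  case (add f g)
  then show ?case by (simp add: hat_rules(1) lin_add quo_rules hs_rules(1) del: free_module_simps)
qed

definition dn :: "('c \<Rightarrow>\<^sub>0 'c uring) \<Rightarrow> 'c \<Rightarrow> 'c"
  where "dn k x = (if x \<in> carrier A then co (Poly_Mapping.lookup k x) else \<zero>\<^bsub>A\<^esub>)"

lemma dn_closed: "dn k \<in> carrier FM"
proof -
  have "{x. dn k x \<noteq> \<zero>\<^bsub>A\<^esub>} \<subseteq> Poly_Mapping.keys k"
    by (auto simp: dn_def in_keys_iff split: if_splits)
  then have "finite {x. dn k x \<noteq> \<zero>\<^bsub>A\<^esub>}" by (rule finite_subset) simp
  then show ?thesis by (auto simp: free_module_carrier dn_def)
qed

text \<open>Passing from \<open>k\<close> to \<open>hat (dn k)\<close> discards the indices outside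
  the carrier and, in the coefficients, all factors other than \<open>A\<close>. An additive
  extension that is blind to both takes the same value on the two.\<close>

lemma lext_hat_dn:
  assumes "\<And>x. t x 0 = 0" "\<And>x a b. t x (a + b) = t x a + t x b"
    "\<And>x r. x \<in> carrier A \<Longrightarrow> t x (ua (co r)) = t x r" "\<And>x r. x \<notin> carrier A \<Longrightarrow> t x r = 0"
  shows "lext t (hat (dn k)) = lext t k"
proof (induction k rule: poly_mapping_add_induct)
  case zero
  have "dn 0 = \<zero>\<^bsub>FM\<^esub>" by (auto simp: dn_def)
  then show ?case by (simp del: free_module_simps)
next
  case (single x r)
  show ?case
  proof (cases "x \<in> carrier A")
    case True
    have "hat (dn (Poly_Mapping.single x r)) = Poly_Mapping.single x (ua (co r))"
      by (rule poly_mapping_eqI) (use True in \<open>auto simp: lookup_hat[OF dn_closed] dn_def lookup_single when_def\<close>)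
    then show ?thesis using assms True by simp
  next
    case False
    have "hat (dn (Poly_Mapping.single x r)) = 0"
      by (rule poly_mapping_eqI) (use False in \<open>auto simp: lookup_hat[OF dn_closed] dn_def lookup_single when_def\<close>)
    then show ?thesis using assms False by simp
  qed
next
  case (add k k')
  have "dn (k + k') = dn k \<oplus>\<^bsub>FM\<^esub> dn k'"
    by (auto simp: dn_def lookup_add fun_eq_iff)
  then show ?case using add assms(1,2) by (simp add: hat_rules(1) dn_closed lext_add del: free_module_simps)
qed

lemma lin_Dx_dn: "lin Dx k = hs (quo (dn k))"
proof -
  have "lin Dx (hat (dn k)) = lin Dx k"
    unfolding lin_def
  proof (rule lext_hat_dn)
    show "scl (ua (co r)) (Dx x) = scl r (Dx x)" if "x \<in> carrier A" for x r
      using that by (simp add: Dx_def hs_rules(3))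
  qed (simp_all add: scl_distribs Dx_def)
  then show ?thesis by (simp add: lin_Dx_hat dn_closed)
qed

text \<open>The kernel conditions of \<open>projective_lie_rinehart\<close> concern arbitrary
  \<open>k\<close>. This turns them into statements about \<open>NN\<close>, which can be checked on
  the Kaehler relations.\<close>

lemma ker_dn: "lin Dx k = 0 \<Longrightarrow> dn k \<in> NN"
  using hs_inj[of "quo (dn k)"] quo_eq_zero_iff[OF dn_closed] quo_rules(1)[OF dn_closed]
  by (simp add: lin_Dx_dn)

section \<open>Anchor and bracket respect the Kaehler relations\<close>

lemma ancx_facts:
  "ancx x (r + s) = ancx x r + ancx x s" "ancx x (r * s) = ancx x r * s + r * ancx x s"
  "ancx x 0 = 0"
  "x \<in> carrier A \<Longrightarrow> ua \<one>\<^bsub>A\<^esub> * ancx x s = ancx x s"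
  "ua (co r) * ancx x s = r * ancx x s"
  "x \<in> carrier A \<Longrightarrow> ancx x (ua (co r)) = ancx x r"
  "x \<in> carrier A \<Longrightarrow> y \<in> carrier A \<Longrightarrow> ancx x (ua y) = ua (bracket x y)"
  "ancx x (ua \<one>\<^bsub>A\<^esub>) = 0" "c \<in> carrier K \<Longrightarrow> ancx x (ua (c \<odot>\<^bsub>A\<^esub> \<one>\<^bsub>A\<^esub>)) = 0"
  "x \<notin> carrier A \<Longrightarrow> ancx x r = 0"
  using A_one_closed
  by (auto simp: ancx_def bracket_add_right bracket_leibniz bracket_closed ua_rules(1,4) A_m_closed A_l_one
      bracket_zero bracket_one bracket_const mult.commute[of r] A_m_comm)

text \<open>The bracket with the fixed element \<open>co s\<close> is a derivation and so
  annihilates all three families of relations: letting \<open>dx\<close> act as the bracket with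
  \<open>x\<close> is a well-defined anchor.\<close>

lemma NN_ancx: "f \<in> NN \<Longrightarrow> lext (\<lambda>x r. r * ancx x s) (hat f) = 0"
proof -
  let ?t = "lext (\<lambda>x r. r * ancx x s) :: ('c \<Rightarrow>\<^sub>0 'c uring) \<Rightarrow> 'c uring"
  have add: "?t (k + k') = ?t k + ?t k'" for k k'
    by (intro lext_add) (auto simp: distrib_right)
  have scl: "?t (scl r k) = r * ?t k" for r k
    by (induction k rule: poly_mapping_add_induct) (simp_all add: scl_distribs add distrib_left mult.assoc)
  have minus: "?t (k - k') = ?t k - ?t k'" for k k'
    using add[of "k - k'" k'] by simp
  have bas: "?t (hat (bas x)) = ua (bracket x (co s))" if "x \<in> carrier A" for x
    using that ancx_facts(4)[of x s] by (simp add: hat_bas) (simp add: ancx_def)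
  have "submodule {f \<in> carrier FM. ?t (hat f) = 0} A FM"
    by (rule FM.submoduleI') (auto simp: hat_rules(1,2) add scl simp del: free_module_simps)
  moreover have "kaehler_relations K A \<subseteq> {f \<in> carrier FM. ?t (hat f) = 0}"
  proof
    fix z assume z: "z \<in> kaehler_relations K A"
    have co: "co s \<in> carrier A" by simp
    from z have "?t (hat z) = 0"
      using A_m_closed co
      by (cases rule: kaehler_relations_cases)
        (simp_all add: hat_minus hat_rules(1,2) minus add scl bas ua_rules(1,4)
          bracket_add_left bracket_smult_left bracket_leibniz_left bracket_closed smult_const[symmetric]
          del: free_module_simps)
    then show "z \<in> {f \<in> carrier FM. ?t (hat f) = 0}" using z kaehler_relations_closed by blast
  qed
  ultimately have "NN \<subseteq> {f \<in> carrier FM. ?t (hat f) = 0}" by (rule NN_minimal)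
  then show "f \<in> NN \<Longrightarrow> ?t (hat f) = 0" by blast
qed

text \<open>The expression is not linear in \<open>f\<close>: a scalar \<open>r\<close> adds a
  multiple of \<open>lin Dx (hat f)\<close>. The vanishing of that term is therefore carried along
  as a second condition in \<open>?Z\<close>, and this makes \<open>?Z\<close> a submodule.\<close>

lemma NN_lie: "f \<in> NN \<Longrightarrow> lext (\<lambda>x r. scl r (Dx (brx x c)) - scl (ancx c r) (Dx x)) (hat f) = 0"
proof (cases "c \<in> carrier A")
  case False
  then show ?thesis by (simp add: brx_def ancx_def lext_def)
next
  case c: True
  let ?t = "lext (\<lambda>x r. scl r (Dx (brx x c)) - scl (ancx c r) (Dx x))"
  have add: "?t (k + k') = ?t k + ?t k'" for k k'
    by (intro lext_add) (auto simp: scl_distribs ancx_facts)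
  have single: "?t (Poly_Mapping.single x r) = scl r (Dx (brx x c)) - scl (ancx c r) (Dx x)" for x r
    by (rule lext_single) (simp add: ancx_facts)
  have scl: "?t (scl r k) = scl r (?t k) - scl (ancx c r) (lin Dx k)" for r k
  proof (induction k rule: poly_mapping_add_induct)
    case (single x s)
    then show ?case
      using single
      by (simp add: \<open>\<And>x r. ?t (Poly_Mapping.single x r) = scl r (Dx (brx x c)) - scl (ancx c r) (Dx x)\<close>
          ancx_facts(2) scl_distribs algebra_simps)
  qed (simp_all add: scl_distribs add lin_add)
  have minus: "?t (k - k') = ?t k - ?t k'" for k k'
    using add[of "k - k'" k'] by simp
  have bas: "?t (hat (bas x)) = Dx (bracket x c)" "lin Dx (hat (bas x)) = Dx x" if "x \<in> carrier A" for x
    using that c by (simp_all add: hat_bas single ancx_facts brx_def Dx_rules bracket_closed)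
  let ?Z = "{f \<in> carrier FM. lin Dx (hat f) = 0 \<and> ?t (hat f) = 0}"
  have "submodule ?Z A FM"
    by (rule FM.submoduleI') (auto simp: hat_rules(1,2) add scl lin_add lin_scl simp del: free_module_simps)
  moreover have "kaehler_relations K A \<subseteq> ?Z"
  proof
    fix z assume z: "z \<in> kaehler_relations K A"
    then have zc: "z \<in> carrier FM" "z \<in> NN"
      using kaehler_relations_closed FM.generated_submodule_subset by blast+
    have 1: "lin Dx (hat z) = 0"
      using quo_eq_zero_iff[OF zc(1)] zc by (simp add: lin_Dx_hat)
    from z have "?t (hat z) = 0"
    proof (cases rule: kaehler_relations_cases)
      case (add x y)
      then show ?thesis
        using c by (simp add: hat_minus hat_rules(1,2) minus \<open>\<And>k k'. ?t (k + k') = ?t k + ?t k'\<close> bas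
            bracket_add_left bracket_closed Dx_rules del: free_module_simps)
    next
      case (smult k x)
      then show ?thesis
        using c by (simp add: hat_minus hat_rules(1,2) minus scl bas
            bracket_smult_left bracket_closed Dx_rules ancx_facts bracket_const del: free_module_simps)
    next
      case (mult x y)
      have "Dx (bracket (x \<otimes>\<^bsub>A\<^esub> y) c) = scl (ua x) (Dx (bracket y c)) + scl (ua (bracket y c)) (Dx x)
          + (scl (ua y) (Dx (bracket x c)) + scl (ua (bracket x c)) (Dx y))"
        using mult c A_m_closed by (simp add: bracket_leibniz_left bracket_closed Dx_rules)
      moreover have "ua (bracket c x) = - ua (bracket x c)" "ua (bracket c y) = - ua (bracket y c)"
        using mult c by (simp_all add: bracket_anti[of _ c] bracket_closed ua_uminus)
      ultimately show ?thesis
        using mult c A_m_closed by (simp add: hat_minus hat_rules(1,2) minus add scl bas ancx_facts(7) del: free_module_simps)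
    qed
    then show "z \<in> ?Z" using 1 zc by blast
  qed
  ultimately have "NN \<subseteq> ?Z" by (rule NN_minimal)
  then show "f \<in> NN \<Longrightarrow> ?t (hat f) = 0" by blast
qed

sublocale PL: projective_lie_rinehart ancx brx Dx
proof
  show "ancx x (r + s) = ancx x r + ancx x s" "ancx x (r * s) = ancx x r * s + r * ancx x s" for x r s
    by (rule ancx_facts)+
  show "lin Dx (Dx x) = Dx x" for x
    by (auto simp: Dx_def hs_def lin_Dx_hat sec_rules(1) sec(2))
  show "lext (\<lambda>x r. r * ancx x s) k = 0" if "lin Dx k = 0" for k s
    using NN_ancx[OF ker_dn[OF that], of s]
    by (subst (asm) lext_hat_dn) (auto simp: distrib_right ancx_facts)
  show "lext (\<lambda>x r. scl r (Dx (brx x c)) - scl (ancx c r) (Dx x)) k = 0" if "lin Dx k = 0" for k c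
  proof -
    have *: "scl (ua (co r)) (Dx x) = scl r (Dx x)" for r x
      by (auto simp: Dx_def hs_rules(3))
    have **: "ancx c (ua (co r)) = ancx c r" for r by (simp add: ancx_def)
    show ?thesis
      using NN_lie[OF ker_dn[OF that], of c]
      by (subst (asm) lext_hat_dn) (auto simp: scl_distribs ancx_facts(1,3) * ** brx_def, auto simp: Dx_def)
  qed
  show "Dx (brx x x) = 0" for x
    by (simp add: brx_def bracket_alternating)
  show "Dx (brx x y) = - Dx (brx y x)" for x y
    using Dx_uminus[of "bracket y x"] by (auto simp: brx_def bracket_anti[of y x] bracket_closed)
  show "Dx (brx x (brx y z)) + Dx (brx y (brx z x)) + Dx (brx z (brx x y)) = 0" for x y z
  proof (cases "x \<in> carrier A \<and> y \<in> carrier A \<and> z \<in> carrier A")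
    case True
    then show ?thesis
      using bracket_jacobi[of x y z] Dx_zero
      by (simp add: brx_def bracket_closed Dx_rules(1)[symmetric])
  qed (auto simp: brx_def bracket_zero)
  show "ancx (brx x y) r = ancx x (ancx y r) - ancx y (ancx x r)" for x y r
  proof (cases "x \<in> carrier A \<and> y \<in> carrier A")
    case True
    then show ?thesis
      by (simp add: ancx_def brx_def bracket_closed bracket_jacobi' ua_rules(5))
  qed (auto simp: ancx_def brx_def bracket_zero)
qed

end

section \<open>Action of the enveloping algebra on polynomials\<close>

context poisson_algebra
begin

lemma env_relations_cases:
  assumes "z \<in> env_relations K A bracket"
  obtains (m_add) x y where "x \<in> carrier A" "y \<in> carrier A" "z = mF (x \<oplus>\<^bsub>A\<^esub> y) \<ominus>\<^bsub>PE.FA\<^esub> (mF x \<oplus>\<^bsub>PE.FA\<^esub> mF y)"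
    | (m_smult) c x where "c \<in> carrier K" "x \<in> carrier A" "z = mF (c \<odot>\<^bsub>A\<^esub> x) \<ominus>\<^bsub>PE.FA\<^esub> (c \<odot>\<^bsub>PE.FA\<^esub> mF x)"
    | (h_add) x y where "x \<in> carrier A" "y \<in> carrier A" "z = hF (x \<oplus>\<^bsub>A\<^esub> y) \<ominus>\<^bsub>PE.FA\<^esub> (hF x \<oplus>\<^bsub>PE.FA\<^esub> hF y)"
    | (h_smult) c x where "c \<in> carrier K" "x \<in> carrier A" "z = hF (c \<odot>\<^bsub>A\<^esub> x) \<ominus>\<^bsub>PE.FA\<^esub> (c \<odot>\<^bsub>PE.FA\<^esub> hF x)"
    | (m_mult) x y where "x \<in> carrier A" "y \<in> carrier A" "z = mF (x \<otimes>\<^bsub>A\<^esub> y) \<ominus>\<^bsub>PE.FA\<^esub> (mF x \<otimes>\<^bsub>PE.FA\<^esub> mF y)"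
    | (h_bracket) x y where "x \<in> carrier A" "y \<in> carrier A"
        "z = hF (bracket x y) \<ominus>\<^bsub>PE.FA\<^esub> ((hF x \<otimes>\<^bsub>PE.FA\<^esub> hF y) \<ominus>\<^bsub>PE.FA\<^esub> (hF y \<otimes>\<^bsub>PE.FA\<^esub> hF x))"
    | (h_mult) x y where "x \<in> carrier A" "y \<in> carrier A"
        "z = hF (x \<otimes>\<^bsub>A\<^esub> y) \<ominus>\<^bsub>PE.FA\<^esub> ((mF y \<otimes>\<^bsub>PE.FA\<^esub> hF x) \<oplus>\<^bsub>PE.FA\<^esub> (mF x \<otimes>\<^bsub>PE.FA\<^esub> hF y))"
    | (m_bracket) x y where "x \<in> carrier A" "y \<in> carrier A"
        "z = mF (bracket x y) \<ominus>\<^bsub>PE.FA\<^esub> ((hF x \<otimes>\<^bsub>PE.FA\<^esub> mF y) \<ominus>\<^bsub>PE.FA\<^esub> (mF y \<otimes>\<^bsub>PE.FA\<^esub> hF x))"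
    | (m_one) "z = mF \<one>\<^bsub>A\<^esub> \<ominus>\<^bsub>PE.FA\<^esub> \<one>\<^bsub>PE.FA\<^esub>"
  using assms unfolding env_relations_def Let_def
  by (elim UnE CollectE exE conjE insertE emptyE) (rule that, assumption+)+

end

context projective_poisson
begin

text \<open>The ground field acts on polynomials through the constants of \<open>A\<close>.\<close>

definition kc :: "'a \<Rightarrow> 'c uring" where "kc c = ua (c \<odot>\<^bsub>A\<^esub> \<one>\<^bsub>A\<^esub>)"

lemma kc_rules:
  assumes c: "c \<in> carrier K" "c' \<in> carrier K"
  shows "kc (c \<oplus>\<^bsub>K\<^esub> c') = kc c + kc c'" "kc (c \<otimes>\<^bsub>K\<^esub> c') = kc c * kc c'" "kc \<one>\<^bsub>K\<^esub> = ua \<one>\<^bsub>A\<^esub>"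
    "x \<in> carrier A \<Longrightarrow> ua (c \<odot>\<^bsub>A\<^esub> x) = kc c * ua x" "ua \<one>\<^bsub>A\<^esub> * kc c = kc c"
proof -
  note one = A_one_closed
  show "kc (c \<oplus>\<^bsub>K\<^esub> c') = kc c + kc c'"
    using c one by (simp add: kc_def smult_l_distr ua_rules(1))
  show x: "ua (c \<odot>\<^bsub>A\<^esub> x) = kc c * ua x" if "x \<in> carrier A" for x
    using c that smult_const[OF that c(1)] by (simp add: kc_def ua_rules(4))
  show "kc (c \<otimes>\<^bsub>K\<^esub> c') = kc c * kc c'"
    using c one x[of "c' \<odot>\<^bsub>A\<^esub> \<one>\<^bsub>A\<^esub>"] by (simp add: kc_def smult_assoc1)
  show "kc \<one>\<^bsub>K\<^esub> = ua \<one>\<^bsub>A\<^esub>" using one by (simp add: kc_def)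
  show "ua \<one>\<^bsub>A\<^esub> * kc c = kc c" using c by (simp add: kc_def ua_one_times)
qed

type_synonym 'x uvec = "(nat \<times> 'x) multiset \<Rightarrow>\<^sub>0 'x uring"

text \<open>
  \<open>emb A\<close> does not preserve the unit. The last condition on \<open>f\<close> makes multiplication by the
  idempotent \<open>emb A \<one>\<close> the unit of \<open>EndV\<close>.
\<close>
definition EndV :: "('a, 'c uvec \<Rightarrow> 'c uvec) module" where
  "EndV = \<lparr>carrier = {f. (\<forall>u v. f (u + v) = f u + f v)
      \<and> (\<forall>c\<in>carrier K. \<forall>v. f (scl (kc c) v) = scl (kc c) (f v)) \<and> (\<forall>v. scl (ua \<one>\<^bsub>A\<^esub>) (f v) = f v)},
    monoid.mult = (\<lambda>f g v. f (g v)), one = scl (ua \<one>\<^bsub>A\<^esub>), zero = (\<lambda>_. 0), add = (\<lambda>f g v. f v + g v),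
    smult = (\<lambda>c f v. scl (kc c) (f v))\<rparr>"

lemma EndV_simps:
  "f \<in> carrier EndV \<longleftrightarrow> (\<forall>u v. f (u + v) = f u + f v)
      \<and> (\<forall>c\<in>carrier K. \<forall>v. f (scl (kc c) v) = scl (kc c) (f v)) \<and> (\<forall>v. scl (ua \<one>\<^bsub>A\<^esub>) (f v) = f v)"
  "f \<otimes>\<^bsub>EndV\<^esub> g = (\<lambda>v. f (g v))" "\<one>\<^bsub>EndV\<^esub> = scl (ua \<one>\<^bsub>A\<^esub>)" "\<zero>\<^bsub>EndV\<^esub> = (\<lambda>_. 0)"
  "f \<oplus>\<^bsub>EndV\<^esub> g = (\<lambda>v. f v + g v)" "c \<odot>\<^bsub>EndV\<^esub> f = (\<lambda>v. scl (kc c) (f v))"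
  by (simp_all add: EndV_def)

text \<open>Multiplication by the idempotent is the scalar one of \<open>K\<close>, so it commutes
  with \<open>f\<close>; and it fixes the values of \<open>f\<close>.\<close>

lemma EndV_one: "f \<in> carrier EndV \<Longrightarrow> f (scl (ua \<one>\<^bsub>A\<^esub>) v) = f v"
  using kc_rules(3)[OF K.one_closed K.one_closed] K.one_closed unfolding EndV_simps by metis

lemma EndV_algebra: "assoc_algebra K EndV"
proof -
  have group: "abelian_group EndV"
  proof (rule abelian_groupI)
    fix f assume f: "f \<in> carrier EndV"
    have "(\<lambda>v. - f v) \<in> carrier EndV" using f by (simp add: EndV_simps)
    then show "\<exists>g\<in>carrier EndV. g \<oplus>\<^bsub>EndV\<^esub> f = \<zero>\<^bsub>EndV\<^esub>"
      by (rule bexI[rotated]) (simp add: EndV_simps)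
  qed (auto simp: EndV_simps scl_distribs algebra_simps)
  have m: "module K EndV"
  proof (rule moduleI)
    show "cring K" by (rule K.is_cring)
    show "abelian_group EndV" by (rule group)
    show "c \<odot>\<^bsub>EndV\<^esub> f \<in> carrier EndV" if "c \<in> carrier K" "f \<in> carrier EndV" for c f
      using that by (auto simp: EndV_simps scl_distribs mult.commute[of "kc c"] mult.assoc
          kc_rules(5)[OF that(1) that(1)])
    show "\<one>\<^bsub>K\<^esub> \<odot>\<^bsub>EndV\<^esub> f = f" if "f \<in> carrier EndV" for f
      using that kc_rules(3)[OF K.one_closed K.one_closed] by (simp add: EndV_simps)
  qed (auto simp: EndV_simps scl_distribs kc_rules)
  have "Group.monoid EndV"
  proof (rule monoidI)
    have "ua \<one>\<^bsub>A\<^esub> * ua \<one>\<^bsub>A\<^esub> = ua \<one>\<^bsub>A\<^esub>" using A_one_closed by (rule ua_one_times)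
    then show "\<one>\<^bsub>EndV\<^esub> \<in> carrier EndV"
      by (auto simp: EndV_simps scl_distribs mult.commute)
    show "f \<otimes>\<^bsub>EndV\<^esub> \<one>\<^bsub>EndV\<^esub> = f" if "f \<in> carrier EndV" for f
      using EndV_one[OF that] by (simp add: EndV_simps)
  qed (auto simp: EndV_simps)
  then have "ring EndV"
    by (rule ringI[OF group]) (auto simp: EndV_simps)
  then show ?thesis
    using m by (intro assoc_algebra.intro assoc_algebra_axioms.intro) (auto simp: EndV_simps)
qed

sublocale EV: assoc_algebra K EndV
  by (rule EndV_algebra)

lemma EndV_minus: "f \<in> carrier EndV \<Longrightarrow> g \<in> carrier EndV \<Longrightarrow> f \<ominus>\<^bsub>EndV\<^esub> g = (\<lambda>v. f v - g v)"
proof -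
  assume f: "f \<in> carrier EndV" and g: "g \<in> carrier EndV"
  have "\<ominus>\<^bsub>EndV\<^esub> g = (\<lambda>v. - g v)"
    using g by (intro EV.M.minus_equality) (simp_all add: EndV_simps)
  then show ?thesis by (simp add: a_minus_def EndV_simps)
qed

lemma hact_D': "x \<in> carrier A \<Longrightarrow> y \<in> carrier A \<Longrightarrow>
    PL.hact (x \<otimes>\<^bsub>A\<^esub> y) v = scl (ua x) (PL.hact y v) + scl (ua y) (PL.hact x v)"
  by (simp add: PL.hact_def Dx_rules shift_linear PL.X_add PL.X_scl)

primrec gen_op :: "'c env_gen \<Rightarrow> 'c uvec \<Rightarrow> 'c uvec" where
  "gen_op (GenM x) = scl (ua x)"
| "gen_op (GenH x) = PL.hact x"

lemma hact_closed: "x \<in> carrier A \<Longrightarrow> PL.hact x \<in> carrier EndV"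
proof -
  assume x: "x \<in> carrier A"
  have "scl (ua \<one>\<^bsub>A\<^esub>) (PL.hact x v) = PL.hact x v" for v
    using PL.hact_D(2)[of x "ua \<one>\<^bsub>A\<^esub>" x v] Dx_rules(4)[OF x x] by simp
  then show ?thesis
    by (simp add: EndV_simps PL.hact_add_right PL.hact_scl_right kc_def ancx_facts)
qed

lemma scl_closed: "x \<in> carrier A \<Longrightarrow> scl (ua x) \<in> carrier EndV"
  using ua_one_times[of x] by (auto simp: EndV_simps scl_distribs mult.commute)

lemma gen_op_closed: "gen_op \<in> env_gens A \<rightarrow> carrier EndV"
  by (auto simp: env_gens_def hact_closed scl_closed)

text \<open>The defining relations translate into properties already available:
  \<open>h_bracket\<close> is \<open>hact_commutator\<close>, \<open>m_bracket\<close> is the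
  Leibniz rule \<open>hact_scl_right\<close>, and \<open>h_mult\<close> together with the linearity
  of \<open>h\<close> comes from the rules for \<open>d\<close>.\<close>

lemma ex_rep:
  "\<exists>f. f \<in> ring_hom E EndV \<and> (\<forall>x\<in>carrier A. f (m x) = scl (ua x) \<and> f (h x) = PL.hact x)"
proof -
  let ?e = "lincomb K EndV (word_val EndV gen_op)"
  have wc: "word_val EndV gen_op \<in> lists (env_gens A) \<rightarrow> carrier EndV"
    using EV.word_val_closed[OF gen_op_closed] by blast
  have e: "?e \<in> module_hom K PE.FA EndV"
    using EV.lincomb_hom(1)[OF wc] by (simp add: module_hom_def free_algebra_simps)
  have em: "?e (f \<otimes>\<^bsub>PE.FA\<^esub> g) = ?e f \<otimes>\<^bsub>EndV\<^esub> ?e g" if "f \<in> carrier PE.FA" "g \<in> carrier PE.FA" for f g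
    using EV.lincomb_word_mult[OF gen_op_closed] that by (simp add: free_algebra_simps)
  have ev: "?e (mF x) = scl (ua x)" "?e (hF x) = PL.hact x" if "x \<in> carrier A" for x
    using EV.lincomb_hom(2)[OF wc, of "[GenM x]"] EV.lincomb_hom(2)[OF wc, of "[GenH x]"] that
      EV.r_one[OF scl_closed[OF that]] EV.r_one[OF hact_closed[OF that]]
    by (simp_all add: free_var_def env_gens_def)
  have e1: "?e \<one>\<^bsub>PE.FA\<^esub> = \<one>\<^bsub>EndV\<^esub>"
    using EV.lincomb_hom(2)[OF wc, of "[]"] by (simp add: free_algebra_simps)
  have minus: "?e (u \<ominus>\<^bsub>PE.FA\<^esub> v) = ?e u \<ominus>\<^bsub>EndV\<^esub> ?e v" if "u \<in> carrier PE.FA" "v \<in> carrier PE.FA" for u v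
    using module_hom_minus[OF PE.FA.module_self EV.module_self e that] .
  have zero: "?e (u \<ominus>\<^bsub>PE.FA\<^esub> v) = \<zero>\<^bsub>EndV\<^esub>"
    if "u \<in> carrier PE.FA" "v \<in> carrier PE.FA" "?e u = ?e v" for u v
    using minus[OF that(1,2)] that module_homD(1)[OF e] by (simp add: EV.M.minus_eq_zero_iff)
  note simps = mhF_closed ev em minus module_homD(2,3)[OF e] bracket_closed A_m_closed A_one_closed smult_closed
    EndV_minus[OF EV.m_closed EV.m_closed] hact_closed scl_closed
  have "?e z = \<zero>\<^bsub>EndV\<^esub>" if "z \<in> env_relations K A bracket" for z
    using that
  proof (cases rule: env_relations_cases)
    case (m_add x y)
    then show ?thesis
      unfolding m_add(3) by (intro zero) (simp_all add: simps, simp_all add: EndV_simps ua_rules(1) scl_distribs fun_eq_iff)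
  next
    case (m_smult c x)
    then show ?thesis
      unfolding m_smult(3) by (intro zero) (simp_all add: simps, simp_all add: EndV_simps kc_rules(4) fun_eq_iff)
  next
    case (h_add x y)
    then show ?thesis
      unfolding h_add(3) by (intro zero) (simp_all add: simps, simp_all add: EndV_simps fun_eq_iff PL.hact_D(1) Dx_rules)
  next
    case (h_smult c x)
    then show ?thesis
      unfolding h_smult(3)
      by (intro zero) (simp_all add: simps, simp_all add: EndV_simps fun_eq_iff PL.hact_D(2) Dx_rules kc_def)
  next
    case (m_mult x y)
    then show ?thesis
      unfolding m_mult(3) by (intro zero) (simp_all add: simps, simp_all add: EndV_simps ua_rules(2) fun_eq_iff)
  next
    case (h_bracket x y)
    then show ?thesis
      unfolding h_bracket(3)
      by (intro zero) (simp_all add: simps,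
          simp_all add: EndV_simps fun_eq_iff PL.hact_commutator, simp add: brx_def)
  next
    case (h_mult x y)
    then show ?thesis
      unfolding h_mult(3)
      by (intro zero) (simp_all add: simps, simp_all add: EndV_simps fun_eq_iff hact_D' add.commute)
  next
    case (m_bracket x y)
    then show ?thesis
      unfolding m_bracket(3)
      by (intro zero) (simp_all add: simps, simp_all add: EndV_simps fun_eq_iff PL.hact_scl_right ancx_facts(7))
  next
    case m_one
    then show ?thesis
      unfolding m_one by (intro zero) (simp_all add: simps e1, simp_all add: EndV_simps)
  qed
  then obtain f where "f \<in> ring_hom PE.PA EndV" "\<And>x. x \<in> env_gens A \<Longrightarrow> f (PE.var x) = gen_op x"
    using PE.PA_hom[OF EndV_algebra gen_op_closed] by metis
  then show ?thesis
    by (intro exI[of _ f]) (simp add: E_eq env_m_def env_h_def env_gens_def)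
qed

definition rep :: "('c env_gen list \<Rightarrow> 'a) set \<Rightarrow> 'c uvec \<Rightarrow> 'c uvec" where
  "rep = (SOME f. f \<in> ring_hom E EndV \<and> (\<forall>x\<in>carrier A. f (m x) = scl (ua x) \<and> f (h x) = PL.hact x))"

lemma rep_hom: "rep \<in> ring_hom E EndV"
  and rep_mh: "x \<in> carrier A \<Longrightarrow> rep (m x) = scl (ua x)" "x \<in> carrier A \<Longrightarrow> rep (h x) = PL.hact x"
  using someI_ex[OF ex_rep] unfolding rep_def by auto

lemma rep_rules:
  assumes "u \<in> carrier E" "v \<in> carrier E"
  shows "rep (u \<otimes>\<^bsub>E\<^esub> v) w = rep u (rep v w)" "rep (u \<oplus>\<^bsub>E\<^esub> v) w = rep u w + rep v w"
    "rep \<one>\<^bsub>E\<^esub> w = scl (ua \<one>\<^bsub>A\<^esub>) w"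
  using ring_hom_mult[OF rep_hom assms] ring_hom_add[OF rep_hom assms] ring_hom_one[OF rep_hom]
  by (simp_all add: EndV_simps)

lemma rep_zero: "rep \<zero>\<^bsub>E\<^esub> w = 0"
  using rep_rules(2)[of "\<zero>\<^bsub>E\<^esub>" "\<zero>\<^bsub>E\<^esub>" w] by simp

end

section \<open>Degrees and homogeneous parts of polynomials\<close>

definition sized :: "nat set \<Rightarrow> ('i multiset \<Rightarrow>\<^sub>0 'r::comm_ring_1) \<Rightarrow> bool"
  where "sized S v \<longleftrightarrow> (\<forall>p\<in>Poly_Mapping.keys v. size p \<in> S)"

definition top_part :: "nat \<Rightarrow> ('i multiset \<Rightarrow>\<^sub>0 'r::comm_ring_1) \<Rightarrow> 'i multiset \<Rightarrow>\<^sub>0 'r"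
  where "top_part n = lin (\<lambda>p. if size p = n then single1 p else 0)"

lemma sized_rules:
  "sized S 0" "sized S v \<Longrightarrow> sized S w \<Longrightarrow> sized S (v + w)" "sized S v \<Longrightarrow> sized S (scl r v)"
  "size p \<in> S \<Longrightarrow> sized S (Poly_Mapping.single p r)" "sized S v \<Longrightarrow> S \<subseteq> T \<Longrightarrow> sized T v"
proof -
  show "sized S v \<Longrightarrow> sized S w \<Longrightarrow> sized S (v + w)"
    using keys_add[of v w] by (auto simp: sized_def)
qed (auto simp: sized_def in_keys_iff lookup_single when_def split: if_splits)

lemma sized_induct [consumes 1, case_names zero single add]:
  assumes "sized S v" "P 0" "\<And>p r. size p \<in> S \<Longrightarrow> P (Poly_Mapping.single p r)"
    "\<And>f g. P f \<Longrightarrow> P g \<Longrightarrow> P (f + g)"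
  shows "P v"
  by (rule poly_mapping_keys_induct[of v "{p. size p \<in> S}"]) (use assms in \<open>auto simp: sized_def\<close>)

lemma top_part_add: "top_part n (v + w) = top_part n v + top_part n w"
  by (simp add: top_part_def lin_add)

lemma top_part_scl: "top_part n (scl r v) = scl r (top_part n v)"
  by (simp add: top_part_def lin_scl)

lemma top_part_zero [simp]: "top_part n 0 = 0"
  by (simp add: top_part_def)

lemma top_part_eq_zero: "sized S v \<Longrightarrow> n \<notin> S \<Longrightarrow> top_part n v = 0"
  by (induction v rule: sized_induct) (auto simp: top_part_add lin_add top_part_def)

lemma top_part_eq: "sized {n} v \<Longrightarrow> top_part n v = v"
  by (induction v rule: sized_induct) (auto simp: lin_add top_part_def single1_def)

lemma (in free_lie_rinehart) sized_mulv: "sized S v \<Longrightarrow> sized (Suc ` S) (mulv y v)"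
proof (induction v rule: sized_induct)
  case (single p r)
  show ?case
    using single
    by (induction y rule: poly_mapping_add_induct) (auto simp: mulv_add mulv_single intro: sized_rules)
qed (auto simp: mulv_add_right intro: sized_rules)

lemma (in comm_monoid) word_val_mset:
  assumes t: "\<And>x. t x \<in> carrier G"
  shows "mset l = mset l' \<Longrightarrow> word_val G t l = word_val G t l'"
proof (induction l arbitrary: l')
  case (Cons x l)
  then have "x \<in> set l'" by (metis list.set_intros(1) set_mset_mset)
  then obtain a b where l': "l' = a @ x # b" by (meson split_list)
  have c: "word_val G t w \<in> carrier G" for w
    using word_val_closed[of t UNIV w] t by auto
  have app: "word_val G t (u @ v) = word_val G t u \<otimes> word_val G t v" for u v
    using word_val_append[of t UNIV u v] t by auto
  have "mset l = mset (a @ b)" using Cons.prems by (simp add: l')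
  then have "word_val G t (x # l) = t x \<otimes> word_val G t (a @ b)"
    by (simp only: word_val_simps Cons.IH)
  also have "\<dots> = word_val G t l'" using t c by (simp add: l' app m_lcomm)
  finally show ?case .
qed simp

context poisson_algebra
begin

section \<open>Differentials in the enveloping algebra and their symmetric algebra\<close>

lemma Om_induct [consumes 1, case_names smult add]:
  assumes "w \<in> carrier Om"
    and smult: "\<And>r x. r \<in> carrier A \<Longrightarrow> x \<in> carrier A \<Longrightarrow> P (r \<odot>\<^bsub>Om\<^esub> dd x)"
    and add: "\<And>v w. v \<in> carrier Om \<Longrightarrow> w \<in> carrier Om \<Longrightarrow> P v \<Longrightarrow> P w \<Longrightarrow> P (v \<oplus>\<^bsub>Om\<^esub> w)"
  shows "P w"
proof -
  obtain f where f: "f \<in> carrier FM" "w = quo f" using Om_cases assms(1) by blast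
  have "P (quo f)"
    using f(1)
  proof (induction f rule: cring.free_module_induct[OF M_cring, consumes 1, case_names zero basis add])
    case zero
    have "P (\<zero>\<^bsub>A\<^esub> \<odot>\<^bsub>Om\<^esub> dd \<zero>\<^bsub>A\<^esub>)" by (rule smult) auto
    then show ?case
      using module_hom_zero[OF FM.module_axioms Om.module_axioms quo_hom] by simp
  next
    case (basis r x)
    then show ?case using smult[of r x] by (simp add: quo_rules dd_def del: free_module_simps)
  next
    case (add f g)
    then show ?case
      using \<open>\<And>v w. v \<in> carrier Om \<Longrightarrow> w \<in> carrier Om \<Longrightarrow> P v \<Longrightarrow> P w \<Longrightarrow> P (v \<oplus>\<^bsub>Om\<^esub> w)\<close>[of "quo f" "quo g"]
      by (simp add: quo_rules del: free_module_simps)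
  qed
  then show ?thesis using f by simp
qed

text \<open>The relation for \<open>h\<close> of a product says that \<open>h\<close> is a
  derivation for the left action of \<open>A\<close>, hence it factors through the
  differentials.\<close>

lemma ex_Hm: "\<exists>H. H \<in> module_hom A Om EL \<and> (\<forall>x\<in>carrier A. H (dd x) = h x)"
proof -
  have 1: "h (c \<odot>\<^bsub>A\<^esub> x) = (c \<odot>\<^bsub>A\<^esub> \<one>\<^bsub>A\<^esub>) \<odot>\<^bsub>EL\<^esub> h x" if "c \<in> carrier K" "x \<in> carrier A" for c x
    using that A_one_closed by (simp add: EL_simps env_rules m_one E.smult_mult_left)
  have 2: "h (x \<otimes>\<^bsub>A\<^esub> y) = (x \<odot>\<^bsub>EL\<^esub> h y) \<oplus>\<^bsub>EL\<^esub> (y \<odot>\<^bsub>EL\<^esub> h x)"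
    if "x \<in> carrier A" "y \<in> carrier A" for x y
    using that by (simp add: EL_simps env_rules E.M.a_comm)
  show ?thesis
  proof (rule kaehler_lift[OF EL_module, of h])
    show "h x \<in> carrier EL" if "x \<in> carrier A" for x using that by (simp add: EL_simps)
    show "h (x \<oplus>\<^bsub>A\<^esub> y) = h x \<oplus>\<^bsub>EL\<^esub> h y" if "x \<in> carrier A" "y \<in> carrier A" for x y
      using that by (simp add: EL_simps env_rules)
    show ?thesis if "H \<in> module_hom A Om EL" "\<And>x. x \<in> carrier A \<Longrightarrow> H (dd x) = h x" for H
      using that by blast
  qed (rule 1 2; assumption)+
qed

definition Hm where "Hm = (SOME H. H \<in> module_hom A Om EL \<and> (\<forall>x\<in>carrier A. H (dd x) = h x))"

lemma Hm_hom: "Hm \<in> module_hom A Om EL" and Hm_dd: "x \<in> carrier A \<Longrightarrow> Hm (dd x) = h x"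
  using someI_ex[OF ex_Hm] unfolding Hm_def by auto

lemma Hm_rules:
  "w \<in> carrier Om \<Longrightarrow> Hm w \<in> carrier E"
  "v \<in> carrier Om \<Longrightarrow> w \<in> carrier Om \<Longrightarrow> Hm (v \<oplus>\<^bsub>Om\<^esub> w) = Hm v \<oplus>\<^bsub>E\<^esub> Hm w"
  "r \<in> carrier A \<Longrightarrow> w \<in> carrier Om \<Longrightarrow> Hm (r \<odot>\<^bsub>Om\<^esub> w) = m r \<otimes>\<^bsub>E\<^esub> Hm w"
  using module_homD[OF Hm_hom] by (simp_all add: EL_simps)

lemma Hm_F: "w \<in> carrier Om \<Longrightarrow> Hm w \<in> F 1"
proof (induction w rule: Om_induct)
  case (smult r x)
  have "hw [x] \<in> F 1" using smult by (intro hw_F) auto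
  then show ?case using smult by (simp add: Hm_rules Hm_dd F_rules)
qed (simp add: Hm_rules F_rules)

abbreviation Hw where "Hw \<equiv> word_val E Hm"

lemma Hw_F: "ws \<in> lists (carrier Om) \<Longrightarrow> Hw ws \<in> F (length ws)"
proof (induction ws)
  case Nil
  then show ?case using hw_F[of "[]" 0] by simp
next
  case (Cons w ws)
  then show ?case using F_mult[of "Hm w" 1 "Hw ws" "length ws"] Hm_F by simp
qed

lemma Hw_dd: "ys \<in> lists (carrier A) \<Longrightarrow> Hw (map dd ys) = hw ys"
  by (induction ys) (auto simp: Hm_dd)

lemma dd_lists: "ys \<in> lists (carrier A) \<Longrightarrow> map dd ys \<in> lists (carrier Om)"
  by auto

lemma symmetric_relations_closed: "symmetric_relations A Om \<subseteq> carrier (free_algebra A (carrier Om))"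
proof -
  interpret S: assoc_algebra A "free_algebra A (carrier Om)"
    by (rule cring.assoc_algebra_free_algebra[OF M_cring])
  have v: "free_var A w \<in> carrier (free_algebra A (carrier Om))" if "w \<in> carrier Om" for w
    using that by (simp add: free_var_def free_algebra_simps cring.free_basis_closed[OF M_cring])
  show ?thesis
    unfolding symmetric_relations_def Let_def by (auto simp: v)
qed

sublocale SP: presentation A "carrier Om" "symmetric_relations A Om"
  by (intro presentation.intro presentation_axioms.intro symmetric_relations_closed M_cring)

abbreviation S where "S \<equiv> SP.PA"
abbreviation sv where "sv \<equiv> SP.var"

lemma S_eq: "symmetric_algebra A Om = S"
  by (simp add: symmetric_algebra_def)

lemma symmetric_relations_cases:
  assumes "z \<in> symmetric_relations A Om"
  obtains (add) v w where "v \<in> carrier Om" "w \<in> carrier Om"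
      "z = free_var A (v \<oplus>\<^bsub>Om\<^esub> w) \<ominus>\<^bsub>SP.FA\<^esub> (free_var A v \<oplus>\<^bsub>SP.FA\<^esub> free_var A w)"
    | (smult) r w where "r \<in> carrier A" "w \<in> carrier Om"
      "z = free_var A (r \<odot>\<^bsub>Om\<^esub> w) \<ominus>\<^bsub>SP.FA\<^esub> (r \<odot>\<^bsub>SP.FA\<^esub> free_var A w)"
    | (comm) v w where "v \<in> carrier Om" "w \<in> carrier Om"
      "z = (free_var A v \<otimes>\<^bsub>SP.FA\<^esub> free_var A w) \<ominus>\<^bsub>SP.FA\<^esub> (free_var A w \<otimes>\<^bsub>SP.FA\<^esub> free_var A v)"
  using assms unfolding symmetric_relations_def Let_def
  by (elim UnE CollectE exE conjE) (rule that, assumption+)+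

lemma sv_closed [simp]: "w \<in> carrier Om \<Longrightarrow> sv w \<in> carrier S"
  using SP.var_closed by blast

lemma sv_rules:
  assumes v: "v \<in> carrier Om" and w: "w \<in> carrier Om"
  shows "sv (v \<oplus>\<^bsub>Om\<^esub> w) = sv v \<oplus>\<^bsub>S\<^esub> sv w"
    "r \<in> carrier A \<Longrightarrow> sv (r \<odot>\<^bsub>Om\<^esub> w) = r \<odot>\<^bsub>S\<^esub> sv w"
    "sv v \<otimes>\<^bsub>S\<^esub> sv w = sv w \<otimes>\<^bsub>S\<^esub> sv v"
proof -
  let ?R = "symmetric_relations A Om"
  have r: "free_var A (v \<oplus>\<^bsub>Om\<^esub> w) \<ominus>\<^bsub>SP.FA\<^esub> (free_var A v \<oplus>\<^bsub>SP.FA\<^esub> free_var A w) \<in> ?R"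
    "r \<in> carrier A \<Longrightarrow> free_var A (r \<odot>\<^bsub>Om\<^esub> w) \<ominus>\<^bsub>SP.FA\<^esub> (r \<odot>\<^bsub>SP.FA\<^esub> free_var A w) \<in> ?R"
    "(free_var A v \<otimes>\<^bsub>SP.FA\<^esub> free_var A w) \<ominus>\<^bsub>SP.FA\<^esub> (free_var A w \<otimes>\<^bsub>SP.FA\<^esub> free_var A v) \<in> ?R"
    unfolding symmetric_relations_def Let_def using v w by blast+
  note * = r[THEN SP.cls_eqI]
  note simps = SP.var_eq SP.cls(5-7) SP.free_var_closed v w
  show "sv (v \<oplus>\<^bsub>Om\<^esub> w) = sv v \<oplus>\<^bsub>S\<^esub> sv w" using *(1) by (simp add: simps)
  show "r \<in> carrier A \<Longrightarrow> sv (r \<odot>\<^bsub>Om\<^esub> w) = r \<odot>\<^bsub>S\<^esub> sv w" using *(2) by (simp add: simps)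
  show "sv v \<otimes>\<^bsub>S\<^esub> sv w = sv w \<otimes>\<^bsub>S\<^esub> sv v" using *(3) by (simp add: simps)
qed

lemma S_cring: "cring S"
  by (rule SP.PA_commute) (rule sv_rules(3))

lemma S_algebra: "algebra A S"
  by (rule algebraI[OF M_cring S_cring])
    (auto simp: SP.PA.smult_l_distr SP.PA.smult_r_distr SP.PA.smult_assoc1 SP.PA.smult_mult_left)


end

context projective_poisson
begin

section \<open>Leading terms of words acting on the constant polynomial\<close>

definition wact :: "('c \<Rightarrow> 'c) set \<Rightarrow> 'c uvec \<Rightarrow> 'c uvec" where "wact w = PL.X (nth_in 0 (hs w))"

lemma wact_dd: "x \<in> carrier A \<Longrightarrow> wact (dd x) v = PL.hact x v"
  by (simp add: wact_def PL.hact_def Dx_def)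

lemma rep_Hm: "w \<in> carrier Om \<Longrightarrow> rep (Hm w) v = wact w v"
proof (induction w rule: Om_induct)
  case (smult r x)
  have "wact (r \<odot>\<^bsub>Om\<^esub> dd x) v = scl (ua r) (wact (dd x) v)"
    using smult by (simp add: wact_def hs_rules(2) shift_linear PL.X_scl)
  then show ?case using smult by (simp add: Hm_rules Hm_dd rep_rules rep_mh wact_dd)
next
  case (add v w)
  then show ?case by (simp add: Hm_rules rep_rules wact_def hs_rules(1) shift_linear PL.X_add)
qed

text \<open>The unit of the factor \<open>A\<close>, not of \<open>uring\<close>: the unit of the
  enveloping algebra acts as multiplication by this idempotent and has to fix the starting
  vector.\<close>

definition v0 :: "'c uvec" where "v0 = Poly_Mapping.single {#} (ua \<one>\<^bsub>A\<^esub>)"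

definition mulw :: "('c \<Rightarrow> 'c) set list \<Rightarrow> 'c uvec"
  where "mulw ws = foldr (\<lambda>w. PL.mulv (nth_in 0 (hs w))) ws v0"

lemma v0_idem: "scl (ua \<one>\<^bsub>A\<^esub>) v0 = v0"
  using ua_one_times[OF A_one_closed] by (simp add: v0_def)

lemma sized_mulw: "sized {length ws} (mulw ws)"
proof (induction ws)
  case Nil
  show ?case by (simp add: mulw_def v0_def sized_rules)
next
  case (Cons w ws)
  then show ?case using PL.sized_mulv[of "{length ws}" "mulw ws"] by (simp add: mulw_def)
qed

lemma deg_le_sized: "PL.deg_le n v \<longleftrightarrow> sized {..n} v"
  by (auto simp: PL.deg_le_def sized_def)

text \<open>By \<open>PL.X_top\<close> each factor acts as multiplication by its linear form up to
  terms that do not raise the degree, and the multiplication itself keeps the earlier error below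
  the top degree.\<close>

lemma rep_word:
  "ws \<in> lists (carrier Om) \<Longrightarrow> sized {..<length ws} (rep (Hw ws) v0 - mulw ws)"
proof (induction ws)
  case Nil
  have "rep \<one>\<^bsub>E\<^esub> v0 = v0" using rep_rules(3)[of "\<one>\<^bsub>E\<^esub>" "\<one>\<^bsub>E\<^esub>" v0] v0_idem by simp
  then show ?case by (simp add: mulw_def sized_rules)
next
  case (Cons w ws)
  then have w: "w \<in> carrier Om" and ws: "ws \<in> lists (carrier Om)" by auto
  define v where "v = rep (Hw ws) v0"
  define y where "y = nth_in 0 (hs w)"
  have IH: "sized {..<length ws} (v - mulw ws)" using Cons.IH[OF ws] by (simp add: v_def)
  have "sized {..length ws} (v - mulw ws)" "sized {..length ws} (mulw ws)"
    using IH sized_mulw[of ws] by (auto intro: sized_rules(5))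
  then have "sized {..length ws} v" using sized_rules(2) by fastforce
  then have "sized {..length ws} (PL.X y v - PL.mulv y v)"
    using PL.X_top[of "length ws" v y] by (simp add: deg_le_sized)
  then have 1: "sized {..<Suc (length ws)} (PL.X y v - PL.mulv y v)"
    by (simp add: lessThan_Suc_atMost)
  have "sized (Suc ` {..<length ws}) (PL.mulv y (v - mulw ws))"
    using IH by (rule PL.sized_mulv)
  then have 2: "sized {..<Suc (length ws)} (PL.mulv y (v - mulw ws))"
    by (rule sized_rules(5)) auto
  have "PL.mulv y v = PL.mulv y (v - mulw ws) + PL.mulv y (mulw ws)"
    using PL.mulv_add_right[of y "v - mulw ws" "mulw ws"] by simp
  then have "(PL.X y v - PL.mulv y v) + PL.mulv y (v - mulw ws) = PL.X y v - PL.mulv y (mulw ws)"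
    by simp
  then have "sized {..<Suc (length ws)} (PL.X y v - PL.mulv y (mulw ws))"
    using sized_rules(2)[OF 1 2] by (simp only:)
  moreover have "rep (Hw (w # ws)) v0 = PL.X y v"
    using w Hw_F[OF ws] by (simp add: rep_rules Hm_rules F_subset rep_Hm wact_def v_def y_def)
  ultimately show ?case by (simp add: mulw_def y_def)
qed

lemma top_rep_word: "ws \<in> lists (carrier Om) \<Longrightarrow> top_part (length ws) (rep (Hw ws) v0) = mulw ws"
proof -
  assume "ws \<in> lists (carrier Om)"
  then have "top_part (length ws) (rep (Hw ws) v0 - mulw ws + mulw ws) = mulw ws"
    unfolding top_part_add using top_part_eq_zero[OF rep_word] top_part_eq[OF sized_mulw] by simp
  then show ?thesis by simp
qed

lemma sized_rep: "u \<in> F n \<Longrightarrow> sized {..n} (rep u v0)"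
proof (induction u rule: F_induct)
  case (word a w)
  let ?ws = "map dd w"
  have "sized {..n} (rep (Hw ?ws) v0 - mulw ?ws)" "sized {..n} (mulw ?ws)"
    using rep_word[OF dd_lists[OF word(2)]] sized_mulw[of ?ws] word(3) by (auto elim!: sized_rules(5))
  then have "sized {..n} (rep (hw w) v0)"
    using sized_rules(2) Hw_dd[of w] word by fastforce
  then show ?case using word by (simp add: rep_rules rep_mh sized_rules)
next
  case (add u v)
  then show ?case by (simp add: rep_rules F_subset sized_rules)
qed

text \<open>This makes the leading part in degree \<open>n\<close> a function on the graded
  piece.\<close>

lemma top_rep_FP: "u \<in> FP n \<Longrightarrow> top_part n (rep u v0) = 0"
proof (cases n)
  case 0
  then show "u \<in> FP n \<Longrightarrow> top_part n (rep u v0) = 0" by (simp add: FP_simps rep_zero)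
next
  case (Suc k)
  then show "u \<in> FP n \<Longrightarrow> top_part n (rep u v0) = 0"
    using sized_rep[of u k] top_part_eq_zero[of "{..k}" "rep u v0" n] by (simp add: FP_simps)
qed

section \<open>The symbol isomorphism\<close>

text \<open>Every copy of the variable \<open>x\<close> goes to the class of \<open>dx\<close>. The
  leading parts \<open>mulw ws\<close> live in copy 0, and the uniform choice gives a value to all
  other polynomials as well.\<close>

definition svar :: "nat \<times> 'c \<Rightarrow> (('c \<Rightarrow> 'c) set list \<Rightarrow> 'c) set"
  where "svar i = (if snd i \<in> carrier A then sv (dd (snd i)) else \<zero>\<^bsub>S\<^esub>)"

text \<open>Any enumeration of the multiset gives the same product, because \<open>S\<close> is
  commutative (\<open>smon_mset\<close>).\<close>

definition smon :: "(nat \<times> 'c) multiset \<Rightarrow> (('c \<Rightarrow> 'c) set list \<Rightarrow> 'c) set"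
  where "smon p = word_val S svar (SOME l. mset l = p)"

lemma svar_closed [simp]: "svar i \<in> carrier S"
  by (simp add: svar_def)

lemma smon_mset: "smon (mset l) = word_val S svar l"
proof -
  have "mset (SOME l'. mset l' = mset l) = mset l" by (rule someI_ex) blast
  then show ?thesis
    unfolding smon_def by (intro comm_monoid.word_val_mset cring.axioms(2) S_cring svar_closed)
qed

lemma smon_rules: "smon {#} = \<one>\<^bsub>S\<^esub>" "smon (add_mset i p) = svar i \<otimes>\<^bsub>S\<^esub> smon p" "smon p \<in> carrier S"
proof -
  obtain l where l: "mset l = p" using ex_mset by blast
  show "smon {#} = \<one>\<^bsub>S\<^esub>" using smon_mset[of "[]"] by simp
  show "smon (add_mset i p) = svar i \<otimes>\<^bsub>S\<^esub> smon p"
    using smon_mset[of "i # l"] smon_mset[of l] l by simp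
  show "smon p \<in> carrier S"
    using smon_mset[of l] l SP.PA.word_val_closed[of svar UNIV l] by auto
qed

definition piS :: "'c uvec \<Rightarrow> (('c \<Rightarrow> 'c) set list \<Rightarrow> 'c) set"
  where "piS v = lincomb A S smon (\<lambda>p. co (Poly_Mapping.lookup v p))"

lemma co_lookup_closed: "(\<lambda>p. co (Poly_Mapping.lookup v p)) \<in> carrier (free_module A UNIV)"
proof -
  have "{p. co (Poly_Mapping.lookup v p) \<noteq> \<zero>\<^bsub>A\<^esub>} \<subseteq> Poly_Mapping.keys v"
    by (auto simp: in_keys_iff)
  then have "finite {p. co (Poly_Mapping.lookup v p) \<noteq> \<zero>\<^bsub>A\<^esub>}" by (rule finite_subset) simp
  then show ?thesis by (simp add: free_module_carrier)
qed

lemma piS_rules: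
  "piS v \<in> carrier S" "piS (v + w) = piS v \<oplus>\<^bsub>S\<^esub> piS w" "piS (scl q v) = co q \<odot>\<^bsub>S\<^esub> piS v"
  "piS (Poly_Mapping.single p q) = co q \<odot>\<^bsub>S\<^esub> smon p"
proof -
  have sf: "smon \<in> UNIV \<rightarrow> carrier S" using smon_rules(3) by simp
  note hom = SP.PA.lincomb_hom(1)[OF sf] and bas = SP.PA.lincomb_hom(2)[OF sf]
  note rules = module_homD[OF hom]
  show "piS v \<in> carrier S" unfolding piS_def by (rule rules(1)[OF co_lookup_closed])
  show "piS (v + w) = piS v \<oplus>\<^bsub>S\<^esub> piS w"
    unfolding piS_def rules(2)[OF co_lookup_closed co_lookup_closed, symmetric]
    by (simp add: lookup_add)
  show "piS (scl q v) = co q \<odot>\<^bsub>S\<^esub> piS v"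
    unfolding piS_def using rules(3)[OF _ co_lookup_closed, of "co q" v] by simp
  have "(\<lambda>p'. co (Poly_Mapping.lookup (Poly_Mapping.single p q) p'))
      = co q \<odot>\<^bsub>free_module A UNIV\<^esub> free_basis A p"
    by (auto simp: fun_eq_iff lookup_single when_def free_basis_def)
  then show "piS (Poly_Mapping.single p q) = co q \<odot>\<^bsub>S\<^esub> smon p"
    unfolding piS_def using rules(3)[of "co q" "free_basis A p"] bas[of p]
      cring.free_basis_closed[OF M_cring, of p UNIV] by simp
qed

lemma piS_zero: "piS 0 = \<zero>\<^bsub>S\<^esub>"
  using piS_rules(3)[of 0 0] piS_rules(1)[of 0] by simp

text \<open>Under \<open>piS\<close>, multiplication by a linear form depends only on the
  differential that the form represents. Applied to \<open>sec w\<close>, this undoes the passage to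
  coordinates.\<close>

lemma piS_mulv_hat:
  "f \<in> carrier FM \<Longrightarrow> piS (PL.mulv (nth_in 0 (hat f)) v) = sv (quo f) \<otimes>\<^bsub>S\<^esub> piS v"
proof (induction f rule: cring.free_module_induct[OF M_cring, consumes 1, case_names zero basis add])
  case zero
  have "sv \<zero>\<^bsub>Om\<^esub> = \<zero>\<^bsub>S\<^esub>"
    using sv_rules(2)[of "\<zero>\<^bsub>Om\<^esub>" "\<zero>\<^bsub>Om\<^esub>" "\<zero>\<^bsub>A\<^esub>"] by simp
  then show ?case
    using hat_zero module_hom_zero[OF FM.module_axioms Om.module_axioms quo_hom] piS_rules(1)[of v]
    by (simp add: shift_linear piS_zero)
next
  case (basis r x)
  have nth: "nth_in 0 (hat (r \<odot>\<^bsub>FM\<^esub> bas x)) = Poly_Mapping.single (0, x) (ua r)"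
    using basis A_one_closed ua_one_times[of r]
    by (simp add: hat_rules(2) hat_bas nth_in_def single1_def mult.commute del: free_module_simps)
  have q: "sv (quo (r \<odot>\<^bsub>FM\<^esub> bas x)) = r \<odot>\<^bsub>S\<^esub> svar (0, x)"
    using basis sv_rules(2)[of "dd x" "dd x" r]
    by (simp add: quo_rules dd_def[symmetric] svar_def del: free_module_simps)
  show ?case
    unfolding nth q
  proof (induction v rule: poly_mapping_add_induct)
    case zero
    then show ?case using basis by (simp add: piS_zero)
  next
    case (single p s)
    show ?case
      using basis smon_rules(3)
      by (simp add: PL.mulv_single piS_rules(4) smon_rules(2) SP.PA.smult_mult_left SP.PA.smult_mult_right
          SP.PA.smult_assoc1[symmetric] A_m_comm[of "co s" r])
  next
    case (add v w)
    then show ?case using basis by (simp add: PL.mulv_add_right piS_rules SP.PA.r_distr)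
  qed
next
  case (add f g)
  then show ?case
    by (simp add: hat_rules(1) shift_linear PL.mulv_add piS_rules quo_rules sv_rules(1) SP.PA.l_distr
        del: free_module_simps)
qed

lemma piS_mulw: "ws \<in> lists (carrier Om) \<Longrightarrow> piS (mulw ws) = word_val S sv ws"
proof (induction ws)
  case Nil
  show ?case
    using A_one_closed by (simp add: mulw_def v0_def piS_rules(4) smon_rules)
next
  case (Cons w ws)
  then have "w \<in> carrier Om" by simp
  then have "piS (mulw (w # ws)) = sv w \<otimes>\<^bsub>S\<^esub> piS (mulw ws)"
    using piS_mulv_hat[of "sec w" "mulw ws"] by (simp add: mulw_def hs_def sec_rules(1) sec(2))
  then show ?case using Cons by simp
qed

end

section \<open>The symbol map and its surjectivity\<close>

sublocale poisson_algebra \<subseteq> GF: filtered_algebra A EL F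
  by (rule env_filtered)

context poisson_algebra
begin

abbreviation GR where "GR \<equiv> gr_algebra EL F"

lemma GR_assoc: "assoc_algebra A GR"
proof -
  interpret GR: algebra A GR by (rule GF.GR_algebra)
  show ?thesis
  proof (intro assoc_algebra.intro assoc_algebra_axioms.intro GF.GR_module)
    show "ring GR" by (rule cring.axioms(1)[OF GR.M_cring])
    show "x \<otimes>\<^bsub>GR\<^esub> (a \<odot>\<^bsub>GR\<^esub> y) = a \<odot>\<^bsub>GR\<^esub> (x \<otimes>\<^bsub>GR\<^esub> y)"
      if "a \<in> carrier A" "x \<in> carrier GR" "y \<in> carrier GR" for a x y
      using module_homD(3)[OF GF.GR_mult_hom_right[OF that(2)] that(1,3)] .
  qed (rule GR.smult_assoc2)
qed

lemma homog_rules: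
  "u \<in> F n \<Longrightarrow> v \<in> F n \<Longrightarrow> GF.homog n (u \<oplus>\<^bsub>E\<^esub> v) = GF.homog n u \<oplus>\<^bsub>GR\<^esub> GF.homog n v"
  "r \<in> carrier A \<Longrightarrow> u \<in> F n \<Longrightarrow> GF.homog n (m r \<otimes>\<^bsub>E\<^esub> u) = r \<odot>\<^bsub>GR\<^esub> GF.homog n u"
  "u \<in> F i \<Longrightarrow> v \<in> F j \<Longrightarrow> GF.homog i u \<otimes>\<^bsub>GR\<^esub> GF.homog j v = GF.homog (i + j) (u \<otimes>\<^bsub>E\<^esub> v)"
  "\<one>\<^bsub>GR\<^esub> = GF.homog 0 \<one>\<^bsub>E\<^esub>"
  using module_homD[OF GF.homog_hom[of n]] GF.homog_mult GF.GR_one by (simp_all add: EL_simps)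

lemma homog_FP: "u \<in> FP n \<Longrightarrow> GF.homog n u = \<zero>\<^bsub>GR\<^esub>"
proof -
  assume u: "u \<in> FP n"
  then have "GF.hcls n u = FP n" using GF.hcls_eq_zero_iff[of u n] FP_F by blast
  then show ?thesis by (simp add: GF.homog_def GF.GR_simps fun_eq_iff)
qed

text \<open>The first two families of relations are respected because \<open>Hm\<close> and the
  passage to degree 1 are linear, the commutators because the graded algebra is commutative.\<close>

lemma ex_symbol:
  "\<exists>f. f \<in> ring_hom S GR \<and> f \<in> module_hom A S GR \<and> (\<forall>w\<in>carrier Om. f (sv w) = GF.homog 1 (Hm w))"
proof -
  interpret GA: assoc_algebra A GR by (rule GR_assoc)
  let ?t = "\<lambda>w. GF.homog 1 (Hm w)"
  have t: "?t \<in> carrier Om \<rightarrow> carrier GR"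
    using GF.homog_closed Hm_F by auto
  have tc: "?t w \<in> carrier GR" if "w \<in> carrier Om" for w using t that by auto
  let ?e = "lincomb A GR (word_val GR ?t)"
  have wc: "word_val GR ?t \<in> lists (carrier Om) \<rightarrow> carrier GR"
    using GA.word_val_closed[OF t] by blast
  have e: "?e \<in> module_hom A SP.FA GR"
    using GA.lincomb_hom(1)[OF wc] by (simp add: module_hom_def free_algebra_simps)
  have em: "?e (f \<otimes>\<^bsub>SP.FA\<^esub> g) = ?e f \<otimes>\<^bsub>GR\<^esub> ?e g" if "f \<in> carrier SP.FA" "g \<in> carrier SP.FA" for f g
    using GA.lincomb_word_mult[OF t] that by (simp add: free_algebra_simps)
  have ev: "?e (free_var A w) = ?t w" if "w \<in> carrier Om" for w
    using GA.lincomb_hom(2)[OF wc, of "[w]"] that GA.r_one[OF tc[OF that]] by (simp add: free_var_def)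
  have zero: "?e (u \<ominus>\<^bsub>SP.FA\<^esub> v) = \<zero>\<^bsub>GR\<^esub>"
    if "u \<in> carrier SP.FA" "v \<in> carrier SP.FA" "?e u = ?e v" for u v
    using module_hom_minus[OF SP.FA.module_self GA.module_self e that(1,2)] that module_homD(1)[OF e]
    by (simp add: GA.M.minus_eq_zero_iff)
  note simps = SP.free_var_closed ev em module_homD(2,3)[OF e] Hm_rules Hm_F homog_rules(1,2)
  have "?e z = \<zero>\<^bsub>GR\<^esub>" if "z \<in> symmetric_relations A Om" for z
    using that
  proof (cases rule: symmetric_relations_cases)
    case (add v w)
    then show ?thesis unfolding add(3) by (intro zero) (simp_all add: simps del: One_nat_def)
  next
    case (smult r w)
    then show ?thesis unfolding smult(3) by (intro zero) (simp_all add: simps del: One_nat_def)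
  next
    case (comm v w)
    then show ?thesis
      unfolding comm(3) by (intro zero) (simp_all add: simps GF.GR_m_comm[OF tc tc] del: One_nat_def)
  qed
  then show ?thesis using SP.PA_hom[OF GR_assoc t] by metis
qed

definition symb where
  "symb = (SOME f. f \<in> ring_hom S GR \<and> f \<in> module_hom A S GR \<and> (\<forall>w\<in>carrier Om. f (sv w) = GF.homog 1 (Hm w)))"

lemma symb: "symb \<in> ring_hom S GR" "symb \<in> module_hom A S GR"
  "w \<in> carrier Om \<Longrightarrow> symb (sv w) = GF.homog 1 (Hm w)"
  using someI_ex[OF ex_symbol] unfolding symb_def by auto

lemma sw_closed: "ws \<in> lists (carrier Om) \<Longrightarrow> word_val S sv ws \<in> carrier S"
  using SP.PA.word_val_closed[OF SP.var_closed] .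

lemma symb_word: "ws \<in> lists (carrier Om) \<Longrightarrow> symb (word_val S sv ws) = GF.homog (length ws) (Hw ws)"
proof (induction ws)
  case Nil
  then show ?case using ring_hom_one[OF symb(1)] by (simp add: homog_rules)
next
  case (Cons w ws)
  then have "symb (sv w \<otimes>\<^bsub>S\<^esub> word_val S sv ws) = symb (sv w) \<otimes>\<^bsub>GR\<^esub> symb (word_val S sv ws)"
    by (intro ring_hom_mult[OF symb(1)] sv_closed sw_closed) auto
  then show ?case using Cons Hm_F Hw_F by (simp add: symb homog_rules)
qed

text \<open>The graded algebra is generated over \<open>A\<close> in degree 1: the class in degree
  \<open>n\<close> of a word with \<open>n\<close> factors is the product of the classes of its
  factors.\<close>

lemma symb_surj: "symb ` carrier S = carrier GR"
proof
  show "symb ` carrier S \<subseteq> carrier GR" using module_homD(1)[OF symb(2)] by blast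
  have "GF.homog n u \<in> symb ` carrier S" if "u \<in> F n" for n u
    using that
  proof (induction u rule: F_induct)
    case (word a w)
    let ?s = "a \<odot>\<^bsub>S\<^esub> word_val S sv (map dd w)"
    show ?case
    proof (cases "length w = n")
      case True
      have "symb ?s = a \<odot>\<^bsub>GR\<^esub> symb (word_val S sv (map dd w))"
        using word by (intro module_homD(3)[OF symb(2)] sw_closed dd_lists)
      also have "\<dots> = GF.homog n (m a \<otimes>\<^bsub>E\<^esub> hw w)"
        using word True hw_F[of w n] symb_word[OF dd_lists[OF word(2)]]
        by (simp add: homog_rules Hw_dd)
      finally show ?thesis
        using word sw_closed[OF dd_lists[OF word(2)]] by (intro image_eqI[of _ _ ?s]) auto
    next
      case False
      \<comment> \<open>A word with fewer than \<open>n\<close> factors has class zero in degree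
        \<open>n\<close>.\<close>
      then have "hw w \<in> FP n"
        using word hw_F[of w "n - 1"] by (cases n) (auto simp: FP_simps)
      then have "GF.homog n (m a \<otimes>\<^bsub>E\<^esub> hw w) = \<zero>\<^bsub>GR\<^esub>"
        using word by (intro homog_FP FP_rules)
      moreover have "symb \<zero>\<^bsub>S\<^esub> = \<zero>\<^bsub>GR\<^esub>"
        by (rule module_hom_zero[OF SP.PA.module_self GF.GR_module symb(2)])
      ultimately show ?thesis by (metis SP.PA.M.zero_closed image_eqI)
    qed
  next
    case (add u v)
    then obtain s t where "s \<in> carrier S" "t \<in> carrier S" "GF.homog n u = symb s" "GF.homog n v = symb t"
      by blast
    then show ?case
      using add module_homD(2)[OF symb(2), of s t]
      by (intro image_eqI[of _ _ "s \<oplus>\<^bsub>S\<^esub> t"]) (auto simp: homog_rules)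
  qed
  note homog = this
  show "carrier GR \<subseteq> symb ` carrier S"
  proof
    fix u assume "u \<in> carrier GR"
    then show "u \<in> symb ` carrier S"
    proof (induction u rule: GF.GR_induct)
      case zero
      have "symb \<zero>\<^bsub>S\<^esub> = \<zero>\<^bsub>GR\<^esub>"
        by (rule module_hom_zero[OF SP.PA.module_self GF.GR_module symb(2)])
      then show ?case by (metis SP.PA.M.zero_closed image_eqI)
    next
      case (homog n x)
      then show ?case by (rule \<open>\<And>u n. u \<in> F n \<Longrightarrow> GF.homog n u \<in> symb ` carrier S\<close>)
    next
      case (add u v)
      then obtain s t where "s \<in> carrier S" "t \<in> carrier S" "u = symb s" "v = symb t" by blast
      then show ?case
        using module_homD(2)[OF symb(2), of s t] by (intro image_eqI[of _ _ "s \<oplus>\<^bsub>S\<^esub> t"]) auto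
    qed
  qed
qed

end

context projective_poisson
begin

section \<open>A left inverse of the symbol map\<close>

definition tau :: "nat \<Rightarrow> ('c env_gen list \<Rightarrow> 'a) set set \<Rightarrow> 'c uvec"
  where "tau n C = top_part n (rep (SOME x. x \<in> F n \<and> GF.hcls n x = C) v0)"

text \<open>Two representatives of a class differ by an element of lower filtration, whose action on
  \<open>v0\<close> has no part of degree \<open>n\<close>.\<close>

lemma tau_hcls: "x \<in> F n \<Longrightarrow> tau n (GF.hcls n x) = top_part n (rep x v0)"
proof -
  assume x: "x \<in> F n"
  define y where "y = (SOME y. y \<in> F n \<and> GF.hcls n y = GF.hcls n x)"
  have y: "y \<in> F n \<and> GF.hcls n y = GF.hcls n x"
    unfolding y_def by (rule someI[of _ x]) (use x in auto)
  then have d: "y \<ominus>\<^bsub>E\<^esub> x \<in> FP n" using GF.hcls_eq_iff[of y n x] x by (simp add: EL_minus)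
  have "y = (y \<ominus>\<^bsub>E\<^esub> x) \<oplus>\<^bsub>E\<^esub> x"
    using F_subset[of y n] F_subset[of x n] x y by (simp add: a_minus_def E.M.a_assoc E.M.l_neg)
  then have "rep y v0 = rep (y \<ominus>\<^bsub>E\<^esub> x) v0 + rep x v0"
    using rep_rules(2)[of "y \<ominus>\<^bsub>E\<^esub> x" x v0] F_subset[of y n] F_subset[of x n] x y by simp
  then show ?thesis
    using top_rep_FP[OF d] by (simp add: tau_def y_def[symmetric] top_part_add)
qed

lemma tau_rules:
  assumes C: "C \<in> carrier (gr_piece EL F n)"
  shows "D \<in> carrier (gr_piece EL F n) \<Longrightarrow> tau n (C \<oplus>\<^bsub>gr_piece EL F n\<^esub> D) = tau n C + tau n D"
    "r \<in> carrier A \<Longrightarrow> tau n (r \<odot>\<^bsub>gr_piece EL F n\<^esub> C) = scl (ua r) (tau n C)"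
proof -
  obtain x where x: "x \<in> F n" "C = GF.hcls n x" using C by (auto simp: GF.G_facts)
  show "tau n (C \<oplus>\<^bsub>gr_piece EL F n\<^esub> D) = tau n C + tau n D" if D: "D \<in> carrier (gr_piece EL F n)"
  proof -
    obtain y where y: "y \<in> F n" "D = GF.hcls n y" using D by (auto simp: GF.G_facts)
    show ?thesis
      using x y by (simp add: GF.G_facts tau_hcls EL_simps F_rules rep_rules F_subset top_part_add)
  qed
  show "tau n (r \<odot>\<^bsub>gr_piece EL F n\<^esub> C) = scl (ua r) (tau n C)" if "r \<in> carrier A"
    using x that by (simp add: GF.G_facts tau_hcls EL_simps F_rules rep_rules rep_mh F_subset top_part_scl)
qed

lemma tau_FP: "tau n (FP n) = 0"
proof -
  have "FP n = GF.hcls n \<zero>\<^bsub>E\<^esub>"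
    using GF.hcls_eq_zero_iff[of "\<zero>\<^bsub>E\<^esub>" n] F_rules(1) FP_rules(1) by simp
  then show ?thesis by (simp add: tau_hcls F_rules rep_zero)
qed

definition Tau :: "(nat \<Rightarrow> ('c env_gen list \<Rightarrow> 'a) set set) \<Rightarrow> 'c uvec"
  where "Tau u = (\<Sum>n | u n \<noteq> FP n. tau n (u n))"

lemma Tau_superset: "finite T \<Longrightarrow> {n. u n \<noteq> FP n} \<subseteq> T \<Longrightarrow> Tau u = (\<Sum>n\<in>T. tau n (u n))"
  unfolding Tau_def by (rule sum.mono_neutral_left) (auto simp: tau_FP)

lemma Tau_rules:
  assumes u: "u \<in> carrier GR"
  shows "v \<in> carrier GR \<Longrightarrow> Tau (u \<oplus>\<^bsub>GR\<^esub> v) = Tau u + Tau v"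
    "r \<in> carrier A \<Longrightarrow> Tau (r \<odot>\<^bsub>GR\<^esub> u) = scl (ua r) (Tau u)"
proof -
  interpret GR: module A GR by (rule GF.GR_module)
  have c: "w n \<in> carrier (gr_piece EL F n)" "finite {n. w n \<noteq> FP n}" if "w \<in> carrier GR" for w n
    using that by (simp_all add: GF.GR_simps)
  show "Tau (u \<oplus>\<^bsub>GR\<^esub> v) = Tau u + Tau v" if v: "v \<in> carrier GR"
  proof -
    let ?w = "u \<oplus>\<^bsub>GR\<^esub> v"
    let ?T = "{n. u n \<noteq> FP n} \<union> {n. v n \<noteq> FP n} \<union> {n. ?w n \<noteq> FP n}"
    have T: "finite ?T" using c(2)[OF u] c(2)[OF v] c(2)[OF GR.M.a_closed[OF u v]] by simp
    have "Tau ?w = (\<Sum>n\<in>?T. tau n (?w n))" using T by (rule Tau_superset) blast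
    also have "\<dots> = (\<Sum>n\<in>?T. tau n (u n)) + (\<Sum>n\<in>?T. tau n (v n))"
      unfolding sum.distrib[symmetric] using c(1)[OF u] c(1)[OF v]
      by (intro sum.cong) (auto simp: GF.GR_simps(3) tau_rules)
    also have "(\<Sum>n\<in>?T. tau n (u n)) = Tau u" using T by (rule Tau_superset[symmetric]) blast
    also have "(\<Sum>n\<in>?T. tau n (v n)) = Tau v" using T by (rule Tau_superset[symmetric]) blast
    finally show ?thesis .
  qed
  show "Tau (r \<odot>\<^bsub>GR\<^esub> u) = scl (ua r) (Tau u)" if r: "r \<in> carrier A"
  proof -
    let ?w = "r \<odot>\<^bsub>GR\<^esub> u"
    let ?T = "{n. u n \<noteq> FP n} \<union> {n. ?w n \<noteq> FP n}"
    have T: "finite ?T" using c(2)[OF u] c(2)[OF GR.smult_closed[OF r u]] by simp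
    have "Tau ?w = (\<Sum>n\<in>?T. tau n (?w n))" using T by (rule Tau_superset) blast
    also have "\<dots> = scl (ua r) (\<Sum>n\<in>?T. tau n (u n))"
      unfolding scl_sum using c(1)[OF u] r by (intro sum.cong) (auto simp: GF.GR_simps(4) tau_rules)
    also have "(\<Sum>n\<in>?T. tau n (u n)) = Tau u" using T by (rule Tau_superset[symmetric]) blast
    finally show ?thesis .
  qed
qed

lemma Tau_homog: "x \<in> F n \<Longrightarrow> Tau (GF.homog n x) = top_part n (rep x v0)"
proof -
  assume x: "x \<in> F n"
  have "{k. GF.homog n x k \<noteq> FP k} \<subseteq> {n}" by (auto simp: GF.homog_def split: if_splits)
  then have "Tau (GF.homog n x) = (\<Sum>k\<in>{n}. tau k (GF.homog n x k))"
    by (intro Tau_superset) auto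
  then show ?thesis using x by (simp add: GF.homog_def tau_hcls)
qed

text \<open>This is the injectivity half, the Poincare-Birkhoff-Witt statement. On a word,
  \<open>symb\<close> gives the class of the corresponding product in the enveloping algebra,
  \<open>Tau\<close> reads off the product of linear forms by \<open>top_rep_word\<close>, and
  \<open>piS\<close> turns these back into differentials.\<close>

lemma Tau_symb: "z \<in> carrier S \<Longrightarrow> piS (Tau (symb z)) = z"
proof (induction z rule: SP.PA_induct)
  case (word r w)
  have "symb (r \<odot>\<^bsub>S\<^esub> word_val S sv w) = r \<odot>\<^bsub>GR\<^esub> GF.homog (length w) (Hw w)"
    using word by (simp add: module_homD(3)[OF symb(2)] sw_closed symb_word)
  moreover have "GF.homog (length w) (Hw w) \<in> carrier GR" using word Hw_F by (intro GF.homog_closed)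
  ultimately have "Tau (symb (r \<odot>\<^bsub>S\<^esub> word_val S sv w)) = scl (ua r) (mulw w)"
    using word Hw_F by (simp add: Tau_rules Tau_homog top_rep_word)
  then show ?case using word by (simp add: piS_rules piS_mulw)
next
  case (add y z)
  then show ?case
    using module_homD[OF symb(2)] by (simp add: Tau_rules piS_rules)
qed

theorem symb_iso: "algebra_isomorphic A S GR"
proof -
  have "inj_on symb (carrier S)"
    using Tau_symb by (rule inj_on_inverseI[where g = "\<lambda>u. piS (Tau u)"])
  then have "symb \<in> ring_iso S GR"
    using symb(1) symb_surj by (simp add: ring_iso_def bij_betw_def)
  then show ?thesis
    unfolding algebra_isomorphic_def
    using S_algebra GF.GR_algebra module_homD(3)[OF symb(2)] by blast
qed

end

theorem corollary5p8:
  fixes K :: "('k, 'p) ring_scheme" and A :: "('k, 'a, 'q) module_scheme"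
    and br :: "'a \<Rightarrow> 'a \<Rightarrow> 'a"
  assumes "poisson_algebra K A br"
    and "projective_module A (kaehler K A)"
  shows "algebra_isomorphic A
    (symmetric_algebra A (kaehler K A))
    (gr_algebra (poisson_env_left K A br) (env_filtration K A br))"
proof -
  interpret projective_poisson K A br
    using assms by (intro projective_poisson.intro projective_poisson_axioms.intro)
  show ?thesis unfolding S_eq by (rule symb_iso)
qed

end
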